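(* Let $q$ be a prime number. For any $\alpha,\beta\in[-1,1]$ with $\alpha<\beta$, $$\lim_{\nu\to\infty}\frac{\mu_{q^\nu}([\alpha,\beta])}{\mu_{q^\nu}([-1,1])}=\lim_{\nu\to\infty}\frac{1-q^{-1}}{2q^\nu}\sum_{\substack{t\in\mathbb{Z}\\ \alpha\le \frac{t}{2q^{\nu/2}}\le\beta}}H(4q^\nu-t^2)=\frac{2}{\pi}\int_\alpha^\beta\sqrt{1-x^2}\,dx,$$ where in the middle expression only $t$ with $t^2<4q^\nu$ occur (i.e. $H(D)$ is taken to be $0$ for $D\le 0$); in particular both limits exist.
   Context: For an integer $D>0$ with $D\equiv 0,3\pmod 4$, the Hurwitz class number is $H(D)=\sum_Q \frac{1}{\#\Gamma_Q}$, where $Q$ runs over $\mathrm{PSL}_2(\mathbb{Z})$-equivalence classes of positive definite integral binary quadratic forms of discriminant $-D$ and $\Gamma_Q$ is the stabilizer of $Q$ in $\mathrm{PSL}_2(\mathbb{Z})$. For $m\in\mathbb{N}$, $\mu_m$ is the discrete measure on $[-1,1]$ given by $\mu_m=\sum_{t\in\mathbb{Z},\,t^2<4m}H(4m-t^2)\,\delta_{t/(2\sqrt m)}$, where $\delta_a$ is the Dirac measure at $a$. *)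

theory Defs
  imports "HOL-Analysis.Analysis" "HOL-Computational_Algebra.Primes"
begin

text \<open>Integral binary quadratic forms Q(x,y) = a x^2 + b x y + c y^2, encoded as (a,b,c).\<close>
type_synonym bqf = "int \<times> int \<times> int"

definition bqf_disc :: "bqf \<Rightarrow> int" where
  "bqf_disc Q = (case Q of (a,b,c) \<Rightarrow> b^2 - 4*a*c)"

definition bqf_eval :: "bqf \<Rightarrow> int \<Rightarrow> int \<Rightarrow> int" where
  "bqf_eval Q x y = (case Q of (a,b,c) \<Rightarrow> a*x^2 + b*x*y + c*y^2)"

definition bqf_posdef :: "bqf \<Rightarrow> bool" where
  "bqf_posdef Q = (\<forall>x y. (x,y) \<noteq> (0,0) \<longrightarrow> bqf_eval Q x y > 0)"

text \<open>2x2 integer matrices [[p,q],[r,s]] encoded as (p,q,r,s); SL2(Z).\<close>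
type_synonym mat2 = "int \<times> int \<times> int \<times> int"

definition SL2Z :: "mat2 set" where
  "SL2Z = {(p,q,r,s). p * s - q * r = 1}"

definition mat2_neg :: "mat2 \<Rightarrow> mat2" where
  "mat2_neg g = (case g of (p,q,r,s) \<Rightarrow> (-p,-q,-r,-s))"

text \<open>Action (Q.g)(x,y) = Q(p x + q y, r x + s y).\<close>
definition bqf_act :: "bqf \<Rightarrow> mat2 \<Rightarrow> bqf" where
  "bqf_act Q g = (case Q of (a,b,c) \<Rightarrow> case g of (p,q,r,s) \<Rightarrow>
     (a*p^2 + b*p*r + c*r^2, 2*a*p*q + b*(p * s + q * r) + 2*c * r * s, a*q^2 + b * q * s + c * s^2))"

definition PSL2Z :: "mat2 set set" where
  "PSL2Z = {{g, mat2_neg g} | g. g \<in> SL2Z}"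

text \<open>Stabilizer of Q in PSL2(Z) (-I acts trivially, so this is well defined).\<close>
definition PSL2_stab :: "bqf \<Rightarrow> mat2 set set" where
  "PSL2_stab Q = {{g, mat2_neg g} | g. g \<in> SL2Z \<and> bqf_act Q g = Q}"

definition posdef_forms :: "int \<Rightarrow> bqf set" where
  "posdef_forms D = {Q. bqf_posdef Q \<and> bqf_disc Q = -D}"

definition bqf_orbit :: "bqf \<Rightarrow> bqf set" where
  "bqf_orbit Q = {bqf_act Q g | g. g \<in> SL2Z}"

definition form_classes :: "int \<Rightarrow> bqf set set" where
  "form_classes D = bqf_orbit ` posdef_forms D"

text \<open>Hurwitz class number H(D) = sum over classes of 1/#Gamma_Q.
  For D <= 0 (or D not 0,3 mod 4) there are no forms and H(D) = 0.\<close>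
definition hurwitz :: "int \<Rightarrow> real" where
  "hurwitz D = (\<Sum>C\<in>form_classes D. 1 / real (card (PSL2_stab (SOME Q. Q \<in> C))))"

definition mu :: "nat \<Rightarrow> real set \<Rightarrow> real" where
  "mu m S = (\<Sum>t\<in>{t::int. t^2 < 4 * int m \<and> real_of_int t / (2 * sqrt (real m)) \<in> S}.
               hurwitz (4 * int m - t^2))"

end

theory Submission
  imports Defs "HOL-Number_Theory.Number_Theory" "HOL-Real_Asymp.Real_Asymp"
begin

text \<open>
  Put \<open>m = q^\<nu>\<close> and \<open>X = sqrt m\<close>. By reduction theory, the sum of \<open>H(4m - t\<^sup>2)\<close> over a range of \<open>t\<close> lies
  between the number of forms \<open>(a, b, c)\<close> of these discriminants with \<open>|b| < a < c\<close> and the number of those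
  with \<open>|b| \<le> a \<le> c\<close>, so stabilizers and boundary identifications never matter. With \<open>x = (t - b)/2\<close> and
  \<open>y = (t + b)/2\<close> these forms become integer triples \<open>(a, x, y)\<close> with \<open>x y = m (mod a)\<close> in a region that
  scales with \<open>X\<close>. It is therefore enough to show that the points \<open>(a/X, x/a, y/a)\<close>, the last two coordinates
  taken modulo 1, become equidistributed with respect to a multiple of \<open>s ds du dv\<close>. By the Stone-Weierstrass
  theorem this is a statement on exponential sums. Sorting by \<open>gcd(x, a) = q^i\<close> turns them into
  Kloosterman sums, for which the elementary bound \<open>|K|^4 \<le> C a^3 d(a)^3\<close> suffices; it comes from the fourth moment
  and the invariance of \<open>K(h, k)\<close> under \<open>(h, k) \<mapsto> (h u, k/u)\<close>. The main term is the mean value of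
  Euler's function, hence a factor \<open>1/\<zeta>(2) = 6/\<pi>\<^sup>2\<close>, and the sum over \<open>i\<close> contributes \<open>1/(1 - 1/q)\<close>.
  Finally, in suitable coordinates the volume of the region is the product of \<open>2\<pi>/3\<close>, twice the hyperbolic area of the
  modular domain, and the integral of \<open>sqrt(1 - x\<^sup>2)\<close>.
\<close>

section \<open>Reduced forms\<close>

text \<open>Only limits are needed, never rates. Since x y = q^nu modulo a, gcd(x, a) divides q^nu
  and is therefore a power q^i. The solutions with this gcd make up a share O(q^(-i)) of all points,
  uniformly in nu, so dominated convergence over i replaces estimates uniform in nu. At a nontrivial
  frequency the bound saves only about a^(1/4), up to divisor functions, but after averaging over a
  any power saved over the trivial bound a is enough. The main obstacle is that the region is not
  compact: with s = a/X, u = x/a, v = y/a, the conditions leave u and v unbounded as s tends to 0,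
  whereas the torus sees u and v only modulo 1. The region is therefore cut into unit cells in (u,
  v). Equidistribution handles the cells with indices up to J, and a direct count shows that only
  O(X^2/J) triples lie in the others. The counts of strictly and of weakly reduced forms lead to
  regions of equal volume, so the two bounds meet in the limit.\<close>

definition wred :: "int \<Rightarrow> bqf set" where
  "wred D = {(a,b,c). 0 < a \<and> \<bar>b\<bar> \<le> a \<and> a \<le> c \<and> b^2 - 4*a*c = -D}"

definition sred :: "int \<Rightarrow> bqf set" where
  "sred D = {(a,b,c). 0 < a \<and> \<bar>b\<bar> < a \<and> a < c \<and> b^2 - 4*a*c = -D}"

lemma sred_subset_wred: "sred D \<subseteq> wred D"
  by (auto simp: sred_def wred_def)

section \<open>The group SL2(Z) and its action on forms\<close>

fun mat2_mul :: "mat2 \<Rightarrow> mat2 \<Rightarrow> mat2" where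
  "mat2_mul (p,q,r,s) (t,u,v,w) = (p * t + q * v, p * u + q * w, r * t + s * v, r * u + s * w)"

fun mat2_inv :: "mat2 \<Rightarrow> mat2" where
  "mat2_inv (p,q,r,s) = (s,-q,-r,p)"

lemma SL2Z_mul: "g \<in> SL2Z \<Longrightarrow> h \<in> SL2Z \<Longrightarrow> mat2_mul g h \<in> SL2Z"
proof (cases g; cases h)
  fix p q r s t u v w assume g: "g \<in> SL2Z" "h \<in> SL2Z" "g = (p,q,r,s)" "h = (t,u,v,w)"
  have "(p * t + q * v) * (r * u + s * w) - (p * u + q * w) * (r * t + s * v) = (p * s - q * r) * (t * w - u * v)"
    by Groebner_Basis.algebra
  then show "mat2_mul g h \<in> SL2Z" using g by (simp add: SL2Z_def)
qed

lemma SL2Z_inv: "g \<in> SL2Z \<Longrightarrow> mat2_inv g \<in> SL2Z"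
  by (cases g) (auto simp: SL2Z_def algebra_simps)

lemma mat2_one_in_SL2Z: "(1,0,0,1) \<in> SL2Z"
  by (simp add: SL2Z_def)

lemma mat2_mul_assoc: "mat2_mul (mat2_mul f g) h = mat2_mul f (mat2_mul g h)"
  by (cases f; cases g; cases h) (simp add: algebra_simps)

lemma mat2_mul_inv: 
  assumes "g \<in> SL2Z" 
  shows "mat2_mul g (mat2_inv g) = (1,0,0,1)" "mat2_mul (mat2_inv g) g = (1,0,0,1)"
  using assms by (cases g; auto simp: SL2Z_def algebra_simps)+

lemma bqf_act_one: "bqf_act Q (1,0,0,1) = Q"
  by (cases Q) (simp add: bqf_act_def)

lemma bqf_act_mul: "bqf_act (bqf_act Q g) h = bqf_act Q (mat2_mul g h)"
proof (cases Q; cases g; cases h)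
  fix a b c p q r s t u v w
  assume Q: "Q = (a,b,c)" "g = (p,q,r,s)" "h = (t,u,v,w)"
  show ?thesis unfolding Q by (simp add: bqf_act_def) (intro conjI; Groebner_Basis.algebra)
qed

lemma bqf_eval_act: "bqf_eval (bqf_act Q (p,q,r,s)) x y = bqf_eval Q (p*x + q*y) (r*x + s * y)"
  by (cases Q) (simp add: bqf_act_def bqf_eval_def algebra_simps power2_eq_square)

lemma bqf_disc_act: "g \<in> SL2Z \<Longrightarrow> bqf_disc (bqf_act Q g) = bqf_disc Q"
proof (cases Q; cases g)
  fix a b c p q r s :: int
  assume g: "g \<in> SL2Z" and Q: "Q = (a,b,c)" "g = (p,q,r,s)"
  have "bqf_disc (bqf_act Q g) = bqf_disc Q * (p * s - q * r)^2"
    unfolding Q by (simp add: bqf_act_def bqf_disc_def algebra_simps power2_eq_square)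
  then show ?thesis using g Q by (simp add: SL2Z_def)
qed

lemma bqf_posdef_act: 
  assumes "g \<in> SL2Z" "bqf_posdef Q" shows "bqf_posdef (bqf_act Q g)"
proof (cases g)
  fix p q r s assume g: "g = (p,q,r,s)"
  with assms have d: "p * s - q * r = 1" by (simp add: SL2Z_def)
  show ?thesis unfolding bqf_posdef_def g bqf_eval_act
  proof (intro allI impI)
    fix x y :: int assume xy: "(x,y) \<noteq> (0,0)"
    have "x = s * (p*x + q*y) - q*(r*x+s * y)" "y = p*(r*x + s * y) - r*(p*x + q*y)"
      using d by Groebner_Basis.algebra+
    then have "(p*x+q*y, r*x + s * y) \<noteq> (0,0)" using xy by auto
    then show "0 < bqf_eval Q (p*x + q*y) (r*x + s * y)" using assms(2) unfolding bqf_posdef_def by blast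
  qed
qed

text \<open>Because |b| <= a <= c, the value is at least a (x^2 - |x y| + y^2). The bracket is a
  positive integer, since four times it equals (2|x| - |y|)^2 + 3 y^2. Both positive definiteness
  and uniqueness of reduced forms rest on this minimum.\<close>

lemma wred_eval_ge:
  assumes "(a,b,c) \<in> wred D" "(x,y) \<noteq> (0,0)"
  shows "a \<le> bqf_eval (a,b,c) x y"
proof -
  have a: "0 < a" "\<bar>b\<bar> \<le> a" "a \<le> c" using assms by (auto simp: wred_def)
  have q: "x^2 - \<bar>x*y\<bar> + y^2 \<ge> 1"
  proof -
    have calc: "4 * (x^2 - \<bar>x*y\<bar> + y^2) = (2*\<bar>x\<bar> - \<bar>y\<bar>)^2 + 3*y^2"
    proof -
      have "4*(k^2-k*l+l^2) = (2*k-l)^2+3*l^2" for k l :: int by Groebner_Basis.algebra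
      from this[of "\<bar>x\<bar>" "\<bar>y\<bar>"] show ?thesis by (simp add: abs_mult)
    qed
    have "4 * (x^2 - \<bar>x*y\<bar> + y^2) > 0"
    proof (cases "y = 0")
      case True then show ?thesis using assms by simp
    next
      case False then have "3*y^2 > 0" by simp
      moreover have "(2*\<bar>x\<bar> - \<bar>y\<bar>)^2 \<ge> 0" by simp
      ultimately show ?thesis using calc by linarith
    qed
    moreover have "4*k > 0 \<Longrightarrow> 1 \<le> k" for k :: int by simp
    ultimately show ?thesis by blast
  qed
  have "\<bar>b*x*y\<bar> \<le> a * \<bar>x*y\<bar>" using a by (simp add: abs_mult mult.assoc mult_right_mono)
  moreover have "a*y^2 \<le> c*y^2" using a by (simp add: mult_right_mono)
  ultimately have "bqf_eval (a,b,c) x y \<ge> a * (x^2 - \<bar>x*y\<bar> + y^2)"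
    by (simp add: bqf_eval_def algebra_simps)
  moreover have "a * (x^2 - \<bar>x*y\<bar> + y^2) \<ge> a * 1" using a q by (intro mult_left_mono) auto
  ultimately show ?thesis by linarith
qed

lemma wred_posdef: "Q \<in> wred D \<Longrightarrow> Q \<in> posdef_forms D"
proof (cases Q)
  fix a b c assume *: "Q \<in> wred D" "Q = (a,b,c)"
  then have "0 < a" "bqf_disc Q = -D" by (auto simp: wred_def bqf_disc_def)
  moreover have "bqf_posdef Q" unfolding bqf_posdef_def
  proof (intro allI impI)
    fix x y :: int assume "(x,y) \<noteq> (0,0)"
    then have "a \<le> bqf_eval (a,b,c) x y" using wred_eval_ge *(1) unfolding *(2) by blast
    then show "0 < bqf_eval Q x y" using \<open>0 < a\<close> *(2) by simp
  qed
  ultimately show ?thesis by (simp add: posdef_forms_def)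
qed

text \<open>Gauss reduction as a minimality argument: in the orbit take a form with least leading
  coefficient a. A translation brings b into range without changing a. The matrix (0,-1,1,0) then
  makes c the leading coefficient of an equivalent form, so minimality yields a <= c.\<close>

lemma posdef_equiv_wred:
  assumes "Q \<in> posdef_forms D"
  obtains g where "g \<in> SL2Z" "bqf_act Q g \<in> wred D"
proof -
  \<comment> \<open>\<open>nat\<close> gives access to the least-number principle; leading
    coefficients of positive definite forms are positive, so nothing is lost.\<close>
  define P where "P n \<longleftrightarrow> (\<exists>g\<in>SL2Z. nat (fst (bqf_act Q g)) = n)" for n
  have ex: "P (nat (fst (bqf_act Q (1,0,0,1))))" unfolding P_def using mat2_one_in_SL2Z by blast
  define n where "n = (LEAST n. P n)"
  have Pn: "P n" unfolding n_def using ex by (rule LeastI)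
  have least: "n \<le> k" if "P k" for k unfolding n_def using that by (rule Least_le)
  obtain g where g: "g \<in> SL2Z" "nat (fst (bqf_act Q g)) = n" using Pn unfolding P_def by blast
  obtain a b c where abc: "bqf_act Q g = (a,b,c)" by (cases "bqf_act Q g")
  have pd: "bqf_posdef (bqf_act Q g)" "bqf_disc (bqf_act Q g) = -D"
    using assms g bqf_posdef_act bqf_disc_act by (auto simp: posdef_forms_def)
  have a0: "a > 0" using pd(1)[unfolded bqf_posdef_def, rule_format, of 1 0] by (simp add: abc bqf_eval_def)
  \<comment> \<open>With this translation b' = a - ((a - b) mod (2 a)), which lies in the half-open
    interval (-a, a].\<close>
  define k where "k = (a - b) div (2*a)"
  define b' where "b' = b + 2*a*k"
  have b': "b' = a - (a-b) mod (2*a)"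
    unfolding b'_def k_def using mult_div_mod_eq[of "2*a" "a-b"] by linarith
  have b'1: "\<bar>b'\<bar> \<le> a" using a0 pos_mod_bound[of "2*a" "a-b"] pos_mod_sign[of "2*a" "a-b"] unfolding b' by linarith
  define h where "h = mat2_mul g (1,k,0,1)"
  have h: "h \<in> SL2Z" unfolding h_def by (rule SL2Z_mul[OF g(1)]) (simp add: SL2Z_def)
  define c' where "c' = a*k^2+b*k+c"
  have hQ: "bqf_act Q h = (a,b',c')" unfolding h_def bqf_act_mul[symmetric] abc
    by (simp add: bqf_act_def b'_def c'_def)
  define h2 where "h2 = mat2_mul h (0,-1,1,0)"
  have h2: "h2 \<in> SL2Z" unfolding h2_def by (rule SL2Z_mul[OF h]) (simp add: SL2Z_def)
  have h2Q: "bqf_act Q h2 = (c',-b',a)" unfolding h2_def bqf_act_mul[symmetric] hQ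
    by (simp add: bqf_act_def)
  have "P (nat c')" unfolding P_def using h2 h2Q by (intro bexI[of _ h2]) auto
  then have "nat a \<le> nat c'" using least g(2) abc by auto
  then have "a \<le> c'" using a0 by linarith
  moreover have "b'^2 - 4*a*c' = -D" using bqf_disc_act[OF h, of Q] hQ assms
    by (simp add: bqf_disc_def posdef_forms_def)
  ultimately have "bqf_act Q h \<in> wred D" using a0 b'1 hQ by (simp add: wred_def)
  with h show ?thesis using that by blast
qed

text \<open>The form is the sum of (a, b, a), to which \<open>wred_eval_ge\<close> applies with its
  own discriminant, and of (c - a) y^2, which is positive for nonzero y.\<close>

lemma sred_eval_gt:
  assumes "(a,b,c) \<in> sred D" "y \<noteq> 0"
  shows "a < bqf_eval (a,b,c) x y"
proof -
  have a: "0 < a" "\<bar>b\<bar> < a" "a < c" using assms by (auto simp: sred_def)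
  have y: "y^2 \<ge> 1" using assms(2) by (simp add: int_one_le_iff_zero_less)
  have "a < a + (c-a)*1" using a by simp
  also have "\<dots> \<le> bqf_eval (a,b,a) x y + (c-a)*y^2"
  proof (rule add_mono)
    show "a \<le> bqf_eval (a,b,a) x y"
      by (rule wred_eval_ge[of a b a "-(b^2-4*a*a)"]) (use a assms in \<open>auto simp: wred_def\<close>)
    show "(c-a)*1 \<le> (c-a)*y^2" using a y by (intro mult_left_mono) auto
  qed
  also have "\<dots> = bqf_eval (a,b,c) x y"
    by (simp add: bqf_eval_def algebra_simps)
  finally show ?thesis .
qed

text \<open>The image form represents a, so its minimum a' is at most a. On the other hand a' = Q(p,
  r) exceeds a unless r = 0. Then \<open>g\<close> is a translation up to sign, which moves b by 2 a
  p q, and |b| < a together with |b'| <= a leaves only q = 0.\<close>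

lemma sred_unique:
  assumes Q: "Q \<in> sred D" and g: "g \<in> SL2Z" and Q': "bqf_act Q g \<in> wred D'"
  shows "g = (1,0,0,1) \<or> g = (-1,0,0,-1)"
proof -
  obtain a b c where abc: "Q = (a,b,c)" by (cases Q)
  obtain p q r s where pq: "g = (p,q,r,s)" by (cases g)
  obtain a' b' c' where abc': "bqf_act Q g = (a',b',c')" by (cases "bqf_act Q g")
  have a: "0 < a" "\<bar>b\<bar> < a" "a < c" using Q by (auto simp: sred_def abc)
  have d: "p * s - q * r = 1" using g by (simp add: SL2Z_def pq)
  \<comment> \<open>The vector (s, -r) is the first column of the inverse of \<open>g\<close>, so
    the transformed form takes there the value Q(1, 0) = a.\<close>
  have "a' \<le> bqf_eval (a',b',c') s (-r)"
    by (rule wred_eval_ge[of _ _ _ D']) (use Q' abc' d in auto)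
  also have "\<dots> = bqf_eval (a,b,c) (p * s - q * r) 0"
    unfolding abc'[symmetric] pq bqf_eval_act abc by (simp add: algebra_simps)
  finally have le: "a' \<le> a" unfolding d by (simp add: bqf_eval_def)
  have a': "a' = bqf_eval (a,b,c) p r" using abc' by (simp add: bqf_act_def abc pq bqf_eval_def)
  have r: "r = 0" using sred_eval_gt[of a b c D r p] Q abc a' le by fastforce
  have ps: "p * s = 1" using d r by simp
  then have pp: "(p = 1 \<and> s = 1) \<or> (p = -1 \<and> s = -1)" by (simp add: zmult_eq_1_iff)
  have "a' = a" using a' pp r by (auto simp: bqf_eval_def)
  moreover have "b' = 2*a*(p*q) + b" using abc' pp r by (auto simp: bqf_act_def abc pq)
  moreover have "\<bar>b'\<bar> \<le> a'" using Q' abc' by (simp add: wred_def)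
  ultimately have "\<bar>2*a*(p*q)\<bar> < 2*a" using a by linarith
  then have "2*a*\<bar>p*q\<bar> < 2*a*1" using a by (simp add: abs_mult)
  then have "\<bar>p*q\<bar> < 1" using a by (simp only: mult_less_cancel_left_pos)
  then have "q = 0" using pp by auto
  with pp r pq show ?thesis by auto
qed

lemma wred_bounds:
  assumes "(a,b,c) \<in> wred D"
  shows "3*a^2 \<le> D" "a \<le> D" "\<bar>b\<bar> \<le> D" "c \<le> D"
proof -
  have a: "0 < a" "\<bar>b\<bar> \<le> a" "a \<le> c" and D: "D = 4*a*c - b^2" using assms by (auto simp: wred_def)
  have "b^2 \<le> a^2" using a by (simp add: abs_le_square_iff[symmetric])
  moreover have ac: "a*a \<le> a*c" using a by (simp add: mult_left_mono)
  ultimately show 1: "3*a^2 \<le> D" unfolding D by (simp add: power2_eq_square)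
  have "a*1 \<le> a*a" using a by (intro mult_left_mono) auto
  then have "a \<le> a^2" by (simp add: power2_eq_square)
  then show 2: "a \<le> D" using 1 a by linarith
  then show "\<bar>b\<bar> \<le> D" using a by linarith
  have "1*c \<le> a*c" using a by (intro mult_right_mono) auto
  moreover have "D = 4*(a*c) - b^2" unfolding D by simp
  moreover have "b^2 \<le> a*c" "0 \<le> a*a" using \<open>b^2 \<le> a^2\<close> ac by (auto simp: power2_eq_square)
  ultimately show "c \<le> D" using ac by linarith
qed

lemma finite_wred: "finite (wred D)"
proof (rule finite_subset)
  show "wred D \<subseteq> {-D..D} \<times> {-D..D} \<times> {-D..D}"
  proof
    fix Q assume "Q \<in> wred D"
    moreover obtain a b c where "Q = (a,b,c)" by (cases Q)
    ultimately show "Q \<in> {-D..D} \<times> {-D..D} \<times> {-D..D}"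
      using wred_bounds[of a b c D] by (auto simp: wred_def)
  qed
qed auto

section \<open>Orbits, stabilizers and class numbers\<close>

lemma bqf_orbit_self: "Q \<in> bqf_orbit Q"
  unfolding bqf_orbit_def mem_Collect_eq using mat2_one_in_SL2Z bqf_act_one[of Q] by metis

lemma bqf_orbit_act: 
  assumes g: "g \<in> SL2Z" shows "bqf_orbit (bqf_act Q g) = bqf_orbit Q"
proof (intro equalityI subsetI)
  fix x assume "x \<in> bqf_orbit (bqf_act Q g)"
  then obtain h where "h \<in> SL2Z" "x = bqf_act Q (mat2_mul g h)" unfolding bqf_orbit_def bqf_act_mul by blast
  then show "x \<in> bqf_orbit Q" unfolding bqf_orbit_def using SL2Z_mul[OF g] by blast
next
  fix x assume "x \<in> bqf_orbit Q"
  then obtain h where h: "h \<in> SL2Z" "x = bqf_act Q h" unfolding bqf_orbit_def by auto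
  have "x = bqf_act (bqf_act Q g) (mat2_mul (mat2_inv g) h)"
    unfolding bqf_act_mul mat2_mul_assoc[symmetric] mat2_mul_inv[OF g] h(2)
    by (cases h) simp
  then show "x \<in> bqf_orbit (bqf_act Q g)" unfolding bqf_orbit_def using SL2Z_mul SL2Z_inv g h by blast
qed

lemma form_classes_wred: "form_classes D = bqf_orbit ` wred D"
proof
  show "form_classes D \<subseteq> bqf_orbit ` wred D"
  proof
    fix C assume "C \<in> form_classes D"
    then obtain Q where Q: "Q \<in> posdef_forms D" "C = bqf_orbit Q" by (auto simp: form_classes_def)
    obtain g where g: "g \<in> SL2Z" "bqf_act Q g \<in> wred D" using posdef_equiv_wred[OF Q(1)] .
    then show "C \<in> bqf_orbit ` wred D" using bqf_orbit_act[OF g(1)] Q(2) by blast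
  qed
  show "bqf_orbit ` wred D \<subseteq> form_classes D" using wred_posdef by (auto simp: form_classes_def)
qed

lemma hurwitz_le: "hurwitz D \<le> real (card (wred D))"
proof -
  have "hurwitz D \<le> (\<Sum>C\<in>form_classes D. 1)"
    unfolding hurwitz_def
  proof (rule sum_mono)
    \<comment> \<open>If the stabilizer were infinite, \<open>card\<close> would be 0 and the
      quotient 0, so the bound 1 covers this default value as well.\<close>
    fix C show "1 / real (card (PSL2_stab (SOME Q. Q \<in> C))) \<le> 1"
      by (cases "card (PSL2_stab (SOME Q. Q \<in> C)) = 0") auto
  qed
  also have "\<dots> = real (card (bqf_orbit ` wred D))" by (simp add: form_classes_wred)
  also have "\<dots> \<le> real (card (wred D))" using card_image_le[OF finite_wred] by simp
  finally show ?thesis .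
qed

text \<open>\<open>hurwitz\<close> evaluates the stabilizer at a representative picked by
  \<open>SOME\<close>, so it must be known for every form of the orbit. Conjugation by
  \<open>h\<close> carries a stabilizing matrix of \<open>R\<close> to one of \<open>Q\<close>,
  where \<open>sred_unique\<close> applies.\<close>

lemma sred_orbit_stab:
  assumes Q: "Q \<in> sred D" and R: "R \<in> bqf_orbit Q"
  shows "card (PSL2_stab R) = 1"
proof -
  obtain h where h: "h \<in> SL2Z" "R = bqf_act Q h" using R unfolding bqf_orbit_def by auto
  have triv: "g = (1,0,0,1) \<or> g = (-1,0,0,-1)" if g: "g \<in> SL2Z" "bqf_act R g = R" for g
  proof -
    define k where "k = mat2_mul (mat2_mul h g) (mat2_inv h)"
    have kS: "k \<in> SL2Z" unfolding k_def by (intro SL2Z_mul SL2Z_inv h g)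
    have "bqf_act Q k = bqf_act (bqf_act (bqf_act Q h) g) (mat2_inv h)"
      unfolding k_def bqf_act_mul ..
    also have "\<dots> = Q" using g(2) unfolding h(2) by (simp add: bqf_act_mul mat2_mul_inv[OF h(1)] bqf_act_one)
    finally have "bqf_act Q k \<in> wred D" using Q sred_subset_wred by auto
    from sred_unique[OF Q kS this] have k: "k = (1,0,0,1) \<or> k = (-1,0,0,-1)" .
    \<comment> \<open>Both inserted factors are the identity; regrouping exposes the conjugate
      \<open>k\<close>.\<close>
    have "g = mat2_mul (mat2_mul (mat2_inv h) h) (mat2_mul g (mat2_mul (mat2_inv h) h))"
      unfolding mat2_mul_inv[OF h(1)] by (cases g) simp
    also have "\<dots> = mat2_mul (mat2_inv h) (mat2_mul k h)"
      unfolding k_def by (simp add: mat2_mul_assoc)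
    finally have *: "g = mat2_mul (mat2_inv h) (mat2_mul k h)" .
    obtain p q r s where "h = (p,q,r,s)" by (cases h)
    with * k h(1) show ?thesis by (auto simp: SL2Z_def algebra_simps)
  qed
  have "PSL2_stab R = {{(1,0,0,1),(-1,0,0,-1)}}"
  proof
    show "PSL2_stab R \<subseteq> {{(1,0,0,1),(-1,0,0,-1)}}"
      unfolding PSL2_stab_def using triv by (fastforce simp: mat2_neg_def)
    show "{{(1,0,0,1),(-1,0,0,-1)}} \<subseteq> PSL2_stab R"
      unfolding PSL2_stab_def using mat2_one_in_SL2Z bqf_act_one[of R] by (force simp: mat2_neg_def)
  qed
  then show ?thesis by simp
qed

text \<open>Strictly reduced forms lie in pairwise different classes, each of weight exactly 1, and
  the remaining classes contribute nonnegative terms.\<close>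

lemma hurwitz_ge: "real (card (sred D)) \<le> hurwitz D"
proof -
  have inj: "inj_on bqf_orbit (sred D)"
  proof (rule inj_onI)
    fix Q R assume Q: "Q \<in> sred D" and R: "R \<in> sred D" and "bqf_orbit Q = bqf_orbit R"
    then have "R \<in> bqf_orbit Q" using bqf_orbit_self by auto
    then obtain g where g: "g \<in> SL2Z" "R = bqf_act Q g" unfolding bqf_orbit_def by auto
    then have "g = (1,0,0,1) \<or> g = (-1,0,0,-1)" using sred_unique[OF Q g(1)] R sred_subset_wred by blast
    then show "Q = R" using g(2) by (cases Q) (auto simp: bqf_act_def)
  qed
  have sub: "bqf_orbit ` sred D \<subseteq> form_classes D" 
    unfolding form_classes_wred using sred_subset_wred by auto
  have fin: "finite (form_classes D)" unfolding form_classes_wred using finite_wred by auto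
  have "real (card (sred D)) = (\<Sum>C\<in>bqf_orbit ` sred D. 1)" using card_image[OF inj] by simp
  also have "\<dots> = (\<Sum>C\<in>bqf_orbit ` sred D. 1 / real (card (PSL2_stab (SOME Q. Q \<in> C))))"
  proof (rule sum.cong[OF refl])
    fix C assume "C \<in> bqf_orbit ` sred D"
    then obtain Q where Q: "Q \<in> sred D" "C = bqf_orbit Q" by auto
    have "(SOME Q. Q \<in> C) \<in> C" using bqf_orbit_self Q(2) by (metis someI)
    then show "1 = 1 / real (card (PSL2_stab (SOME Q. Q \<in> C)))" using sred_orbit_stab[OF Q(1)] Q(2) by simp
  qed
  also have "\<dots> \<le> hurwitz D" unfolding hurwitz_def
    by (rule sum_mono2[OF fin sub]) auto
  finally show ?thesis .
qed

lemma finite_sred: "finite (sred D)"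
  using finite_subset[OF sred_subset_wred finite_wred] .

text \<open>A form \<open>(a, b, c)\<close> of discriminant \<open>t\<^sup>2 - 4 m\<close> is recorded as \<open>(a, x, y)\<close> with \<open>t = x + y\<close>,
  \<open>b = y - x\<close>, so that \<open>a c + x y = m\<close>.\<close>
definition wcount :: "int \<Rightarrow> int set \<Rightarrow> (int \<times> int \<times> int) set" where
  "wcount m T = {(a,x,y). 0 < a \<and> \<bar>y - x\<bar> \<le> a \<and> a^2 \<le> m - x*y \<and> a dvd x*y - m \<and> x + y \<in> T}"

definition scount :: "int \<Rightarrow> int set \<Rightarrow> (int \<times> int \<times> int) set" where
  "scount m T = {(a,x,y). 0 < a \<and> \<bar>y - x\<bar> < a \<and> a^2 < m - x*y \<and> a dvd x*y - m \<and> x + y \<in> T}"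

text \<open>The discriminant equation makes b^2 - t^2 a multiple of 4, so t and b have equal parity
  and both halves are integers. The coefficient c is recovered as (m - x y)/a, and a <= c turns into
  a^2 <= m - x y.\<close>

lemma card_wcount:
  assumes "finite T"
  shows "finite (wcount m T)" "card (wcount m T) = (\<Sum>t\<in>T. card (wred (4*m - t^2)))"
proof -
  define f :: "int \<times> int \<times> int \<times> int \<Rightarrow> int \<times> int \<times> int" where "f = (\<lambda>(t,a,b,c). (a, (t-b) div 2, (t+b) div 2))"
  have par: "even (t - b) \<and> even (t + b)" if "b^2 - 4*a*c = -(4*m-t^2)" for a b c t :: int
  proof -
    have "b^2 - t^2 = 2*(2*(a*c) - 2*m)" using that by (simp add: algebra_simps)
    then have "even (b^2 - t^2)" by simp
    then show ?thesis by auto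
  qed
  have "bij_betw f (Sigma T (\<lambda>t. wred (4*m-t^2))) (wcount m T)"
  proof (rule bij_betw_byWitness[where f' = "\<lambda>(a,x,y). (x+y, a, y-x, (m - x*y) div a)"])
    show "\<forall>p\<in>Sigma T (\<lambda>t. wred (4*m-t^2)). (\<lambda>(a,x,y). (x+y, a, y-x, (m - x*y) div a)) (f p) = p"
    proof safe
      fix t a b c assume *: "t \<in> T" "(a,b,c) \<in> wred (4*m-t^2)"
      then have e: "b^2 - 4*a*c = -(4*m-t^2)" and a: "0 < a" by (auto simp: wred_def)
      obtain x where x: "t - b = 2*x" using par[OF e] by blast
      obtain y where y: "t + b = 2*y" using par[OF e] by blast
      have tb: "t = x + y" "b = y - x" using x y by auto
      have "m - x*y = a*c" using e unfolding tb by (simp add: power2_eq_square algebra_simps)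
      then show "(\<lambda>(a,x,y). (x+y, a, y-x, (m - x*y) div a)) (f (t,a,b,c)) = (t,a,b,c)"
        using a by (simp add: f_def tb)
    qed
    show "\<forall>p\<in>wcount m T. f ((\<lambda>(a,x,y). (x+y, a, y-x, (m - x*y) div a)) p) = p"
      by (auto simp: f_def)
    show "f ` Sigma T (\<lambda>t. wred (4*m-t^2)) \<subseteq> wcount m T"
    proof
      fix p assume "p \<in> f ` Sigma T (\<lambda>t. wred (4*m-t^2))"
      then obtain t a b c where *: "t \<in> T" "(a,b,c) \<in> wred (4*m-t^2)" and p: "p = f (t,a,b,c)" by auto
      then have e: "b^2 - 4*a*c = -(4*m-t^2)" and a: "0 < a" "\<bar>b\<bar> \<le> a" "a \<le> c" by (auto simp: wred_def)
      obtain x where x: "t - b = 2*x" using par[OF e] by blast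
      obtain y where y: "t + b = 2*y" using par[OF e] by blast
      have tb: "t = x + y" "b = y - x" using x y by auto
      have m: "x*y - m = a*(-c)" using e unfolding tb by (simp add: power2_eq_square algebra_simps)
      have "a*a \<le> a*c" using a by (simp add: mult_left_mono)
      then have "a^2 \<le> m - x*y" using m by (simp add: power2_eq_square)
      moreover have "a dvd x*y - m" unfolding m by simp
      ultimately show "p \<in> wcount m T" using a \<open>t \<in> T\<close> unfolding tb p
        by (simp add: f_def wcount_def)
    qed
    show "(\<lambda>(a,x,y). (x+y, a, y-x, (m - x*y) div a)) ` wcount m T \<subseteq> Sigma T (\<lambda>t. wred (4*m-t^2))"
    proof safe
      fix a x y assume "(a,x,y) \<in> wcount m T"
      then have *: "0 < a" "\<bar>y - x\<bar> \<le> a" "a^2 \<le> m - x*y" "a dvd x*y - m" "x + y \<in> T" by (auto simp: wcount_def)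
      from *(4) have "a dvd m - x*y" by (simp add: dvd_diff_commute)
      then obtain c where c: "m - x*y = a*c" ..
      have "a \<le> c" using *(3) c *(1) by (simp add: power2_eq_square)
      moreover have "(y-x)^2 - 4*a*c = -(4*m - (x+y)^2)" using c by (simp add: power2_eq_square algebra_simps)
      ultimately show "x+y \<in> T" "(a, y-x, (m-x*y) div a) \<in> wred (4*m - (x+y)^2)"
        using * c by (auto simp: wred_def)
    qed
  qed
  note bij = this
  have fin: "finite (Sigma T (\<lambda>t. wred (4*m-t^2)))" using assms finite_wred by auto
  then show "finite (wcount m T)" using bij_betw_finite[OF bij] by simp
  show "card (wcount m T) = (\<Sum>t\<in>T. card (wred (4*m - t^2)))"
    using bij_betw_same_card[OF bij] card_SigmaI[OF assms, of "\<lambda>t. wred (4*m-t^2)"] finite_wred by simp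
qed

text \<open>For the lower bound an injection of the triples into the strictly reduced forms is
  enough.\<close>

lemma card_scount:
  assumes "finite T"
  shows "card (scount m T) \<le> (\<Sum>t\<in>T. card (sred (4*m - t^2)))"
proof -
  define g :: "int \<times> int \<times> int \<Rightarrow> int \<times> int \<times> int \<times> int" where
    "g = (\<lambda>(a,x,y). (x+y, a, y-x, (m - x*y) div a))"
  have "card (scount m T) \<le> card (Sigma T (\<lambda>t. sred (4*m-t^2)))"
  proof (rule card_inj_on_le)
    show "inj_on g (scount m T)" unfolding inj_on_def g_def by auto
    show "finite (Sigma T (\<lambda>t. sred (4*m-t^2)))" using assms finite_sred by auto
    show "g ` scount m T \<subseteq> Sigma T (\<lambda>t. sred (4*m-t^2))"
    proof
      fix z assume "z \<in> g ` scount m T"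
      then obtain a x y where z: "z = g (a,x,y)" and "(a,x,y) \<in> scount m T" by auto
      then have *: "0 < a" "\<bar>y - x\<bar> < a" "a^2 < m - x*y" "a dvd x*y - m" "x + y \<in> T" by (auto simp: scount_def)
      from *(4) have "a dvd m - x*y" by (simp add: dvd_diff_commute)
      then obtain c where c: "m - x*y = a*c" ..
      have "a < c" using *(3) c *(1) by (simp add: power2_eq_square)
      moreover have "(y-x)^2 - 4*a*c = -(4*m - (x+y)^2)" using c by (simp add: power2_eq_square algebra_simps)
      ultimately show "z \<in> Sigma T (\<lambda>t. sred (4*m-t^2))" using * c unfolding z g_def by (simp add: sred_def)
    qed
  qed
  also have "\<dots> = (\<Sum>t\<in>T. card (sred (4*m - t^2)))" using assms finite_sred by (intro card_SigmaI) auto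
  finally show ?thesis .
qed

lemma hurwitz_sum_bounds:
  assumes "finite T"
  shows "(\<Sum>t\<in>T. hurwitz (4*m - t^2)) \<le> real (card (wcount m T))"
    and "real (card (scount m T)) \<le> (\<Sum>t\<in>T. hurwitz (4*m - t^2))"
proof -
  show "(\<Sum>t\<in>T. hurwitz (4*m - t^2)) \<le> real (card (wcount m T))"
    unfolding card_wcount(2)[OF assms] of_nat_sum by (rule sum_mono) (rule hurwitz_le)
  have "real (card (scount m T)) \<le> (\<Sum>t\<in>T. real (card (sred (4*m - t^2))))"
    using card_scount[OF assms, of m] by (simp flip: of_nat_sum)
  also have "\<dots> \<le> (\<Sum>t\<in>T. hurwitz (4*m - t^2))" by (rule sum_mono) (rule hurwitz_ge)
  finally show "real (card (scount m T)) \<le> (\<Sum>t\<in>T. hurwitz (4*m - t^2))" .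
qed

section \<open>Kloosterman sums\<close>

definition echar :: "nat \<Rightarrow> int \<Rightarrow> complex" where
  "echar a t = cis (2 * pi * real_of_int t / real a)"

lemma norm_echar [simp]: "norm (echar a t) = 1"
  by (simp add: echar_def)

lemma echar_0 [simp]: "echar a 0 = 1"
  by (simp add: echar_def)

lemma echar_add: "echar a (s + t) = echar a s * echar a t"
  by (simp add: echar_def cis_mult add_divide_distrib distrib_left)

lemma cnj_echar: "cnj (echar a t) = echar a (-t)"
  by (simp add: echar_def cis_cnj)

lemma echar_eq_1_iff:
  assumes "a > 0"
  shows "echar a t = 1 \<longleftrightarrow> int a dvd t"
proof
  assume "echar a t = 1"
  then have "cos (2 * pi * real_of_int t / real a) = 1" by (metis Re_complex_of_real cis.sel(1) echar_def of_real_1)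
  then obtain n :: int where "2 * pi * real_of_int t / real a = n * 2 * pi" by (auto simp: cos_one_2pi_int)
  then have "real_of_int t = real_of_int n * real a" using assms by (simp add: field_simps)
  also have "\<dots> = real_of_int (n * int a)" by simp
  finally have "t = n * int a" by (simp only: of_int_eq_iff)
  then show "int a dvd t" by simp
next
  assume "int a dvd t"
  then obtain n where "t = int a * n" ..
  then have "2 * pi * real_of_int t / real a = 2 * pi * real_of_int n" using assms by simp
  then have "echar a t = cis (2 * pi * real_of_int n)" unfolding echar_def by (rule arg_cong)
  then show "echar a t = 1" by (simp only: cis_multiple_2pi Ints_of_int)
qed

lemma echar_cong:
  assumes "a > 0" "[s = t] (mod int a)"
  shows "echar a s = echar a t"
proof -
  have "int a dvd s - t" using assms(2) by (simp add: cong_iff_dvd_diff)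
  then have "echar a (s - t) = 1" using echar_eq_1_iff[OF assms(1)] by blast
  then show ?thesis using echar_add[of a "s - t" t] by simp
qed

lemma bij_betw_mod_shift:
  "(a::nat) > 0 \<Longrightarrow> bij_betw (\<lambda>h. (h + c) mod int a) {0..<int a} {0..<int a}"
proof (rule bij_betw_byWitness[where f' = "\<lambda>h. (h - c) mod int a"])
  show "\<forall>h\<in>{0..<int a}. ((h + c) mod int a - c) mod int a = h" by (simp add: mod_diff_left_eq)
  show "\<forall>h\<in>{0..<int a}. ((h - c) mod int a + c) mod int a = h" by (simp add: mod_add_left_eq)
qed auto

lemma sum_echar:
  assumes "a > 0"
  shows "(\<Sum>h\<in>{0..<int a}. echar a (h * u)) = (if int a dvd u then of_nat a else 0)"
proof (cases "int a dvd u")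
  case True
  then have "echar a (h * u) = 1" for h using echar_eq_1_iff[OF assms] by simp
  then show ?thesis using True by simp
next
  case False
  let ?S = "\<Sum>h\<in>{0..<int a}. echar a (h * u)"
  have "?S = (\<Sum>h\<in>{0..<int a}. echar a (((h + 1) mod int a) * u))"
    by (rule sum.reindex_bij_betw[OF bij_betw_mod_shift[OF assms], symmetric])
  also have "\<dots> = (\<Sum>h\<in>{0..<int a}. echar a (h * u) * echar a u)"
  proof (rule sum.cong[OF refl])
    fix h
    have "[((h + 1) mod int a) * u = h * u + u] (mod int a)"
      by (simp add: cong_def mod_simps algebra_simps)
    then show "echar a (((h + 1) mod int a) * u) = echar a (h * u) * echar a u"
      using echar_cong[OF assms] by (simp add: echar_add)
  qed
  also have "\<dots> = ?S * echar a u" by (simp add: sum_distrib_right)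
  finally have "?S * (1 - echar a u) = 0" by (simp add: algebra_simps)
  moreover have "echar a u \<noteq> 1" using False echar_eq_1_iff[OF assms] by simp
  ultimately show ?thesis using False by auto
qed

text \<open>Expanding the square produces pairs (i, j). Summing over all h and k, orthogonality of
  characters keeps only the pairs whose phases agree modulo a in both coordinates, each with weight
  a^2.\<close>

lemma parseval:
  fixes u v :: "'i \<Rightarrow> int"
  assumes "a > 0" "finite I"
  shows "(\<Sum>h\<in>{0..<int a}. \<Sum>k\<in>{0..<int a}. (norm (\<Sum>i\<in>I. echar a (h * u i + k * v i)))\<^sup>2)
       = real a ^ 2 * real (card {(i,j)\<in>I \<times> I. int a dvd u i - u j \<and> int a dvd v i - v j})"
proof -
  let ?A = "{0..<int a}"
  let ?P = "\<lambda>i j. int a dvd u i - u j \<and> int a dvd v i - v j"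
  have 1: "complex_of_real ((norm (\<Sum>i\<in>I. echar a (h * u i + k * v i)))\<^sup>2)
      = (\<Sum>i\<in>I. \<Sum>j\<in>I. echar a (h * (u i - u j)) * echar a (k * (v i - v j)))" for h k
  proof -
    have "complex_of_real ((norm (\<Sum>i\<in>I. echar a (h * u i + k * v i)))\<^sup>2)
        = (\<Sum>i\<in>I. echar a (h * u i + k * v i)) * (\<Sum>j\<in>I. echar a (- (h * u j + k * v j)))"
      by (simp add: complex_norm_square cnj_echar del: of_real_power)
    also have "\<dots> = (\<Sum>i\<in>I. \<Sum>j\<in>I. echar a (h * u i + k * v i) * echar a (- (h * u j + k * v j)))"
      by (rule sum_product)
    also have "\<dots> = (\<Sum>i\<in>I. \<Sum>j\<in>I. echar a (h * (u i - u j)) * echar a (k * (v i - v j)))"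
      unfolding echar_add[symmetric] by (simp add: algebra_simps)
    finally show ?thesis .
  qed
  have "complex_of_real (\<Sum>h\<in>?A. \<Sum>k\<in>?A. (norm (\<Sum>i\<in>I. echar a (h * u i + k * v i)))\<^sup>2)
      = (\<Sum>h\<in>?A. \<Sum>k\<in>?A. \<Sum>i\<in>I. \<Sum>j\<in>I. echar a (h * (u i - u j)) * echar a (k * (v i - v j)))"
    using 1 by simp
  also have "\<dots> = (\<Sum>h\<in>?A. \<Sum>i\<in>I. \<Sum>j\<in>I. \<Sum>k\<in>?A. echar a (h * (u i - u j)) * echar a (k * (v i - v j)))"
  proof (rule sum.cong[OF refl])
    fix h
    have "(\<Sum>k\<in>?A. \<Sum>i\<in>I. \<Sum>j\<in>I. echar a (h * (u i - u j)) * echar a (k * (v i - v j)))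
        = (\<Sum>i\<in>I. \<Sum>k\<in>?A. \<Sum>j\<in>I. echar a (h * (u i - u j)) * echar a (k * (v i - v j)))"
      by (rule sum.swap)
    also have "\<dots> = (\<Sum>i\<in>I. \<Sum>j\<in>I. \<Sum>k\<in>?A. echar a (h * (u i - u j)) * echar a (k * (v i - v j)))"
      by (rule sum.cong[OF refl], rule sum.swap)
    finally show "(\<Sum>k\<in>?A. \<Sum>i\<in>I. \<Sum>j\<in>I. echar a (h * (u i - u j)) * echar a (k * (v i - v j))) = \<dots>" .
  qed
  also have "\<dots> = (\<Sum>i\<in>I. \<Sum>h\<in>?A. \<Sum>j\<in>I. \<Sum>k\<in>?A. echar a (h * (u i - u j)) * echar a (k * (v i - v j)))"
    by (rule sum.swap)
  also have "\<dots> = (\<Sum>i\<in>I. \<Sum>j\<in>I. \<Sum>h\<in>?A. \<Sum>k\<in>?A. echar a (h * (u i - u j)) * echar a (k * (v i - v j)))"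
    by (rule sum.cong[OF refl], rule sum.swap)
  also have "\<dots> = (\<Sum>i\<in>I. \<Sum>j\<in>I. (\<Sum>h\<in>?A. echar a (h * (u i - u j))) * (\<Sum>k\<in>?A. echar a (k * (v i - v j))))"
    by (simp only: sum_product)
  also have "\<dots> = (\<Sum>i\<in>I. \<Sum>j\<in>I. if ?P i j then of_nat a ^ 2 else 0)"
    unfolding sum_echar[OF assms(1)] by (intro sum.cong refl) (simp add: power2_eq_square)
  also have "\<dots> = (\<Sum>p\<in>I \<times> I. if ?P (fst p) (snd p) then of_nat a ^ 2 else 0)"
    by (simp add: sum.cartesian_product case_prod_unfold)
  also have "\<dots> = (\<Sum>p\<in>{p\<in>I \<times> I. ?P (fst p) (snd p)}. of_nat a ^ 2)"
    by (rule sum.inter_filter[symmetric]) (use assms in auto)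
  also have "{p\<in>I \<times> I. ?P (fst p) (snd p)} = {(i,j)\<in>I \<times> I. ?P i j}" by auto
  also have "(\<Sum>p\<in>{(i,j)\<in>I \<times> I. ?P i j}. of_nat a ^ 2) =
      complex_of_real (real a ^ 2 * real (card {(i,j)\<in>I \<times> I. ?P i j}))"
    by (simp add: mult.commute)
  finally show ?thesis by (simp only: of_real_eq_iff)
qed

text \<open>The modular hyperbola, that is the units modulo a listed together with their inverses.
  Carrying the pair avoids an inverse function on residues. For a = 1 it consists of the single pair
  (0,0).\<close>

definition Hyp :: "nat \<Rightarrow> (int \<times> int) set" where
  "Hyp a = {(x,z). x \<in> {0..<int a} \<and> z \<in> {0..<int a} \<and> [x * z = 1] (mod int a)}"

definition Kloo :: "nat \<Rightarrow> int \<Rightarrow> int \<Rightarrow> complex" where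
  "Kloo a h k = (\<Sum>(x,z)\<in>Hyp a. echar a (h * x + k * z))"

lemma finite_Hyp [simp]: "finite (Hyp a)"
  by (rule finite_subset[of _ "{0..<int a} \<times> {0..<int a}"]) (auto simp: Hyp_def)

lemma Hyp_inverse_cong:
  assumes "[x * z = 1] (mod n)" "[x' * z' = 1] (mod n)" "[x = x'] (mod (n::int))"
  shows "[z = z'] (mod n)"
proof -
  have "[z = (x' * z') * z] (mod n)" using cong_mult[OF assms(2) cong_refl[of z]] by (simp add: cong_sym)
  also have "(x' * z') * z = x' * (z' * z)" by simp
  also have "[x' * (z' * z) = x * (z' * z)] (mod n)" using assms(3) by (intro cong_mult cong_refl) (rule cong_sym)
  also have "x * (z' * z) = (x * z) * z'" by simp
  also have "[(x * z) * z' = 1 * z'] (mod n)" using assms(1) by (intro cong_mult cong_refl)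
  finally show ?thesis by simp
qed

lemma Hyp_unique:
  assumes "(x,z) \<in> Hyp a" "(x,z') \<in> Hyp a" shows "z = z'"
proof -
  have "[z = z'] (mod int a)" using assms by (intro Hyp_inverse_cong[of x z _ x z']) (auto simp: Hyp_def)
  then show ?thesis using assms by (auto simp: Hyp_def cong_def)
qed

lemma Hyp_swap: "(x,z) \<in> Hyp a \<longleftrightarrow> (z,x) \<in> Hyp a"
  by (auto simp: Hyp_def mult.commute)

lemma Hyp_exists:
  assumes "a > 0" "coprime x (int a)"
  shows "\<exists>z. (x mod int a, z) \<in> Hyp a"
proof -
  obtain z where z: "[x * z = 1] (mod int a)" using cong_solve_coprime_int[OF assms(2)] ..
  then have "(x mod int a, z mod int a) \<in> Hyp a"
    using assms(1) by (auto simp: Hyp_def cong_def mod_simps)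
  then show ?thesis ..
qed

lemma Hyp_coprime: "(x,z) \<in> Hyp a \<Longrightarrow> coprime x (int a)"
  by (auto simp: Hyp_def coprime_iff_invertible_int)

text \<open>Both numbers count units modulo a, but \<open>totatives\<close> takes representatives in
  1..a and \<open>Hyp\<close> in 0..a-1. The choices differ only for a = 1, which is why the inverse
  map sends 0 to a.\<close>

lemma card_Hyp:
  assumes "a > 0"
  shows "card (Hyp a) = totient a"
proof -
  have inj: "inj_on fst (Hyp a)" 
    by (rule inj_onI) (metis Hyp_unique prod.collapse)
  have "bij_betw (\<lambda>x. x mod int a) (int ` totatives a) (fst ` Hyp a)"
  proof (rule bij_betwI[where g = "\<lambda>x. if x = 0 then int a else x"])
    show "(\<lambda>x. x mod int a) \<in> int ` totatives a \<rightarrow> fst ` Hyp a"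
    proof
      fix x assume "x \<in> int ` totatives a"
      then have "coprime x (int a)" by (auto simp: totatives_def)
      then show "x mod int a \<in> fst ` Hyp a" using Hyp_exists[OF assms] by force
    qed
    show "(\<lambda>x. if x = 0 then int a else x) \<in> fst ` Hyp a \<rightarrow> int ` totatives a"
    proof
      fix x assume "x \<in> fst ` Hyp a"
      then obtain z where xz: "(x,z) \<in> Hyp a" by auto
      then have c: "coprime x (int a)" and r: "0 \<le> x" "x < int a" using Hyp_coprime by (auto simp: Hyp_def)
      show "(if x = 0 then int a else x) \<in> int ` totatives a"
      proof (cases "x = 0")
        case True
        then have "a = 1" using c by simp
        then show ?thesis using True by simp
      next
        case False
        obtain n where n: "x = int n" using r nonneg_int_cases by blast
        then have "n \<in> totatives a" using r c False by (auto simp: totatives_def)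
        then show ?thesis using False n by auto
      qed
    qed
    show "(if x mod int a = 0 then int a else x mod int a) = x" if "x \<in> int ` totatives a" for x
    proof -
      from that have "0 < x" "x \<le> int a" by (auto simp: totatives_def)
      then consider "x = int a" | "0 < x" "x < int a" by linarith
      then show ?thesis by cases (simp_all add: mod_pos_pos_trivial)
    qed
    show "(if y = 0 then int a else y) mod int a = y" if "y \<in> fst ` Hyp a" for y
    proof -
      have "0 \<le> y" "y < int a" using that by (auto simp: Hyp_def)
      then show ?thesis by (simp add: mod_pos_pos_trivial)
    qed
  qed
  then have "card (fst ` Hyp a) = card (int ` totatives a)" by (rule bij_betw_same_card[symmetric])
  also have "\<dots> = totient a" by (simp add: card_image totient_def)
  finally show ?thesis using card_image[OF inj] by simp
qed

lemma norm_Kloo_le: 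
  assumes "a > 0" shows "norm (Kloo a h k) \<le> real (totient a)"
proof -
  have "norm (Kloo a h k) \<le> (\<Sum>p\<in>Hyp a. 1)"
    unfolding Kloo_def by (rule sum_norm_le) auto
  then show ?thesis using card_Hyp[OF assms] by simp
qed

lemma Kloo_cong:
  assumes "a > 0" "[h = h'] (mod int a)" "[k = k'] (mod int a)"
  shows "Kloo a h k = Kloo a h' k'"
  unfolding Kloo_def by (intro sum.cong refl) (auto intro!: echar_cong assms cong_add cong_mult)

lemma Hyp_mult:
  assumes "a > 0" "(u,w) \<in> Hyp a" "(x,z) \<in> Hyp a"
  shows "((u*x) mod int a, (w*z) mod int a) \<in> Hyp a"
proof -
  have "[(u*w)*(x*z) = 1*1] (mod int a)" using assms by (intro cong_mult) (auto simp: Hyp_def)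
  then have "[(u*x)*(w*z) = 1] (mod int a)" by (simp add: mult_ac)
  moreover have "[(u*x) mod int a * ((w*z) mod int a) = (u*x)*(w*z)] (mod int a)"
    by (intro cong_mult) auto
  ultimately have "[(u*x) mod int a * ((w*z) mod int a) = 1] (mod int a)" by (rule cong_trans[rotated])
  then show ?thesis using assms(1) by (simp add: Hyp_def)
qed

text \<open>Coordinatewise multiplication by (u, w) permutes the modular hyperbola, and
  multiplication by (w, u) undoes it.\<close>

lemma Kloo_twist:
  assumes a: "a > 0" and uw: "(u,w) \<in> Hyp a"
  shows "Kloo a (h * u) (k * w) = Kloo a h k"
proof -
  let ?f = "\<lambda>(x,z). ((u*x) mod int a, (w*z) mod int a)"
  let ?g = "\<lambda>(x,z). ((w*x) mod int a, (u*z) mod int a)"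
  have c: "(w * (u * x mod int a)) mod int a = x" "(u * (w * x mod int a)) mod int a = x" 
    if "0 \<le> x" "x < int a" for x
  proof -
    have "[(u*w)*x = 1*x] (mod int a)" using uw by (intro cong_mult cong_refl) (auto simp: Hyp_def)
    then show "(w * (u * x mod int a)) mod int a = x" "(u * (w * x mod int a)) mod int a = x"
      using that by (auto simp: cong_def mod_simps algebra_simps)
  qed
  have bij: "bij_betw ?f (Hyp a) (Hyp a)"
  proof (rule bij_betw_byWitness[where f' = ?g])
    show "\<forall>p\<in>Hyp a. ?g (?f p) = p" "\<forall>p\<in>Hyp a. ?f (?g p) = p" using c by (auto simp: Hyp_def)
    show "?f ` Hyp a \<subseteq> Hyp a" using Hyp_mult[OF a uw] by auto
    show "?g ` Hyp a \<subseteq> Hyp a" using Hyp_mult[OF a] uw Hyp_swap by auto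
  qed
  have "Kloo a h k = (\<Sum>p\<in>Hyp a. (\<lambda>(x,z). echar a (h * x + k * z)) (?f p))"
    unfolding Kloo_def by (rule sum.reindex_bij_betw[OF bij, symmetric])
  also have "\<dots> = (\<Sum>(x,z)\<in>Hyp a. echar a (h * u * x + k * w * z))"
  proof (rule sum.cong[OF refl])
    fix p :: "int \<times> int"
    obtain x z where p: "p = (x,z)" by (cases p)
    have "[h * ((u*x) mod int a) + k * ((w*z) mod int a) = h * (u*x) + k * (w*z)] (mod int a)"
      by (intro cong_add cong_mult cong_refl) auto
    then show "(\<lambda>(x,z). echar a (h * x + k * z)) (?f p) = (\<lambda>(x,z). echar a (h * u * x + k * w * z)) p"
      using echar_cong[OF a] unfolding p by (simp add: mult.assoc)
  qed
  finally show ?thesis by (simp add: Kloo_def)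
qed

section \<open>Divisor counts and the fourth moment\<close>

definition dcount :: "nat \<Rightarrow> nat" where
  "dcount a = card {d. d dvd a}"

definition mults :: "nat \<Rightarrow> nat \<Rightarrow> int set" where
  "mults a d = {u\<in>{0..<int a}. int d dvd u}"

lemma card_mults:
  assumes "a > 0" "d dvd a"
  shows "card (mults a d) = a div d"
proof -
  obtain e where e: "a = d * e" using assms(2) ..
  have d: "d > 0" "e > 0" using assms(1) e by auto
  have "mults a d = (\<lambda>j. int d * j) ` {0..<int e}"
  proof
    show "mults a d \<subseteq> (\<lambda>j. int d * j) ` {0..<int e}"
    proof
      fix u assume "u \<in> mults a d"
      then obtain j where "u = int d * j" "0 \<le> u" "u < int a" by (auto simp: mults_def)
      then have "0 \<le> j" "j < int e" using d e by (auto simp: zero_le_mult_iff)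
      then show "u \<in> (\<lambda>j. int d * j) ` {0..<int e}" using \<open>u = int d * j\<close> by auto
    qed
    show "(\<lambda>j. int d * j) ` {0..<int e} \<subseteq> mults a d" using d e by (auto simp: mults_def)
  qed
  moreover have "inj_on (\<lambda>j. int d * j) {0..<int e}" using d by (auto simp: inj_on_def)
  ultimately have "card (mults a d) = e" by (simp add: card_image)
  then show ?thesis using e d by simp
qed

text \<open>Put d = gcd(u, a) and e = gcd(v, a/d). Then d e divides a and a/(d e) divides w. A fixed
  pair (d, e) admits (a/d)(a/e)(d e) = a^2 triples, and there are at most
  \<open>dcount a ^ 2\<close> pairs.\<close>

lemma card_triple_product:
  assumes a: "a > 0"
  shows "card {(u,v,w)\<in>{0..<int a} \<times> {0..<int a} \<times> {0..<int a}. int a dvd u * v * w} \<le> a^2 * dcount a ^ 2"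
proof -
  let ?Z = "{(u,v,w)\<in>{0..<int a} \<times> {0..<int a} \<times> {0..<int a}. int a dvd u * v * w}"
  let ?D = "{d. d dvd a}"
  let ?I = "{(d,e)\<in>?D \<times> ?D. d * e dvd a}"
  let ?M = "\<lambda>(d,e). mults a d \<times> mults a e \<times> mults a (a div (d*e))"
  have finD: "finite ?D" using a by simp
  have finI: "finite ?I" by (rule finite_subset[of _ "?D \<times> ?D"]) (use finD in auto)
  have fM: "finite (mults a d)" for d 
    by (rule finite_subset[of _ "{0..<int a}"]) (auto simp: mults_def)
  have sub: "?Z \<subseteq> \<Union> (?M ` ?I)"
  proof
    fix t assume "t \<in> ?Z"
    then obtain u v w where t: "t = (u,v,w)" and r: "u \<in> {0..<int a}" "v \<in> {0..<int a}" "w \<in> {0..<int a}"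
      and dv: "int a dvd u * v * w" by auto
    define d where "d = nat (gcd u (int a))"
    have d: "int d = gcd u (int a)" by (simp add: d_def)
    have "d dvd a" using d by (metis gcd_dvd2 int_dvd_int_iff)
    then obtain a1 where a1: "a = d * a1" ..
    have d0: "d > 0" "a1 > 0" using a a1 by auto
    obtain u1 where u1: "u = int d * u1" using d by (metis dvdE gcd_dvd1)
    have cop: "coprime u1 (int a1)"
    proof -
      have "gcd (int d * u1) (int d * int a1) = int d" using d u1 a1 by simp
      then have "int d * gcd u1 (int a1) = int d" using gcd_mult_distrib_int[of "int d" u1 "int a1"] by simp
      then show ?thesis using d0 by (simp add: coprime_iff_gcd_eq_1)
    qed
    define e where "e = nat (gcd v (int a1))"
    have e: "int e = gcd v (int a1)" by (simp add: e_def)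
    have "e dvd a1" using e by (metis gcd_dvd2 int_dvd_int_iff)
    then obtain a2 where a2: "a1 = e * a2" ..
    have e0: "e > 0" "a2 > 0" using d0 a2 by auto
    obtain v1 where v1: "v = int e * v1" using e by (metis dvdE gcd_dvd1)
    have cop2: "coprime v1 (int a2)"
    proof -
      have "gcd (int e * v1) (int e * int a2) = int e" using e v1 a2 by simp
      then have "int e * gcd v1 (int a2) = int e" using gcd_mult_distrib_int[of "int e" v1 "int a2"] by simp
      then show ?thesis using e0 by (simp add: coprime_iff_gcd_eq_1)
    qed
    have "int d * int a1 dvd int d * (u1 * (v * w))" using dv a1 u1 by (simp add: mult_ac)
    then have "int a1 dvd u1 * (v * w)" using d0 by simp
    then have "int a1 dvd v * w" using cop by (simp add: coprime_dvd_mult_right_iff coprime_commute)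
    then have "int e * int a2 dvd int e * (v1 * w)" using a2 v1 by (simp add: mult_ac)
    then have "int a2 dvd v1 * w" using e0 by simp
    then have w: "int a2 dvd w" using cop2 by (simp add: coprime_dvd_mult_right_iff coprime_commute)
    have "a div (d * e) = a2" using a1 a2 d0 e0 by (simp add: mult.assoc[symmetric])
    moreover have "(d,e) \<in> ?I" using a1 a2 by auto
    moreover have "int d dvd u" "int e dvd v" using u1 v1 by auto
    ultimately have "t \<in> ?M (d,e)" using r w by (auto simp: t mults_def)
    then show "t \<in> \<Union> (?M ` ?I)" using \<open>(d,e) \<in> ?I\<close> by blast
  qed
  have "card ?Z \<le> card (\<Union> (?M ` ?I))" 
    by (rule card_mono[OF _ sub]) (use finI fM in auto)
  also have "\<dots> \<le> (\<Sum>p\<in>?I. card (?M p))" by (rule card_UN_le[OF finI])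
  also have "\<dots> = (\<Sum>p\<in>?I. a^2)"
  proof (rule sum.cong[OF refl])
    fix p assume "p \<in> ?I"
    then obtain d e where p: "p = (d,e)" "d dvd a" "e dvd a" "d * e dvd a" by auto
    then obtain f where f: "a = d * e * f" by blast
    then have pos: "d > 0" "e > 0" "f > 0" using a by auto
    have "card (?M p) = card (mults a d) * (card (mults a e) * card (mults a f))"
      using p f pos by (simp add: card_cartesian_product)
    also have "\<dots> = (a div d) * ((a div e) * (a div f))"
      using card_mults[OF a] p f by simp
    also have "a div d = e * f" using f pos by (simp add: mult.assoc)
    also have "a div e = d * f" using f pos by (simp add: mult.assoc mult.left_commute[of d e])
    also have "a div f = d * e" using f pos by simp
    finally show "card (?M p) = a^2" by (simp add: f power2_eq_square mult_ac)
  qed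
  also have "\<dots> = card ?I * a^2" by simp
  also have "card ?I \<le> card (?D \<times> ?D)" by (rule card_mono) (use finD in auto)
  also have "\<dots> = dcount a ^ 2" by (simp add: dcount_def card_cartesian_product power2_eq_square)
  finally show ?thesis by (simp add: mult.commute)
qed

text \<open>Multiplying the equation of inverses by x1 x2 x3 x4 gives x3 x4 (x1 + x2) = x1 x2 (x3 +
  x4) modulo a. After substituting x4 = x1 + x2 - x3, the difference of the two sides is -(x1 +
  x2)(x3 - x1)(x3 - x2).\<close>

lemma quadruple_dvd:
  fixes x1 x2 x3 x4 z1 z2 z3 z4 :: int
  assumes "[x1 * z1 = 1] (mod a)" "[x2 * z2 = 1] (mod a)" "[x3 * z3 = 1] (mod a)" "[x4 * z4 = 1] (mod a)"
    and "a dvd (x1 + x2) - (x3 + x4)" "a dvd (z1 + z2) - (z3 + z4)"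
  shows "a dvd (x3 - x1) * (x3 - x2) * (x1 + x2)"
proof -
  have *: "\<exists>c. x * z = 1 + a * c" if "[x * z = 1] (mod a)" for x z
  proof -
    have "a dvd x * z - 1" using that by (simp add: cong_iff_dvd_diff)
    then obtain c where "x * z - 1 = a * c" ..
    then show ?thesis by (intro exI[of _ c]) simp
  qed
  obtain e1 where 1: "x1 * z1 = 1 + a * e1" using * assms(1) by blast
  obtain e2 where 2: "x2 * z2 = 1 + a * e2" using * assms(2) by blast
  obtain e3 where 3: "x3 * z3 = 1 + a * e3" using * assms(3) by blast
  obtain e4 where 4: "x4 * z4 = 1 + a * e4" using * assms(4) by blast
  obtain f where 5: "(x1 + x2) - (x3 + x4) = a * f" using assms(5) ..
  obtain g where 6: "(z1 + z2) - (z3 + z4) = a * g" using assms(6) ..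
  \<comment> \<open>The cofactor of a after this multiplication: g comes from the equation of
    inverses and e1, ..., e4 from replacing each xi zi by 1. With explicit cofactors only polynomial
    identities over the integers remain.\<close>
  define W where "W = x1*x2*x3*x4*g - (x2*x3*x4*e1 + x1*x3*x4*e2 - x1*x2*x4*e3 - x1*x2*x3*e4)"
  have W: "x2*x3*x4 + x1*x3*x4 - x1*x2*x4 - x1*x2*x3 = a * W"
  proof -
    have "x1*x2*x3*x4*((z1 + z2) - (z3 + z4)) =
      x2*x3*x4*(x1*z1) + x1*x3*x4*(x2*z2) - x1*x2*x4*(x3*z3) - x1*x2*x3*(x4*z4)" by (simp add: algebra_simps)
    then show ?thesis unfolding W_def 1 2 3 4 6 by (simp add: algebra_simps)
  qed
  have "(x3 - x1) * (x3 - x2) * (x1 + x2) = a * (- W - f * ((x1 + x2) * x3 - x1 * x2))"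
  proof -
    have x4: "x4 = x1 + x2 - x3 - a * f" using 5 by simp
    have "a * (- W - f * ((x1 + x2) * x3 - x1 * x2)) = - (a * W) - a * f * ((x1 + x2) * x3 - x1 * x2)"
      by (simp add: algebra_simps)
    then show ?thesis unfolding W[symmetric] x4 by (simp add: algebra_simps)
  qed
  then show ?thesis by simp
qed

text \<open>The equations \<open>x1 + x2 = x3 + x4\<close> and \<open>1/x1 + 1/x2 = 1/x3 + 1/x4\<close> modulo \<open>a\<close> force
  \<open>(x3 - x1)(x3 - x2)(x1 + x2) = 0\<close>. These three factors determine \<open>2 x3\<close> modulo \<open>a\<close>, and the extra bit
  \<open>(2 x3) div a\<close> then determines \<open>x3\<close> itself.\<close>
lemma card_Hyp_quadruples:
  assumes a: "a > 0"
  shows "card {(P,Q)\<in>(Hyp a \<times> Hyp a) \<times> (Hyp a \<times> Hyp a). 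
     int a dvd (fst (fst P) + fst (snd P)) - (fst (fst Q) + fst (snd Q)) \<and> 
     int a dvd (snd (fst P) + snd (snd P)) - (snd (fst Q) + snd (snd Q))} \<le> 2 * a^2 * dcount a ^ 2"
    (is "card ?S \<le> _")
proof -
  let ?Z = "{(u,v,w)\<in>{0..<int a} \<times> {0..<int a} \<times> {0..<int a}. int a dvd u * v * w}"
  define f where "f = (\<lambda>(((x1,z1::int),(x2,z2::int)),((x3,z3::int),(x4::int,z4::int))).
     (((x3 - x1) mod int a, (x3 - x2) mod int a, (x1 + x2) mod int a), (2 * x3) div int a))"
  have "card ?S \<le> card (?Z \<times> {0,1::int})"
  proof (rule card_inj_on_le[of f])
    show "finite (?Z \<times> {0,1::int})"
      by (rule finite_cartesian_product, rule finite_subset[of _ "{0..<int a} \<times> {0..<int a} \<times> {0..<int a}"]) auto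
    show "f ` ?S \<subseteq> ?Z \<times> {0,1}"
    proof
      fix t assume "t \<in> f ` ?S"
      then obtain x1 z1 x2 z2 x3 z3 x4 z4 where t: "t = f (((x1,z1),(x2,z2)),((x3,z3),(x4,z4)))"
        and H: "(x1,z1) \<in> Hyp a" "(x2,z2) \<in> Hyp a" "(x3,z3) \<in> Hyp a" "(x4,z4) \<in> Hyp a"
        and d: "int a dvd (x1 + x2) - (x3 + x4)" "int a dvd (z1 + z2) - (z3 + z4)" by force
      have "int a dvd (x3 - x1) * (x3 - x2) * (x1 + x2)"
        by (rule quadruple_dvd[of x1 z1 _ x2 z2 x3 z3 x4 z4]) (use H d in \<open>auto simp: Hyp_def\<close>)
      moreover have "[((x3 - x1) mod int a) * ((x3 - x2) mod int a) * ((x1 + x2) mod int a) = 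
          (x3 - x1) * (x3 - x2) * (x1 + x2)] (mod int a)"
        by (intro cong_mult) auto
      ultimately have "int a dvd ((x3 - x1) mod int a) * ((x3 - x2) mod int a) * ((x1 + x2) mod int a)"
        using cong_dvd_iff by blast
      moreover have "(2 * x3) div int a \<in> {0,1}"
      proof -
        have "0 \<le> x3" "x3 < int a" using H by (auto simp: Hyp_def)
        then have "0 \<le> (2 * x3) div int a" using a by (simp add: pos_imp_zdiv_nonneg_iff)
        moreover have "(2 * x3) div int a < 2"
        proof (rule ccontr)
          assume "\<not> ?thesis"
          then have "int a * 2 \<le> int a * ((2 * x3) div int a)" by (intro mult_left_mono) auto
          also have "\<dots> \<le> 2 * x3" using mult_div_mod_eq[of "int a" "2 * x3"] pos_mod_sign[of "int a" "2 * x3"] a by linarith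
          finally show False using \<open>x3 < int a\<close> by simp
        qed
        ultimately have "0 \<le> (2 * x3) div int a" "(2 * x3) div int a < 2" by auto
        then show ?thesis by auto
      qed
      ultimately show "t \<in> ?Z \<times> {0,1}" using a by (simp add: t f_def)
    qed
    show "inj_on f ?S"
    proof (rule inj_onI)
      fix p q assume p: "p \<in> ?S" and q: "q \<in> ?S" and eq: "f p = f q"
      from p obtain x1 z1 x2 z2 x3 z3 x4 z4 where P: "p = (((x1,z1),(x2,z2)),((x3,z3),(x4,z4)))"
        and H: "(x1,z1) \<in> Hyp a" "(x2,z2) \<in> Hyp a" "(x3,z3) \<in> Hyp a" "(x4,z4) \<in> Hyp a"
        and d: "int a dvd (x1 + x2) - (x3 + x4)" by force
      from q obtain y1 w1 y2 w2 y3 w3 y4 w4 where Q: "q = (((y1,w1),(y2,w2)),((y3,w3),(y4,w4)))"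
        and H': "(y1,w1) \<in> Hyp a" "(y2,w2) \<in> Hyp a" "(y3,w3) \<in> Hyp a" "(y4,w4) \<in> Hyp a"
        and d': "int a dvd (y1 + y2) - (y3 + y4)" by force
      have e: "[x3 - x1 = y3 - y1] (mod int a)" "[x3 - x2 = y3 - y2] (mod int a)" 
          "[x1 + x2 = y1 + y2] (mod int a)" "(2 * x3) div int a = (2 * y3) div int a"
        using eq by (auto simp: P Q f_def cong_def)
      have ceq: "x = y" if "[x = y] (mod int a)" "(x,z) \<in> Hyp a" "(y,z') \<in> Hyp a" for x y z z'
        using that by (auto simp: Hyp_def cong_def)
      have "[(x3 - x1) + (x3 - x2) + (x1 + x2) = (y3 - y1) + (y3 - y2) + (y1 + y2)] (mod int a)"
        by (intro cong_add e)
      then have "[2 * x3 = 2 * y3] (mod int a)" by simp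
      then have "2 * x3 = 2 * y3" using e(4) unfolding cong_def by (metis mult_div_mod_eq)
      then have 3: "x3 = y3" by simp
      have 1: "x1 = y1" using cong_diff[OF cong_refl[of x3] e(1)] 3 by (intro ceq[OF _ H(1) H'(1)]) simp
      have 2: "x2 = y2" using cong_diff[OF cong_refl[of x3] e(2)] 3 by (intro ceq[OF _ H(2) H'(2)]) simp
      have "int a dvd ((x1 + x2) - (x3 + x4)) - ((y1 + y2) - (y3 + y4))" using d d' by (rule dvd_diff)
      then have "int a dvd y4 - x4" using 1 2 3 by simp
      then have "[y4 = x4] (mod int a)" by (simp add: cong_iff_dvd_diff)
      then have 4: "y4 = x4" by (intro ceq[OF _ H'(4) H(4)])
      show "p = q" using H H' unfolding P Q 1 2 3 4 by (auto dest: Hyp_unique)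
    qed
  qed
  also have "\<dots> = card ?Z * 2" by (simp add: card_cartesian_product)
  also have "\<dots> \<le> (a^2 * dcount a ^ 2) * 2" using card_triple_product[OF a] by (intro mult_right_mono) auto
  finally show ?thesis by (simp add: mult_ac)
qed

text \<open>The square of a Kloosterman sum is an exponential sum over pairs of points with phases
  x1 + x2 and z1 + z2. \<open>parseval\<close> turns the moment into a^2 times the number of
  quadruples counted above.\<close>

lemma Kloo_fourth_moment:
  assumes a: "a > 0"
  shows "(\<Sum>h\<in>{0..<int a}. \<Sum>k\<in>{0..<int a}. norm (Kloo a h k) ^ 4) \<le> 2 * real a ^ 4 * real (dcount a) ^ 2"
proof -
  let ?A = "{0..<int a}" and ?I = "Hyp a \<times> Hyp a"
  have "norm (Kloo a h k) ^ 4 = (norm (\<Sum>P\<in>?I. echar a (h * (fst (fst P) + fst (snd P)) + k * (snd (fst P) + snd (snd P)))))\<^sup>2" for h k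
  proof -
    have "(Kloo a h k)\<^sup>2 = (\<Sum>p\<in>Hyp a. \<Sum>q\<in>Hyp a. echar a (h * fst p + k * snd p) * echar a (h * fst q + k * snd q))"
      by (simp add: power2_eq_square Kloo_def sum_product case_prod_unfold)
    also have "\<dots> = (\<Sum>P\<in>?I. echar a (h * fst (fst P) + k * snd (fst P)) * echar a (h * fst (snd P) + k * snd (snd P)))"
      by (simp add: sum.cartesian_product case_prod_unfold)
    also have "\<dots> = (\<Sum>P\<in>?I. echar a (h * (fst (fst P) + fst (snd P)) + k * (snd (fst P) + snd (snd P))))"
      unfolding echar_add[symmetric] by (simp add: algebra_simps)
    finally have "(norm (Kloo a h k))\<^sup>2 = norm (\<Sum>P\<in>?I. echar a (h * (fst (fst P) + fst (snd P)) + k * (snd (fst P) + snd (snd P))))"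
      by (simp add: norm_power[symmetric])
    moreover have "norm (Kloo a h k) ^ 4 = ((norm (Kloo a h k))\<^sup>2)\<^sup>2" by simp
    ultimately show ?thesis by (simp only:)
  qed
  then have "(\<Sum>h\<in>?A. \<Sum>k\<in>?A. norm (Kloo a h k) ^ 4) = real a ^ 2 * real (card {(P,Q)\<in>?I \<times> ?I. 
     int a dvd (fst (fst P) + fst (snd P)) - (fst (fst Q) + fst (snd Q)) \<and> 
     int a dvd (snd (fst P) + snd (snd P)) - (snd (fst Q) + snd (snd Q))})"
    using parseval[OF a, of ?I "\<lambda>P. fst (fst P) + fst (snd P)" "\<lambda>P. snd (fst P) + snd (snd P)"] by simp
  also have "\<dots> \<le> real a ^ 2 * real (2 * a^2 * dcount a ^ 2)"
    by (intro mult_left_mono of_nat_mono card_Hyp_quadruples[OF a]) auto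
  also have "\<dots> = 2 * real a ^ 4 * real (dcount a) ^ 2" by (simp add: power2_eq_square power4_eq_xxxx)
  finally show ?thesis .
qed

text \<open>In Gauss's identity a is the sum of \<open>totient d\<close> over the divisors d, and
  each term is at most \<open>totient a\<close>. The lemma trades the loss a /
  \<open>totient a\<close> below for a divisor function.\<close>

lemma le_totient_dcount: "a \<le> totient a * dcount a"
proof (cases "a = 0")
  case False
  have "a = (\<Sum>d | d dvd a. totient d)" by (rule totient_divisor_sum[symmetric])
  also have "\<dots> \<le> (\<Sum>d | d dvd a. totient a)"
    by (rule sum_mono) (use False in \<open>auto intro: totient_dvd_mono\<close>)
  finally show ?thesis by (simp add: dcount_def mult.commute)
qed auto

text \<open>By \<open>Kloo_twist\<close> the same value occurs in the fourth moment once for every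
  unit u, but different u may give the same frequencies modulo a when h and a are not coprime.
  Recording also the quotient (h u) div a recovers h u and hence u. It takes at most 2|h| + 1
  values, so the moment is counted that often, and the moment's own factor 2 makes the constant 4|h|
  + 2.\<close>

lemma Kloo_bound:
  assumes a: "a > 0" and h: "h \<noteq> 0"
  shows "norm (Kloo a h k) ^ 4 \<le> (4 * \<bar>real_of_int h\<bar> + 2) * real a ^ 3 * real (dcount a) ^ 3"
proof -
  let ?A = "{0..<int a}" and ?R = "{-\<bar>h\<bar>..\<bar>h\<bar>}"
  let ?F = "\<lambda>(h',k',_::int). norm (Kloo a h' k') ^ 4"
  define g where "g = (\<lambda>(u,w). ((h * u) mod int a, (k * w) mod int a, (h * u) div int a))"
  have "real (totient a) * norm (Kloo a h k) ^ 4 = (\<Sum>p\<in>Hyp a. norm (Kloo a h k) ^ 4)"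
    using card_Hyp[OF a] by simp
  also have "\<dots> = (\<Sum>p\<in>Hyp a. ?F (g p))"
  proof (rule sum.cong[OF refl])
    fix p assume "p \<in> Hyp a"
    moreover obtain u w where p: "p = (u,w)" by (cases p)
    ultimately have "Kloo a h k = Kloo a (h * u) (k * w)" using Kloo_twist[OF a] by simp
    also have "\<dots> = Kloo a ((h * u) mod int a) ((k * w) mod int a)"
      by (rule Kloo_cong[OF a]) (auto simp: cong_def)
    finally show "norm (Kloo a h k) ^ 4 = ?F (g p)" by (simp add: g_def p)
  qed
  also have "\<dots> = (\<Sum>t\<in>g ` Hyp a. ?F t)"
  proof (rule sum.reindex[symmetric, unfolded o_def], rule inj_onI)
    fix p q assume p: "p \<in> Hyp a" and q: "q \<in> Hyp a" and eq: "g p = g q"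
    obtain u w where P: "p = (u,w)" by (cases p)
    obtain u' w' where Q: "q = (u',w')" by (cases q)
    have e: "(h * u) mod int a = (h * u') mod int a" "(h * u) div int a = (h * u') div int a"
      using eq unfolding P Q g_def by auto
    have "h * u = int a * ((h * u) div int a) + (h * u) mod int a" by simp
    also have "\<dots> = h * u'" unfolding e by simp
    finally have "h * u = h * u'" .
    then have "u = u'" using h by simp
    then show "p = q" using p q unfolding P Q by (auto dest: Hyp_unique)
  qed
  also have "\<dots> \<le> (\<Sum>t\<in>?A \<times> ?A \<times> ?R. ?F t)"
  proof (rule sum_mono2)
    show "g ` Hyp a \<subseteq> ?A \<times> ?A \<times> ?R"
    proof
      fix t assume "t \<in> g ` Hyp a"
      then obtain u w where uw: "(u,w) \<in> Hyp a" and t: "t = g (u,w)" by auto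
      have u: "0 \<le> u" "u < int a" using uw by (auto simp: Hyp_def)
      have "\<bar>h * u\<bar> \<le> \<bar>h\<bar> * int a" using u by (simp add: abs_mult mult_left_mono)
      then have 1: "- (\<bar>h\<bar> * int a) \<le> h * u" "h * u \<le> \<bar>h\<bar> * int a" by auto
      have "((- \<bar>h\<bar>) * int a) div int a \<le> (h * u) div int a" by (rule zdiv_mono1) (use 1 a in auto)
      then have "- \<bar>h\<bar> \<le> (h * u) div int a" using a by (simp only: nonzero_mult_div_cancel_right of_nat_eq_0_iff)
      moreover have "(h * u) div int a \<le> (\<bar>h\<bar> * int a) div int a" by (rule zdiv_mono1) (use 1 a in auto)
      ultimately have "(h * u) div int a \<in> ?R" using a by simp
      then show "t \<in> ?A \<times> ?A \<times> ?R" using a by (simp add: t g_def)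
    qed
  qed auto
  also have "\<dots> = (\<Sum>h'\<in>?A. \<Sum>k'\<in>?A. \<Sum>j\<in>?R. norm (Kloo a h' k') ^ 4)"
    unfolding sum.cartesian_product by (rule sum.cong[OF refl]) auto
  also have "\<dots> = (2 * \<bar>real_of_int h\<bar> + 1) * (\<Sum>h'\<in>?A. \<Sum>k'\<in>?A. norm (Kloo a h' k') ^ 4)"
    by (simp add: sum_distrib_left)
  also have "\<dots> \<le> (2 * \<bar>real_of_int h\<bar> + 1) * (2 * real a ^ 4 * real (dcount a) ^ 2)"
    by (intro mult_left_mono Kloo_fourth_moment[OF a]) auto
  finally have *: "real (totient a) * norm (Kloo a h k) ^ 4 \<le> (4 * \<bar>real_of_int h\<bar> + 2) * real a ^ 4 * real (dcount a) ^ 2"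
    by (simp add: algebra_simps)
  have "real a * norm (Kloo a h k) ^ 4 \<le> real (totient a * dcount a) * norm (Kloo a h k) ^ 4"
    by (intro mult_right_mono of_nat_mono le_totient_dcount) auto
  also have "\<dots> = real (dcount a) * (real (totient a) * norm (Kloo a h k) ^ 4)" by simp
  also have "\<dots> \<le> real (dcount a) * ((4 * \<bar>real_of_int h\<bar> + 2) * real a ^ 4 * real (dcount a) ^ 2)"
    by (intro mult_left_mono *) auto
  also have "\<dots> = real a * ((4 * \<bar>real_of_int h\<bar> + 2) * real a ^ 3 * real (dcount a) ^ 3)"
    by (simp add: power2_eq_square power3_eq_cube power4_eq_xxxx)
  finally show ?thesis using a by simp
qed

section \<open>Averages over the modulus\<close>

definition Sol :: "nat \<Rightarrow> nat \<Rightarrow> (int \<times> int) set" where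
  "Sol m a = {(x,y). x \<in> {0..<int a} \<and> y \<in> {0..<int a} \<and> int a dvd x * y - int m}"

lemma finite_Sol [simp]: "finite (Sol m a)"
  by (rule finite_subset[of _ "{0..<int a} \<times> {0..<int a}"]) (auto simp: Sol_def)

definition Ksol :: "nat \<Rightarrow> nat \<Rightarrow> int \<Rightarrow> int \<Rightarrow> complex" where
  "Ksol m a h k = (\<Sum>(x,y)\<in>Sol m a. echar a (h * x + k * y))"

lemma Ksol_commute: "Ksol m a h k = Ksol m a k h"
proof -
  have "bij_betw prod.swap (Sol m a) (Sol m a)"
    by (rule bij_betw_byWitness[where f' = prod.swap]) (auto simp: Sol_def mult.commute)
  then have "Ksol m a h k = (\<Sum>p\<in>Sol m a. (\<lambda>(x,y). echar a (h * x + k * y)) (prod.swap p))"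
    unfolding Ksol_def by (rule sum.reindex_bij_betw[symmetric])
  also have "\<dots> = Ksol m a k h"
    unfolding Ksol_def by (rule sum.cong) (auto simp: add.commute)
  finally show ?thesis .
qed

text \<open>The gcd of the first coordinate with a divides q^nu, hence equals some q^i. Divide it
  out and put b = a/q^i: the congruence reads x y = q^(nu-i) modulo b with x a unit. So y is
  determined modulo b by the inverse z of x, and j runs over its q^i lifts to residues modulo
  a.\<close>

lemma Sol_gcd_decomposition:
  assumes q: "prime q" and a: "a > 0"
  shows "bij_betw (\<lambda>(i,(x,z),j). (int (q^i) * x, (int (q^(\<nu>-i)) * z) mod int (a div q^i) + int (a div q^i) * j))
     (Sigma {i. i \<le> \<nu> \<and> q^i dvd a} (\<lambda>i. Hyp (a div q^i) \<times> {0..<int (q^i)})) (Sol (q^\<nu>) a)"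
    (is "bij_betw ?f ?D ?S")
proof (rule bij_betw_imageI)
  have q1: "q > 1" using q prime_gt_1_nat by blast
  have fac: "int a = int (q^i) * int (a div q^i)" "a div q^i > 0" if "q^i dvd a" for i
  proof -
    show "int a = int (q^i) * int (a div q^i)" using that by (metis dvd_mult_div_cancel of_nat_mult)
    show "a div q^i > 0" using that a q1 by (simp add: div_greater_zero_iff dvd_imp_le)
  qed
  have gcdf: "gcd (int (q^i) * x) (int a) = int (q^i)" if "q^i dvd a" "(x,z) \<in> Hyp (a div q^i)" for i x z
  proof -
    have "coprime x (int (a div q^i))" using Hyp_coprime[OF that(2)] .
    then have "gcd x (int (a div q^i)) = 1" by simp
    then show ?thesis using gcd_mult_distrib_int[of "int (q^i)" x "int (a div q^i)"] fac(1)[OF that(1)] by simp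
  qed
  show "inj_on ?f ?D"
  proof (rule inj_onI)
    fix s t assume s: "s \<in> ?D" and t: "t \<in> ?D" and eq: "?f s = ?f t"
    obtain i x z j where S: "s = (i,(x,z),j)" by (metis prod.collapse)
    obtain i' x' z' j' where T: "t = (i',(x',z'),j')" by (metis prod.collapse)
    have s': "q^i dvd a" "(x,z) \<in> Hyp (a div q^i)" "0 \<le> j" using s by (auto simp: S)
    have t': "q^i' dvd a" "(x',z') \<in> Hyp (a div q^i')" using t by (auto simp: T)
    have e1: "int (q^i) * x = int (q^i') * x'" and
      e2: "(int (q^(\<nu>-i)) * z) mod int (a div q^i) + int (a div q^i) * j = 
           (int (q^(\<nu>-i')) * z') mod int (a div q^i') + int (a div q^i') * j'"
      using eq by (auto simp: S T)
    have "int (q^i) = int (q^i')" using gcdf[OF s'(1,2)] gcdf[OF t'] e1 by simp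
    then have ii: "i = i'" using q1 by (simp add: power_inject_exp)
    have xx: "x = x'" using e1 q1 by (simp add: ii)
    have zz: "z = z'" using s' t' ii xx by (auto dest: Hyp_unique)
    have "int (a div q^i) * j = int (a div q^i) * j'" using e2 by (simp add: ii zz)
    then have "j = j'" using fac(2)[OF s'(1)] by simp
    then show "s = t" by (simp add: S T ii xx zz)
  qed
  show "?f ` ?D = ?S"
  proof
    show "?f ` ?D \<subseteq> ?S"
    proof
      fix p assume "p \<in> ?f ` ?D"
      then obtain i x z j where p: "p = ?f (i,(x,z),j)" and i: "i \<le> \<nu>" "q^i dvd a" 
        and xz: "(x,z) \<in> Hyp (a div q^i)" and j: "0 \<le> j" "j < int (q^i)" by force
      define g where "g = int (q^i)"
      define b where "b = int (a div q^i)"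
      define n where "n = int (q^(\<nu>-i))"
      have ab: "int a = g * b" and b0: "b > 0" using fac[OF i(2)] by (auto simp: g_def b_def)
      have g0: "g > 0" using q1 by (simp add: g_def)
      have x: "0 \<le> x" "x < b" and xz1: "[x * z = 1] (mod b)" using xz by (auto simp: Hyp_def b_def)
      have m: "int (q^\<nu>) = g * n" using i(1) by (simp add: g_def n_def flip: power_add of_nat_mult)
      define y where "y = (n * z) mod b + b * j"
      have pp: "p = (g * x, y)" by (simp add: p g_def b_def n_def y_def)
      have "g * x \<in> {0..<int a}" using x g0 by (auto simp: ab)
      moreover have "y \<in> {0..<int a}"
      proof -
        have "0 \<le> (n * z) mod b" "(n * z) mod b < b" using b0 by auto
        moreover have "b * j \<le> b * (g - 1)" using j b0 by (intro mult_left_mono) (auto simp: g_def)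
        moreover have "0 \<le> b * j" using j b0 by simp
        ultimately show ?thesis by (auto simp: ab y_def algebra_simps)
      qed
      moreover have "int a dvd g * x * y - int (q^\<nu>)"
      proof -
        have "[x * y = x * (n * z)] (mod b)" unfolding y_def by (intro cong_mult cong_refl) (simp add: cong_def)
        also have "x * (n * z) = n * (x * z)" by simp
        also have "[n * (x * z) = n * 1] (mod b)" using xz1 by (intro cong_mult cong_refl)
        finally have "b dvd x * y - n" by (simp add: cong_iff_dvd_diff)
        then have "g * b dvd g * (x * y - n)" by (rule mult_dvd_mono[OF dvd_refl])
        then show ?thesis unfolding ab m by (simp add: algebra_simps)
      qed
      ultimately show "p \<in> ?S" by (simp add: pp Sol_def)
    qed
    show "?S \<subseteq> ?f ` ?D"
    proof
      fix p assume "p \<in> ?S"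
      then obtain X y where p: "p = (X,y)" and X: "0 \<le> X" "X < int a" and y: "0 \<le> y" "y < int a"
        and dv: "int a dvd X * y - int (q^\<nu>)" by (auto simp: Sol_def)
      define gg where "gg = nat (gcd X (int a))"
      have gg: "int gg = gcd X (int a)" by (simp add: gg_def)
      have "int gg dvd X * y" "int gg dvd X * y - int (q^\<nu>)" 
        using gg dvd_trans[OF _ dv, of "int gg"] by auto
      then have "int gg dvd int (q^\<nu>)" using dvd_diff[of "int gg" "X * y" "X * y - int (q^\<nu>)"] by simp
      then have "gg dvd q^\<nu>" by (simp only: int_dvd_int_iff)
      then obtain i where i: "i \<le> \<nu>" "gg = q^i" using divides_primepow_nat[OF q] by blast
      have "q^i dvd a" using gg by (metis gcd_dvd2 i(2) int_dvd_int_iff)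
      define g where "g = int (q^i)"
      define b where "b = int (a div q^i)"
      define n where "n = int (q^(\<nu>-i))"
      have ab: "int a = g * b" and b0: "b > 0" using fac[OF \<open>q^i dvd a\<close>] by (auto simp: g_def b_def)
      have g0: "g > 0" using q1 by (simp add: g_def)
      have m: "int (q^\<nu>) = g * n" using i(1) by (simp add: g_def n_def flip: power_add of_nat_mult)
      have "g dvd X" using gg i by (simp add: g_def)
      then obtain x where x: "X = g * x" ..
      have "g * gcd x b = g" using gcd_mult_distrib_int[of g x b] gg i x ab by (simp add: g_def)
      then have cop: "coprime x b" using g0 by (simp add: coprime_iff_gcd_eq_1)
      have xr: "0 \<le> x" "x < b" using X g0 by (auto simp: x ab zero_le_mult_iff)
      obtain z where z: "(x,z) \<in> Hyp (a div q^i)" 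
        using Hyp_exists[of "a div q^i" x] cop fac(2)[OF \<open>q^i dvd a\<close>] xr by (auto simp: b_def)
      have xz: "[x * z = 1] (mod b)" using z by (simp add: Hyp_def b_def)
      have "g * b dvd g * (x * y - n)" using dv unfolding x ab m by (simp add: algebra_simps)
      then have "b dvd x * y - n" using g0 by simp
      then have "[x * y = n] (mod b)" by (simp add: cong_iff_dvd_diff)
      then have "[z * (x * y) = z * n] (mod b)" by (intro cong_mult cong_refl)
      moreover have "[(x * z) * y = 1 * y] (mod b)" using xz by (intro cong_mult cong_refl)
      ultimately have "[y = n * z] (mod b)" by (metis cong_sym cong_trans mult.assoc mult.commute mult_1)
      then have "y mod b = (n * z) mod b" by (simp add: cong_def)
      then have "y = (n * z) mod b + b * (y div b)" using mod_mult_div_eq[of y b] by simp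
      moreover have "0 \<le> y div b" using y b0 by (simp add: pos_imp_zdiv_nonneg_iff)
      moreover have "y div b < g"
      proof (rule ccontr)
        assume "\<not> y div b < g"
        then have "b * g \<le> b * (y div b)" using b0 by (intro mult_left_mono) auto
        also have "\<dots> \<le> y" using mod_mult_div_eq[of y b] pos_mod_sign[of b y] b0 by linarith
        finally show False using y by (simp add: ab mult.commute)
      qed
      ultimately have "p = ?f (i,(x,z),y div b)" "(i,(x,z),y div b) \<in> ?D"
        using z i \<open>q^i dvd a\<close> by (auto simp: p x g_def b_def n_def)
      then show "p \<in> ?f ` ?D" by (rule image_eqI)
    qed
  qed
qed

lemma sum_Sol:
  fixes F :: "int \<Rightarrow> int \<Rightarrow> 'b::comm_monoid_add"
  assumes q: "prime q" and a: "a > 0"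
  shows "(\<Sum>(x,y)\<in>Sol (q^\<nu>) a. F x y) = (\<Sum>i\<in>{i. i \<le> \<nu> \<and> q^i dvd a}. \<Sum>(x,z)\<in>Hyp (a div q^i). \<Sum>j\<in>{0..<int (q^i)}. 
      F (int (q^i) * x) ((int (q^(\<nu>-i)) * z) mod int (a div q^i) + int (a div q^i) * j))"
proof -
  let ?f = "\<lambda>(i,(x,z),j). (int (q^i) * x, (int (q^(\<nu>-i)) * z) mod int (a div q^i) + int (a div q^i) * j)"
  let ?I = "{i. i \<le> \<nu> \<and> q^i dvd a}"
  have finI: "finite ?I" by simp
  have "(\<Sum>(x,y)\<in>Sol (q^\<nu>) a. F x y) = (\<Sum>t\<in>Sigma ?I (\<lambda>i. Hyp (a div q^i) \<times> {0..<int (q^i)}). case_prod F (?f t))"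
    by (rule sum.reindex_bij_betw[OF Sol_gcd_decomposition[OF assms], symmetric])
  also have "\<dots> = (\<Sum>i\<in>?I. \<Sum>t\<in>Hyp (a div q^i) \<times> {0..<int (q^i)}. case_prod F (?f (i,t)))"
    by (subst sum.Sigma[OF finI]) (auto simp: case_prod_unfold)
  also have "\<dots> = (\<Sum>i\<in>?I. \<Sum>p\<in>Hyp (a div q^i). \<Sum>j\<in>{0..<int (q^i)}. case_prod F (?f (i,p,j)))"
    by (simp only: sum.cartesian_product) (simp add: case_prod_unfold)
  also have "\<dots> = (\<Sum>i\<in>?I. \<Sum>(x,z)\<in>Hyp (a div q^i). \<Sum>j\<in>{0..<int (q^i)}. 
      F (int (q^i) * x) ((int (q^(\<nu>-i)) * z) mod int (a div q^i) + int (a div q^i) * j))"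
    by (intro sum.cong refl) (auto simp: case_prod_unfold)
  finally show ?thesis .
qed

lemma card_Sol:
  assumes q: "prime q" and a: "a > 0"
  shows "card (Sol (q^\<nu>) a) = (\<Sum>i\<in>{i. i \<le> \<nu> \<and> q^i dvd a}. q^i * totient (a div q^i))"
proof -
  have "card (Sol (q^\<nu>) a) = (\<Sum>(x,y)\<in>Sol (q^\<nu>) a. 1)" by simp
  also have "\<dots> = (\<Sum>i\<in>{i. i \<le> \<nu> \<and> q^i dvd a}. q^i * totient (a div q^i))"
    unfolding sum_Sol[OF assms]
  proof (rule sum.cong[OF refl])
    fix i assume "i \<in> {i. i \<le> \<nu> \<and> q^i dvd a}"
    then have "a div q^i > 0" using a by (auto simp: div_greater_zero_iff dvd_imp_le intro: Nat.gr0I)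
    then show "(\<Sum>(x,z)\<in>Hyp (a div q^i). \<Sum>j\<in>{0..<int (q^i)}. 1) = q^i * totient (a div q^i)"
      using card_Hyp by (simp add: case_prod_unfold flip: of_nat_power)
  qed
  finally show ?thesis .
qed

text \<open>In \<open>norm_Ksol_le\<close> the second frequency of the Kloosterman sums changes with
  nu and i while the first stays equal to h. The maximum over the second one makes the bound
  independent of nu.\<close>

definition Kmax :: "int \<Rightarrow> nat \<Rightarrow> real" where
  "Kmax h b = Max ((\<lambda>k. norm (Kloo b h k)) ` {0..<int b})"

lemma Kloo_le_Kmax:
  assumes "b > 0" shows "norm (Kloo b h k) \<le> Kmax h b"
proof -
  have "Kloo b h k = Kloo b h (k mod int b)" by (rule Kloo_cong[OF assms]) (auto simp: cong_def)
  moreover have "k mod int b \<in> {0..<int b}" using assms by simp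
  ultimately show ?thesis unfolding Kmax_def by (intro Max_ge) auto
qed

lemma Kmax_attained:
  assumes "b > 0" obtains k where "Kmax h b = norm (Kloo b h k)"
proof -
  have "Kmax h b \<in> (\<lambda>k. norm (Kloo b h k)) ` {0..<int b}"
    unfolding Kmax_def using assms by (intro Max_in) auto
  then show ?thesis using that by auto
qed

lemma Kmax_nonneg: "b > 0 \<Longrightarrow> 0 \<le> Kmax h b"
  by (metis Kmax_attained norm_ge_zero)

lemma Kmax_le: "b > 0 \<Longrightarrow> Kmax h b \<le> real b"
  using norm_Kloo_le totient_le by (metis Kmax_attained of_nat_le_iff order_trans)

lemma Kmax_bound: "b > 0 \<Longrightarrow> h \<noteq> 0 \<Longrightarrow> Kmax h b ^ 4 \<le> (4 * \<bar>real_of_int h\<bar> + 2) * real b ^ 3 * real (dcount b) ^ 3"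
  using Kloo_bound by (metis Kmax_attained)

lemma echar_scale:
  assumes "g > 0" "a = g * b"
  shows "echar a (int g * t) = echar b t"
  using assms by (simp add: echar_def mult.assoc)

text \<open>In the part with gcd q^i the sum over the lifts j is q^i or 0, according to whether q^i
  divides k. In the first case a Kloosterman sum of modulus a/q^i with first frequency h
  remains.\<close>

lemma norm_Ksol_le:
  assumes q: "prime q" and a: "a > 0"
  shows "norm (Ksol (q^\<nu>) a h k) \<le> (\<Sum>i\<in>{i. i \<le> \<nu> \<and> q^i dvd a}. real (q^i) * Kmax h (a div q^i))"
  unfolding Ksol_def sum_Sol[OF assms]
proof (rule sum_norm_le)
  fix i assume i: "i \<in> {i. i \<le> \<nu> \<and> q^i dvd a}"
  define g where "g = q^i"
  define b where "b = a div q^i"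
  define n where "n = int (q^(\<nu>-i))"
  have q1: "q > 1" using q prime_gt_1_nat by blast
  have g0: "g > 0" using q1 by (simp add: g_def)
  have ab: "a = g * b" using i by (simp add: g_def b_def)
  have b0: "b > 0" using a ab by simp
  have ech: "echar a (h * (int g * x) + k * ((n * z) mod int b + int b * j)) = 
      echar b (h * x) * echar a (k * ((n * z) mod int b)) * echar g (j * k)" for x z j
  proof -
    have "h * (int g * x) + k * ((n * z) mod int b + int b * j) = int g * (h * x) + k * ((n * z) mod int b) + int b * (j * k)"
      by (simp add: algebra_simps)
    moreover have "a = b * g" using ab by simp
    ultimately show ?thesis using echar_scale[OF g0 ab] echar_scale[OF b0, of a g]
      by (simp only: echar_add)
  qed
  have sumj: "(\<Sum>j\<in>{0..<int g}. echar a (h * (int g * x) + k * ((n * z) mod int b + int b * j))) = 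
      echar b (h * x) * echar a (k * ((n * z) mod int b)) * (if int g dvd k then of_nat g else 0)" for x z
    unfolding ech sum_distrib_left[symmetric] sum_echar[OF g0] ..
  have "norm (\<Sum>(x,z)\<in>Hyp b. \<Sum>j\<in>{0..<int g}. echar a (h * (int g * x) + k * ((n * z) mod int b + int b * j))) 
     \<le> real g * Kmax h b"
  proof (cases "int g dvd k")
    case False
    then show ?thesis unfolding sumj using Kmax_nonneg[OF b0] by simp
  next
    case True
    then obtain k' where k': "k = int g * k'" ..
    have "echar a (k * ((n * z) mod int b)) = echar b (k' * n * z)" for z
    proof -
      have "echar a (k * ((n * z) mod int b)) = echar b (k' * ((n * z) mod int b))"
        unfolding k' mult.assoc by (rule echar_scale[OF g0 ab])
      also have "\<dots> = echar b (k' * (n * z))"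
        by (rule echar_cong[OF b0], intro cong_mult cong_refl) simp
      finally show ?thesis by (simp add: mult.assoc)
    qed
    then have "(\<Sum>(x,z)\<in>Hyp b. \<Sum>j\<in>{0..<int g}. echar a (h * (int g * x) + k * ((n * z) mod int b + int b * j))) 
      = of_nat g * Kloo b h (k' * n)"
      unfolding sumj Kloo_def sum_distrib_left using True 
      by (intro sum.cong refl) (auto simp: echar_add)
    then show ?thesis using Kloo_le_Kmax[OF b0] by (simp add: norm_mult mult_left_mono)
  qed
  then show "norm (\<Sum>(x,z)\<in>Hyp (a div q^i). \<Sum>j\<in>{0..<int (q^i)}. 
      echar a (h * (int (q^i) * x) + k * ((int (q^(\<nu>-i)) * z) mod int (a div q^i) + int (a div q^i) * j)))
     \<le> real (q^i) * Kmax h (a div q^i)"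
    by (simp only: g_def b_def n_def)
qed

lemma sum_multiples:
  fixes f :: "nat \<Rightarrow> 'b::comm_monoid_add"
  assumes "g > 0"
  shows "(\<Sum>a\<in>{a\<in>{1..N}. g dvd a}. f (a div g)) = (\<Sum>b\<in>{1..N div g}. f b)"
proof (rule sum.reindex_bij_witness[where i = "\<lambda>b. g * b" and j = "\<lambda>a. a div g"])
  fix a assume "a \<in> {a\<in>{1..N}. g dvd a}"
  then show "g * (a div g) = a" "a div g \<in> {1..N div g}" "f (a div g) = f (a div g)"
    using assms by (auto simp: div_le_mono div_greater_zero_iff Suc_le_eq dvd_imp_le)
next
  fix b assume b: "b \<in> {1..N div g}"
  then have "g * b \<le> g * (N div g)" by simp
  also have "\<dots> \<le> N" by simp
  finally show "g * b div g = b" "g * b \<in> {a\<in>{1..N}. g dvd a}" using assms b by auto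
qed

text \<open>A pair (a, i) with q^i dividing a is the same as a pair (i, b), through a = q^i
  b.\<close>

lemma sum_swap_prime_powers:
  fixes f :: "nat \<Rightarrow> nat \<Rightarrow> 'b::comm_monoid_add"
  assumes "q > (0::nat)"
  shows "(\<Sum>a\<in>{1..N}. \<Sum>i\<in>{i. i \<le> \<nu> \<and> q^i dvd a}. f i (a div q^i)) = (\<Sum>i\<le>\<nu>. \<Sum>b\<in>{1..N div q^i}. f i b)"
proof -
  have "(\<Sum>a\<in>{1..N}. \<Sum>i\<in>{i. i \<le> \<nu> \<and> q^i dvd a}. f i (a div q^i)) = 
      (\<Sum>a\<in>{1..N}. \<Sum>i\<in>{i\<in>{..\<nu>}. q^i dvd a}. f i (a div q^i))"
    by (intro sum.cong refl) auto
  also have "\<dots> = (\<Sum>i\<le>\<nu>. \<Sum>a\<in>{a\<in>{1..N}. q^i dvd a}. f i (a div q^i))"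
    by (rule sum.swap_restrict) auto
  also have "\<dots> = (\<Sum>i\<le>\<nu>. \<Sum>b\<in>{1..N div q^i}. f i b)"
    using assms by (intro sum.cong refl sum_multiples) auto
  finally show ?thesis .
qed

section \<open>Dominated convergence for sums over divisors\<close>

lemma div_ratio_tendsto:
  assumes "filterlim N at_top F" "d > (0::nat)"
  shows "((\<lambda>v. real (N v div d) / real (N v)) \<longlongrightarrow> 1 / real d) F"
proof -
  have "((\<lambda>n. real (n div d) / real n) \<longlongrightarrow> 1 / real d) sequentially"
  proof (rule tendsto_sandwich)
    show "eventually (\<lambda>n. 1 / real d - 1 / real n \<le> real (n div d) / real n) sequentially"
      using eventually_gt_at_top[of 0]
    proof eventually_elim
      case (elim n)
      have "n \<le> d * (n div d) + d" 
        using mult_div_mod_eq[of d n] mod_less_divisor[OF assms(2), of n] by linarith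
      then have "real n \<le> real d * real (n div d) + real d" by (metis of_nat_add of_nat_le_iff of_nat_mult)
      then have "(real n - real d) / (real d * real n) \<le> (real d * real (n div d)) / (real d * real n)"
        by (intro divide_right_mono) auto
      then show ?case using elim assms(2) by (simp add: diff_divide_distrib)
    qed
    show "eventually (\<lambda>n. real (n div d) / real n \<le> 1 / real d) sequentially"
      using eventually_gt_at_top[of 0]
    proof eventually_elim
      case (elim n)
      have "d * (n div d) \<le> n" by simp
      then have "real d * real (n div d) \<le> real n" by (metis of_nat_le_iff of_nat_mult)
      then show ?case using elim assms(2) by (simp add: field_simps)
    qed
    show "((\<lambda>n. 1 / real d - 1 / real n) \<longlongrightarrow> 1 / real d) sequentially" by real_asymp
  qed auto
  from filterlim_compose[OF this assms(1)] show ?thesis .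
qed

lemma div_ratio_le: "real (n div d) / real n \<le> 1 / real d"
proof (cases "n = 0 \<or> d = 0")
  case False
  have "d * (n div d) \<le> n" by simp
  then have "real d * real (n div d) \<le> real n" by (metis of_nat_le_iff of_nat_mult)
  then show ?thesis using False by (simp add: field_simps)
qed auto

text \<open>The shape of the summand is that of a sum of a^n f(a/d) over the multiples a <= N of d,
  normalized by N^(n+2), with r(Z) the normalized sum of b^n f(b) over b <= Z. Because (N div d)/N
  <= 1/d, the term of index i is at most C w_i/d_i^2 for every nu, so the limit may be taken
  termwise. It serves both for d_i = q^i and for d_i = i + 1.\<close>

lemma tannery_div:
  fixes d :: "nat \<Rightarrow> nat" and w r :: "nat \<Rightarrow> real" and N M :: "nat \<Rightarrow> nat"
  assumes d: "\<And>i. d i > 0" and w: "\<And>i. w i \<ge> 0" and summ: "summable (\<lambda>i. w i / real (d i)^2)"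
    and N: "filterlim N at_top sequentially" and M: "filterlim M at_top sequentially"
    and r: "\<And>k. \<bar>r k\<bar> \<le> C" and lim: "r \<longlonglongrightarrow> L"
  shows "(\<lambda>\<nu>. \<Sum>i<M \<nu>. w i * real (d i)^n * (real (N \<nu> div d i) / real (N \<nu>))^(n+2) * r (N \<nu> div d i))
     \<longlonglongrightarrow> L * (\<Sum>i. w i / real (d i)^2)"
proof -
  let ?t = "\<lambda>i \<nu>. w i * real (d i)^n * (real (N \<nu> div d i) / real (N \<nu>))^(n+2) * r (N \<nu> div d i)"
  define a where "a = (\<lambda>i \<nu>. if i < M \<nu> then ?t i \<nu> else 0)"
  define b where "b = (\<lambda>i. L * (w i / real (d i)^2))"
  have C0: "0 \<le> C" using r[of 0] by linarith
  have bound: "\<bar>?t i \<nu>\<bar> \<le> C * (w i / real (d i)^2)" for i \<nu>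
  proof -
    have "(real (N \<nu> div d i) / real (N \<nu>))^(n+2) \<le> (1 / real (d i))^(n+2)"
      by (rule power_mono[OF div_ratio_le]) simp
    then have "\<bar>?t i \<nu>\<bar> \<le> w i * real (d i)^n * (1 / real (d i))^(n+2) * C"
      unfolding abs_mult using w[of i] r
      by (intro mult_mono) (auto intro!: mult_nonneg_nonneg simp: abs_of_nonneg)
    also have "\<dots> = C * (w i / real (d i)^2)" using d[of i] by (simp add: field_simps power_add power2_eq_square)
    finally show ?thesis .
  qed
  have "((\<lambda>\<nu>. suminf (\<lambda>i. a i \<nu>)) \<longlongrightarrow> suminf b) sequentially"
  proof (rule tannerys_theorem[THEN conjunct2, THEN conjunct2])
    show "((\<lambda>\<nu>. a i \<nu>) \<longlongrightarrow> b i) sequentially" for i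
    proof -
      have "filterlim (\<lambda>n. n div d i) at_top sequentially"
        unfolding filterlim_at_top eventually_sequentially
        using d[of i] by (metis div_le_mono nonzero_mult_div_cancel_left less_not_refl2)
      then have dv: "filterlim (\<lambda>\<nu>. N \<nu> div d i) at_top sequentially"
        by (rule filterlim_compose[OF _ N])
      have "(\<lambda>\<nu>. ?t i \<nu>) \<longlonglongrightarrow> w i * real (d i)^n * (1 / real (d i))^(n+2) * L"
        by (intro tendsto_intros div_ratio_tendsto[OF N d] filterlim_compose[OF lim dv])
      also have "w i * real (d i)^n * (1 / real (d i))^(n+2) * L = b i"
        using d[of i] by (simp add: b_def field_simps power_add power2_eq_square)
      finally have "(\<lambda>\<nu>. ?t i \<nu>) \<longlonglongrightarrow> b i" .
      moreover have "eventually (\<lambda>\<nu>. ?t i \<nu> = a i \<nu>) sequentially"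
      proof -
        have "eventually (\<lambda>\<nu>. M \<nu> \<ge> Suc i) sequentially" 
          using M unfolding filterlim_at_top by blast
        then show ?thesis by eventually_elim (simp add: a_def)
      qed
      ultimately show ?thesis by (rule Lim_transform_eventually)
    qed
    have "norm (a i \<nu>) \<le> C * (w i / real (d i)^2)" for i \<nu>
      using bound[of i \<nu>] C0 w[of i] by (simp add: a_def)
    then show "eventually (\<lambda>(i,\<nu>). norm (a i \<nu>) \<le> C * (w i / real (d i)^2)) (at_top \<times>\<^sub>F sequentially)"
      by (intro always_eventually) auto
    show "summable (\<lambda>i. C * (w i / real (d i)^2))" by (intro summable_mult summ)
  qed auto
  moreover have "suminf (\<lambda>i. a i \<nu>) = (\<Sum>i<M \<nu>. ?t i \<nu>)" for \<nu>
    by (subst suminf_finite[of "{..<M \<nu>}"]) (auto simp: a_def)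
  moreover have "suminf b = L * (\<Sum>i. w i / real (d i)^2)"
    unfolding b_def by (rule suminf_mult[OF summ])
  ultimately show ?thesis by simp
qed

text \<open>Counting by the divisor d instead gives Z div d <= Z/d multiples up to Z, hence a
  harmonic sum.\<close>

lemma sum_dcount_le: "real (\<Sum>b\<in>{1..Z}. dcount b) \<le> real Z * (1 + ln (real Z))" 
proof (cases "Z = 0")
  case False
  have "(\<Sum>b\<in>{1..Z}. dcount b) = (\<Sum>b\<in>{1..Z}. \<Sum>d\<in>{d\<in>{1..Z}. d dvd b}. 1)"
  proof (rule sum.cong[OF refl])
    fix b assume b: "b \<in> {1..Z}"
    then have "{d\<in>{1..Z}. d dvd b} = {d. d dvd b}" by (auto dest: dvd_imp_le intro!: Nat.gr0I simp: Suc_le_eq)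
    then show "dcount b = (\<Sum>d\<in>{d\<in>{1..Z}. d dvd b}. 1)" by (simp add: dcount_def)
  qed
  also have "\<dots> = (\<Sum>d\<in>{1..Z}. \<Sum>b\<in>{b\<in>{1..Z}. d dvd b}. 1)" by (rule sum.swap_restrict) auto
  also have "\<dots> = (\<Sum>d\<in>{1..Z}. Z div d)"
    by (intro sum.cong refl) (subst sum_multiples[where f = "\<lambda>_. 1"], auto)
  finally have "real (\<Sum>b\<in>{1..Z}. dcount b) = (\<Sum>d\<in>{1..Z}. real (Z div d))" by simp
  also have "\<dots> \<le> (\<Sum>d\<in>{1..Z}. real Z * inverse (real d))"
  proof (rule sum_mono)
    fix d assume d: "d \<in> {1..Z}"
    have "d * (Z div d) \<le> Z" by simp
    then have "real d * real (Z div d) \<le> real Z" by (metis of_nat_le_iff of_nat_mult)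
    then show "real (Z div d) \<le> real Z * inverse (real d)" using d by (simp add: field_simps)
  qed
  also have "\<dots> = real Z * harm Z" by (simp add: harm_def sum_distrib_left)
  also have "\<dots> \<le> real Z * (1 + ln (real Z))"
  proof (rule mult_left_mono)
    have "harm (Suc (Z - 1)) - ln (real (Suc (Z - 1))) \<le> harm (Suc 0) - ln (real (Suc 0))"
      using decseqD[OF decseq_harm_diff_ln, of 0 "Z - 1"] by simp
    then show "harm Z \<le> 1 + ln (real Z)" using False by (simp add: harm_def)
  qed auto
  finally show ?thesis .
qed auto

text \<open>Moduli are separated by the size of their divisor function, with threshold T = Z^(1/4).
  Below it, the Kloosterman bound gives O((Z T)^(3/4)) = O(Z^(15/16)) for each modulus. Above it,
  the trivial bound is at most Z d(b)/T, and the mean value of the divisor function makes the total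
  at most Z^2 (1 + ln Z)/T. Any exponent between 0 and 1/3 in T would serve.\<close>

lemma sum_Kmax_little_o:
  assumes h: "h \<noteq> 0"
  shows "(\<lambda>Z. (\<Sum>b\<in>{1..Z}. Kmax h b) / real Z ^ 2) \<longlonglongrightarrow> 0"
proof -
  define C where "C = 4 * \<bar>real_of_int h\<bar> + 2"
  have C0: "C > 0" by (simp add: C_def)
  have bound: "(\<Sum>b\<in>{1..Z}. Kmax h b) / real Z ^ 2 \<le> 
      C powr (1/4) * real Z powr (-1/16) + (1 + ln (real Z)) / real Z powr (1/4)" if Z: "Z > 0" for Z
  proof -
    define T where "T = real Z powr (1/4)"
    have T0: "T > 0" using Z by (simp add: T_def)
    have T4: "T ^ 4 = real Z" using Z by (simp add: T_def powr_power)
    have each: "Kmax h b \<le> C powr (1/4) * real Z powr (15/16) + real Z / T * real (dcount b)" if b: "b \<in> {1..Z}" for b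
    proof (cases "real (dcount b) \<le> T")
      case True
      have "Kmax h b ^ 4 \<le> C * real b ^ 3 * real (dcount b) ^ 3"
        using Kmax_bound[OF _ h] b unfolding C_def by simp
      also have "\<dots> \<le> C * real Z ^ 3 * T ^ 3"
        using True b C0 by (intro mult_mono power_mono) auto
      also have "\<dots> = (C powr (1/4) * real Z powr (15/16)) ^ 4"
      proof -
        have "T ^ 3 = real Z powr (3/4)" using Z by (simp add: T_def powr_power)
        moreover have "real Z ^ 3 = real Z powr 3" using Z by (simp add: powr_numeral)
        ultimately have "real Z ^ 3 * T ^ 3 = real Z powr 3 * real Z powr (3/4)" by (simp only:)
        also have "\<dots> = real Z powr (15/4)" by (simp only: powr_add[symmetric]) simp
        finally have "real Z ^ 3 * T ^ 3 = real Z powr (15/4)" .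
        then have "C * real Z ^ 3 * T ^ 3 = C * real Z powr (15/4)" by simp
        also have "\<dots> = (C powr (1/4) * real Z powr (15/16)) ^ 4" 
          using C0 Z by (simp add: power_mult_distrib powr_power)
        finally show ?thesis .
      qed
      finally have "Kmax h b \<le> C powr (1/4) * real Z powr (15/16)"
        by (rule power_le_imp_le_base[of _ 3, simplified]) simp
      moreover have "0 \<le> real Z / T * real (dcount b)" using T0 by simp
      ultimately show ?thesis by linarith
    next
      case False
      have "Kmax h b \<le> real b" using b by (intro Kmax_le) auto
      also have "\<dots> \<le> real Z * 1" using b by simp
      also have "\<dots> \<le> real Z * (real (dcount b) / T)" using False T0 by (intro mult_left_mono) auto
      also have "\<dots> = real Z / T * real (dcount b)" by simp
      finally show ?thesis by (simp add: add_increasing)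
    qed
    have "(\<Sum>b\<in>{1..Z}. Kmax h b) \<le> (\<Sum>b\<in>{1..Z}. C powr (1/4) * real Z powr (15/16) + real Z / T * real (dcount b))"
      by (rule sum_mono) (rule each)
    also have "\<dots> = real Z * (C powr (1/4) * real Z powr (15/16)) + real Z / T * real (\<Sum>b\<in>{1..Z}. dcount b)"
      by (simp add: sum.distrib sum_distrib_left)
    also have "\<dots> \<le> real Z * (C powr (1/4) * real Z powr (15/16)) + real Z / T * (real Z * (1 + ln (real Z)))"
      using T0 by (intro add_left_mono mult_left_mono sum_dcount_le) auto
    finally have "(\<Sum>b\<in>{1..Z}. Kmax h b) / real Z ^ 2 \<le> 
       (real Z * (C powr (1/4) * real Z powr (15/16)) + real Z / T * (real Z * (1 + ln (real Z)))) / real Z ^ 2"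
      by (rule divide_right_mono) simp
    also have "\<dots> = C powr (1/4) * (real Z powr (15/16) / real Z) + (1 + ln (real Z)) / T"
      using Z T0 by (simp add: field_simps power2_eq_square)
    also have "real Z powr (15/16) / real Z = real Z powr (-1/16)"
      using Z powr_diff[of "real Z" "15/16" 1] by simp
    finally show ?thesis by (simp add: T_def)
  qed
  show ?thesis
  proof (rule tendsto_sandwich)
    show "eventually (\<lambda>Z. 0 \<le> (\<Sum>b\<in>{1..Z}. Kmax h b) / real Z ^ 2) sequentially"
      by (intro always_eventually allI divide_nonneg_nonneg sum_nonneg) (auto intro: Kmax_nonneg)
    show "eventually (\<lambda>Z. (\<Sum>b\<in>{1..Z}. Kmax h b) / real Z ^ 2 \<le> 
      C powr (1/4) * real Z powr (-1/16) + (1 + ln (real Z)) / real Z powr (1/4)) sequentially"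
      using eventually_gt_at_top[of 0] by eventually_elim (rule bound)
    show "(\<lambda>Z. C powr (1/4) * real Z powr (-1/16) + (1 + ln (real Z)) / real Z powr (1/4)) \<longlonglongrightarrow> 0"
      using C0 by real_asymp
  qed auto
qed

lemma prime_power_weights:
  assumes "q > (1::nat)"
  shows "summable (\<lambda>i. real (q^i) / real (q^i)^2)" "(\<Sum>i. real (q^i) / real (q^i)^2) = 1 / (1 - 1 / real q)"
proof -
  have e: "real (q^i) / real (q^i)^2 = (1 / real q) ^ i" for i
    using assms by (simp add: power2_eq_square power_divide)
  have "norm (1 / real q) < 1" using assms by simp
  then show "summable (\<lambda>i. real (q^i) / real (q^i)^2)" "(\<Sum>i. real (q^i) / real (q^i)^2) = 1 / (1 - 1 / real q)"
    unfolding e by (auto intro: summable_geometric simp: suminf_geometric)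
qed

text \<open>For nonzero h, \<open>tannery_div\<close> applies with limit L = 0, because the
  normalized sums of \<open>Kmax h\<close> are bounded and tend to 0. For h = 0 the symmetry of
  \<open>Ksol\<close> exchanges the frequencies.\<close>

lemma Ksol_average:
  assumes q: "prime q" and N: "filterlim N at_top sequentially" and hk: "h \<noteq> 0 \<or> k \<noteq> 0"
  shows "(\<lambda>\<nu>. (\<Sum>a\<in>{1..N \<nu>}. norm (Ksol (q^\<nu>) a h k)) / real (N \<nu>) ^ 2) \<longlonglongrightarrow> 0"
proof -
  have main: "(\<lambda>\<nu>. (\<Sum>a\<in>{1..N \<nu>}. norm (Ksol (q^\<nu>) a h k)) / real (N \<nu>) ^ 2) \<longlonglongrightarrow> 0" if h: "h \<noteq> 0" for h k
  proof -
    have q1: "q > 1" using q prime_gt_1_nat by blast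
    define r where "r = (\<lambda>Z. (\<Sum>b\<in>{1..Z}. Kmax h b) / real Z ^ 2)"
    have r0: "0 \<le> r Z" for Z unfolding r_def
      by (intro divide_nonneg_nonneg sum_nonneg) (auto intro: Kmax_nonneg)
    have r1: "\<bar>r Z\<bar> \<le> 1" for Z
    proof (cases "Z = 0")
      case False
      have "(\<Sum>b\<in>{1..Z}. Kmax h b) \<le> (\<Sum>b\<in>{1..Z}. real Z)"
      proof (rule sum_mono)
        fix b assume b: "b \<in> {1..Z}"
        then have "Kmax h b \<le> real b" by (intro Kmax_le) auto
        also have "\<dots> \<le> real Z" using b by simp
        finally show "Kmax h b \<le> real Z" .
      qed
      then have "r Z \<le> 1" using False by (simp add: r_def power2_eq_square)
      then show ?thesis using r0[of Z] by simp
    qed (simp add: r_def)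
    have lim: "(\<lambda>\<nu>. \<Sum>i<Suc \<nu>. real (q^i) * real (q^i)^0 * (real (N \<nu> div q^i) / real (N \<nu>))^(0+2) * r (N \<nu> div q^i))
       \<longlonglongrightarrow> 0 * (\<Sum>i. real (q^i) / real (q^i)^2)"
    proof (rule tannery_div[OF _ _ prime_power_weights(1)[OF q1] N filterlim_Suc r1])
      show "r \<longlonglongrightarrow> 0" unfolding r_def by (rule sum_Kmax_little_o[OF h])
    qed (use q1 in auto)
    have ub: "(\<Sum>a\<in>{1..N \<nu>}. norm (Ksol (q^\<nu>) a h k)) / real (N \<nu>) ^ 2 \<le>
      (\<Sum>i<Suc \<nu>. real (q^i) * real (q^i)^0 * (real (N \<nu> div q^i) / real (N \<nu>))^(0+2) * r (N \<nu> div q^i))" for \<nu>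
    proof -
      have "(\<Sum>a\<in>{1..N \<nu>}. norm (Ksol (q^\<nu>) a h k)) \<le> 
         (\<Sum>a\<in>{1..N \<nu>}. \<Sum>i\<in>{i. i \<le> \<nu> \<and> q^i dvd a}. real (q^i) * Kmax h (a div q^i))"
        by (intro sum_mono norm_Ksol_le[OF q]) auto
      also have "\<dots> = (\<Sum>i\<le>\<nu>. \<Sum>b\<in>{1..N \<nu> div q^i}. real (q^i) * Kmax h b)"
        using q1 by (intro sum_swap_prime_powers) auto
      also have "\<dots> = (\<Sum>i<Suc \<nu>. real (q^i) * (real (N \<nu> div q^i)^2 * r (N \<nu> div q^i)))"
      proof -
        have "real Z ^ 2 * r Z = (\<Sum>b\<in>{1..Z}. Kmax h b)" for Z by (simp add: r_def)
        then show ?thesis unfolding lessThan_Suc_atMost by (simp add: sum_distrib_left)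
      qed
      finally have "(\<Sum>a\<in>{1..N \<nu>}. norm (Ksol (q^\<nu>) a h k)) / real (N \<nu>) ^ 2 \<le> 
         (\<Sum>i<Suc \<nu>. real (q^i) * (real (N \<nu> div q^i)^2 * r (N \<nu> div q^i))) / real (N \<nu>) ^ 2"
        by (rule divide_right_mono) simp
      also have "\<dots> = (\<Sum>i<Suc \<nu>. real (q^i) * real (q^i)^0 * (real (N \<nu> div q^i) / real (N \<nu>))^(0+2) * r (N \<nu> div q^i))"
        unfolding sum_divide_distrib by (intro sum.cong refl) (simp add: power_divide power2_eq_square)
      finally show ?thesis .
    qed
    have lim0: "(\<lambda>\<nu>. \<Sum>i<Suc \<nu>. real (q^i) * real (q^i)^0 * (real (N \<nu> div q^i) / real (N \<nu>))^(0+2) * r (N \<nu> div q^i)) \<longlonglongrightarrow> 0"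
      using lim by (simp only: mult_zero_left)
    show ?thesis
    proof (rule tendsto_sandwich[OF _ _ tendsto_const lim0])
      show "eventually (\<lambda>\<nu>. 0 \<le> (\<Sum>a\<in>{1..N \<nu>}. norm (Ksol (q^\<nu>) a h k)) / real (N \<nu>) ^ 2) sequentially"
        by (intro always_eventually allI divide_nonneg_nonneg sum_nonneg) auto
    qed (use ub in auto)
  qed
  show ?thesis using hk main[of h k] main[of k h] by (auto simp: Ksol_commute[of _ _ h k])
qed

section \<open>Mean value of Euler's function\<close>

lemma sum_powers_asymp: "(\<lambda>N. (\<Sum>b\<in>{1..N}. real b ^ Suc n) / real N ^ (n + 2)) \<longlonglongrightarrow> 1 / real (n + 2)"
proof -
  have upper: "(\<Sum>b\<in>{1..N}. real b ^ Suc n) \<le> (real N + 1) ^ (n + 2) / real (n + 2)"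
    and lower: "real N ^ (n + 2) / real (n + 2) \<le> (\<Sum>b\<in>{1..N}. real b ^ Suc n)" for N
  proof -
    \<comment> \<open>The difference is a sum of n + 2 products x^(n+1-i) (x+1)^i, each between
      x^(n+1) and (x+1)^(n+1). Both bounds telescope in the inductions below.\<close>
    have step: "real (n + 2) * x ^ Suc n \<le> (x + 1) ^ (n + 2) - x ^ (n + 2)"
      "(x + 1) ^ (n + 2) - x ^ (n + 2) \<le> real (n + 2) * (x + 1) ^ Suc n" if x: "x \<ge> 0" for x :: real
    proof -
      have e: "(x + 1) ^ Suc (Suc n) - x ^ Suc (Suc n) = (x + 1 - x) * (\<Sum>i<Suc (Suc n). x ^ (Suc n - i) * (x + 1) ^ i)"
        by (subst power_diff_sumr2) simp
      have 1: "x ^ (Suc n - i) * (x + 1) ^ i \<le> (x + 1) ^ Suc n" if "i < Suc (Suc n)" for i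
      proof -
        have "x ^ (Suc n - i) * (x + 1) ^ i \<le> (x + 1) ^ (Suc n - i) * (x + 1) ^ i"
          using x by (intro mult_right_mono power_mono) auto
        also have "\<dots> = (x + 1) ^ Suc n" using that by (simp flip: power_add)
        finally show ?thesis .
      qed
      have 2: "x ^ Suc n \<le> x ^ (Suc n - i) * (x + 1) ^ i" if "i < Suc (Suc n)" for i
      proof -
        have "x ^ Suc n = x ^ (Suc n - i) * x ^ i" using that by (simp flip: power_add)
        also have "\<dots> \<le> x ^ (Suc n - i) * (x + 1) ^ i"
          using x by (intro mult_left_mono power_mono) auto
        finally show ?thesis .
      qed
      have "(\<Sum>i<Suc (Suc n). x ^ (Suc n - i) * (x + 1) ^ i) \<le> (\<Sum>i<Suc (Suc n). (x + 1) ^ Suc n)"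
        by (rule sum_mono) (use 1 in auto)
      moreover have "(\<Sum>i<Suc (Suc n). x ^ Suc n) \<le> (\<Sum>i<Suc (Suc n). x ^ (Suc n - i) * (x + 1) ^ i)"
        by (rule sum_mono) (use 2 in auto)
      ultimately show "real (n + 2) * x ^ Suc n \<le> (x + 1) ^ (n + 2) - x ^ (n + 2)"
        "(x + 1) ^ (n + 2) - x ^ (n + 2) \<le> real (n + 2) * (x + 1) ^ Suc n" using e by simp_all
    qed
    have "real (n + 2) * (\<Sum>b\<in>{1..N}. real b ^ Suc n) \<le> (real N + 1) ^ (n + 2)"
    proof (induction N)
      case (Suc N)
      have "(\<Sum>b\<in>{1..Suc N}. real b ^ Suc n) = (\<Sum>b\<in>{1..N}. real b ^ Suc n) + real (Suc N) ^ Suc n" by simp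
      moreover have "real N + 1 = real (Suc N)" by simp
      ultimately show ?case using step(1)[of "real (Suc N)", OF of_nat_0_le_iff] Suc.IH 
        by (simp only: distrib_left; linarith)
    qed simp
    then show "(\<Sum>b\<in>{1..N}. real b ^ Suc n) \<le> (real N + 1) ^ (n + 2) / real (n + 2)"
      by (simp add: pos_le_divide_eq mult.commute)
    have "real N ^ (n + 2) \<le> real (n + 2) * (\<Sum>b\<in>{1..N}. real b ^ Suc n)"
    proof (induction N)
      case (Suc N)
      have "(\<Sum>b\<in>{1..Suc N}. real b ^ Suc n) = (\<Sum>b\<in>{1..N}. real b ^ Suc n) + real (Suc N) ^ Suc n" by simp
      moreover have "real N + 1 = real (Suc N)" by simp
      ultimately show ?case using step(2)[of "real N", OF of_nat_0_le_iff] Suc.IH 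
        by (simp only: distrib_left; linarith)
    qed simp
    then show "real N ^ (n + 2) / real (n + 2) \<le> (\<Sum>b\<in>{1..N}. real b ^ Suc n)"
      by (simp add: pos_divide_le_eq mult.commute)
  qed
  have "(\<lambda>N. (real N + 1) / real N) \<longlonglongrightarrow> 1" by real_asymp
  then have "(\<lambda>N. ((real N + 1) / real N) ^ (n + 2) / real (n + 2)) \<longlonglongrightarrow> 1 ^ (n + 2) / real (n + 2)"
    by (intro tendsto_intros) auto
  then have lim: "(\<lambda>N. ((real N + 1) / real N) ^ (n + 2) / real (n + 2)) \<longlonglongrightarrow> 1 / real (n + 2)" by simp
  show ?thesis
  proof (rule tendsto_sandwich[OF _ _ tendsto_const lim])
    show "eventually (\<lambda>N. 1 / real (n + 2) \<le> (\<Sum>b\<in>{1..N}. real b ^ Suc n) / real N ^ (n + 2)) sequentially"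
      using eventually_gt_at_top[of 0]
    proof eventually_elim
      case (elim N)
      have "1 / real (n + 2) = (real N ^ (n + 2) / real (n + 2)) / real N ^ (n + 2)" using elim by simp
      also have "\<dots> \<le> (\<Sum>b\<in>{1..N}. real b ^ Suc n) / real N ^ (n + 2)"
        using lower by (intro divide_right_mono) auto
      finally show ?case .
    qed
    show "eventually (\<lambda>N. (\<Sum>b\<in>{1..N}. real b ^ Suc n) / real N ^ (n + 2) \<le> ((real N + 1) / real N) ^ (n + 2) / real (n + 2)) sequentially"
    proof (intro always_eventually allI)
      fix N
      have "(\<Sum>b\<in>{1..N}. real b ^ Suc n) / real N ^ (n + 2) \<le> ((real N + 1) ^ (n + 2) / real (n + 2)) / real N ^ (n + 2)"
        using upper by (intro divide_right_mono) auto
      then show "(\<Sum>b\<in>{1..N}. real b ^ Suc n) / real N ^ (n + 2) \<le> ((real N + 1) / real N) ^ (n + 2) / real (n + 2)"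
        by (simp only: power_divide divide_divide_eq_left mult.commute)
    qed
  qed
qed

lemma sum_inverse_squares: "summable (\<lambda>i. 1 / real (Suc i)^2)" "(\<Sum>i. 1 / real (Suc i)^2) = pi\<^sup>2 / 6"
proof -
  have "(\<lambda>i. 1 / real (Suc i)^2) sums (pi\<^sup>2 / 6)" using inverse_squares_sums by (simp add: add.commute)
  then show "summable (\<lambda>i. 1 / real (Suc i)^2)" "(\<Sum>i. 1 / real (Suc i)^2) = pi\<^sup>2 / 6"
    by (auto simp: sums_iff)
qed

lemma tannery_zeta2:
  fixes r :: "nat \<Rightarrow> real"
  assumes "\<And>k. \<bar>r k\<bar> \<le> C" and "r \<longlonglongrightarrow> L"
  shows "(\<lambda>N. \<Sum>d\<in>{1..N}. real d^n * (real (N div d) / real N)^(n+2) * r (N div d)) \<longlonglongrightarrow> L * (pi\<^sup>2 / 6)"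
proof -
  have "(\<lambda>N. \<Sum>i<N. 1 * real (Suc i)^n * (real (N div Suc i) / real N)^(n+2) * r (N div Suc i))
     \<longlonglongrightarrow> L * (\<Sum>i. 1 / real (Suc i)^2)"
    by (rule tannery_div[OF _ _ sum_inverse_squares(1) filterlim_ident filterlim_ident assms]) auto
  moreover have "(\<Sum>i<N. 1 * real (Suc i)^n * (real (N div Suc i) / real N)^(n+2) * r (N div Suc i)) = 
      (\<Sum>d\<in>{1..N}. real d^n * (real (N div d) / real N)^(n+2) * r (N div d))" for N
    by (rule sum.reindex_bij_witness[where i = "\<lambda>d. d - 1" and j = Suc]) auto
  ultimately show ?thesis by (simp only: sum_inverse_squares(2))
qed

definition tot_sum :: "nat \<Rightarrow> nat \<Rightarrow> real" where
  "tot_sum n N = (\<Sum>b\<in>{1..N}. real b ^ n * real (totient b))"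

text \<open>Expand one factor of b^(n+1) as the sum of \<open>totient (b div d)\<close> over d
  dividing b, write b = d b' and sum over b' first. This identity determines the averages of Euler's
  function from those of powers, in place of Moebius inversion.\<close>

lemma sum_tot_sum: "(\<Sum>d\<in>{1..N}. real d ^ n * tot_sum n (N div d)) = (\<Sum>b\<in>{1..N}. real b ^ Suc n)"
proof -
  have "(\<Sum>b\<in>{1..N}. real b ^ Suc n) = (\<Sum>b\<in>{1..N}. \<Sum>d\<in>{d\<in>{1..N}. d dvd b}. real b ^ n * real (totient (b div d)))"
  proof (rule sum.cong[OF refl])
    fix b assume b: "b \<in> {1..N}"
    then have *: "{d\<in>{1..N}. d dvd b} = {d. d dvd b}" by (auto dest: dvd_imp_le intro!: Nat.gr0I simp: Suc_le_eq)
    have "(\<Sum>d | d dvd b. totient (b div d)) = (\<Sum>d | d dvd b. totient d)"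
      by (rule sum.reindex_bij_witness[where i = "\<lambda>d. b div d" and j = "\<lambda>d. b div d"])
         (use b in \<open>auto elim!: dvdE\<close>)
    then have "real b = (\<Sum>d | d dvd b. real (totient (b div d)))"
      using totient_divisor_sum[of b] by (simp flip: of_nat_sum)
    then show "real b ^ Suc n = (\<Sum>d\<in>{d\<in>{1..N}. d dvd b}. real b ^ n * real (totient (b div d)))"
      unfolding * by (simp flip: sum_distrib_left)
  qed
  also have "\<dots> = (\<Sum>d\<in>{1..N}. \<Sum>b\<in>{b\<in>{1..N}. d dvd b}. real b ^ n * real (totient (b div d)))"
    by (rule sum.swap_restrict) auto
  also have "\<dots> = (\<Sum>d\<in>{1..N}. \<Sum>b\<in>{b\<in>{1..N}. d dvd b}. real d ^ n * (real (b div d) ^ n * real (totient (b div d))))"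
    by (intro sum.cong refl) (auto elim!: dvdE simp: power_mult_distrib)
  also have "\<dots> = (\<Sum>d\<in>{1..N}. \<Sum>b\<in>{1..N div d}. real d ^ n * (real b ^ n * real (totient b)))"
    by (intro sum.cong refl sum_multiples) auto
  also have "\<dots> = (\<Sum>d\<in>{1..N}. real d ^ n * tot_sum n (N div d))"
    by (simp add: tot_sum_def sum_distrib_left)
  finally show ?thesis ..
qed

lemma tot_sum_bounds: "0 \<le> tot_sum n N" "tot_sum n N \<le> real N ^ (n + 2)"
proof -
  show "0 \<le> tot_sum n N" unfolding tot_sum_def by (intro sum_nonneg) auto
  have "tot_sum n N \<le> (\<Sum>b\<in>{1..N}. real N ^ n * real N)" unfolding tot_sum_def
  proof (intro sum_mono mult_mono power_mono)
    fix b assume b: "b \<in> {1..N}"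
    then show "real b \<le> real N" by simp
    have "totient b \<le> N" using totient_le[of b] b by simp
    then show "real (totient b) \<le> real N" by simp
  qed auto
  then show "tot_sum n N \<le> real N ^ (n + 2)" by (simp add: mult_ac)
qed

lemma tot_sum_ratio_le_1: "tot_sum n N / real N ^ (n + 2) \<le> 1"
proof (cases "N = 0")
  case False
  then have "real N ^ (n + 2) > 0" by simp
  then show ?thesis using tot_sum_bounds(2)[of n N] by (simp only: divide_le_eq_1_pos)
qed auto

text \<open>It makes pi^2/6 - 1 < 2/3, safely below the contraction factor 3/4 used next.\<close>

lemma zeta2_upper_bound: "pi\<^sup>2 / 6 < 10 / 6"
proof -
  have "pi < 3.15" using pi_approx by simp
  then have "pi\<^sup>2 < 3.15\<^sup>2" by (intro power_strict_mono) auto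
  then show ?thesis by (simp add: power2_eq_square)
qed

text \<open>With \<open>e N = tot_sum n N / N ^ (n+2) - c\<close>, the identity
  \<open>sum_tot_sum\<close> bounds \<open>limsup |e|\<close> by \<open>(pi^2/6 - 1) limsup |e|\<close>, and \<open>pi^2/6 - 1 < 1\<close>.\<close>
lemma tot_sum_asymp: "(\<lambda>N. tot_sum n N / real N ^ (n + 2)) \<longlonglongrightarrow> (6 / pi\<^sup>2) / real (n + 2)"
proof -
  define c where "c = (6 / pi\<^sup>2) / real (n + 2)"
  define e where "e = (\<lambda>N. tot_sum n N / real N ^ (n + 2) - c)"
  define W where "W = (\<lambda>N d. real d^n * (real (N div d) / real N)^(n+2))"
  define E where "E = (\<lambda>N. \<Sum>d\<in>{1..N}. W N d * e (N div d))"
  have W0: "0 \<le> W N d" for N d by (simp add: W_def)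
  have c0: "0 \<le> c" by (simp add: c_def)
  have eb: "\<bar>e N\<bar> \<le> 1 + c" for N
  proof -
    note tot_sum_ratio_le_1[of n N]
    moreover have "0 \<le> tot_sum n N / real N ^ (n + 2)" using tot_sum_bounds(1)[of n N] by simp
    ultimately show ?thesis unfolding e_def using c0 by linarith
  qed
  have T: "(\<lambda>N. \<Sum>d\<in>{1..N}. W N d * r (N div d)) \<longlonglongrightarrow> L * (pi\<^sup>2 / 6)" 
    if "\<And>k. \<bar>r k\<bar> \<le> C" "r \<longlonglongrightarrow> L" for r :: "nat \<Rightarrow> real" and C L
    unfolding W_def by (rule tannery_zeta2[OF that])
  have W1: "(\<lambda>N. \<Sum>d\<in>{1..N}. W N d) \<longlonglongrightarrow> pi\<^sup>2 / 6" 
    using T[of "\<lambda>_. 1" 1 1] by simp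
  \<comment> \<open>By \<open>sum_tot_sum\<close>, \<open>E\<close> is a normalized power sum minus
    c times the total weight. Their limits are 1/(n+2) and c pi^2/6; the value of c is what makes
    them cancel.\<close>
  have Elim: "E \<longlonglongrightarrow> 0"
  proof -
    have "E N = (\<Sum>b\<in>{1..N}. real b ^ Suc n) / real N ^ (n + 2) - c * (\<Sum>d\<in>{1..N}. W N d)" if "N > 0" for N
    proof -
      have "W N d * e (N div d) = real d ^ n * tot_sum n (N div d) / real N ^ (n + 2) - c * W N d" if d: "d \<in> {1..N}" for d
      proof -
        have "real (N div d) > 0" using d \<open>N > 0\<close> by (simp add: div_greater_zero_iff)
        then have "W N d * (tot_sum n (N div d) / real (N div d) ^ (n + 2)) = real d ^ n * tot_sum n (N div d) / real N ^ (n + 2)"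
          unfolding W_def power_divide by simp
        then show ?thesis unfolding e_def by (simp add: right_diff_distrib)
      qed
      then have "E N = (\<Sum>d\<in>{1..N}. real d ^ n * tot_sum n (N div d) / real N ^ (n + 2) - c * W N d)"
        unfolding E_def by (rule sum.cong[OF refl])
      also have "\<dots> = (\<Sum>d\<in>{1..N}. real d ^ n * tot_sum n (N div d)) / real N ^ (n + 2) - c * (\<Sum>d\<in>{1..N}. W N d)"
        by (simp add: sum_subtractf sum_divide_distrib sum_distrib_left)
      finally show ?thesis unfolding sum_tot_sum .
    qed
    note E_eq = this
    have ev: "eventually (\<lambda>N. (\<Sum>b\<in>{1..N}. real b ^ Suc n) / real N ^ (n + 2) - c * (\<Sum>d\<in>{1..N}. W N d) = E N) sequentially"
      using eventually_gt_at_top[of 0] by eventually_elim (simp only: E_eq)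
    have lim: "(\<lambda>N. (\<Sum>b\<in>{1..N}. real b ^ Suc n) / real N ^ (n + 2) - c * (\<Sum>d\<in>{1..N}. W N d)) 
      \<longlonglongrightarrow> 1 / real (n + 2) - c * (pi\<^sup>2 / 6)"
      by (intro tendsto_intros sum_powers_asymp W1)
    have "6 / P / R * (P / 6) = 1 / R" if "P \<noteq> 0" for P R :: real using that by simp
    from this[of "pi\<^sup>2" "real (n + 2)"] have "1 / real (n + 2) - c * (pi\<^sup>2 / 6) = 0" 
      unfolding c_def by (simp del: of_nat_add)
    from lim[unfolded this] show ?thesis by (rule Lim_transform_eventually[OF _ ev])
  qed
  have contract: "eventually (\<lambda>N. \<bar>e N\<bar> \<le> (3/4) * B) sequentially" 
    if B: "B > 0" and ev: "eventually (\<lambda>N. \<bar>e N\<bar> \<le> B) sequentially" for B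
  proof -
    \<comment> \<open>For d comparable to N the argument N div d stays small, where |e| <= B may
      fail. The excess \<open>\<psi>\<close> is bounded and eventually 0, so its weighted sum tends
      to 0. The term d = 1 of \<open>E N\<close> is \<open>e N\<close> itself, and the other weights
      sum to about pi^2/6 - 1.\<close>
    define \<psi> where "\<psi> = (\<lambda>N. max 0 (\<bar>e N\<bar> - B))"
    have "eventually (\<lambda>N. 0 = \<psi> N) sequentially" using ev by eventually_elim (simp add: \<psi>_def)
    then have "\<psi> \<longlonglongrightarrow> 0" by (rule Lim_transform_eventually[OF tendsto_const])
    moreover have "\<bar>\<psi> N\<bar> \<le> 1 + c" for N using eb[of N] B c0 by (simp add: \<psi>_def)
    ultimately have \<psi>lim: "(\<lambda>N. \<Sum>d\<in>{1..N}. W N d * \<psi> (N div d)) \<longlonglongrightarrow> 0" using T[of \<psi> "1 + c" 0] by simp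
    have "(\<lambda>N. \<bar>E N\<bar> + B * ((\<Sum>d\<in>{1..N}. W N d) - 1) + (\<Sum>d\<in>{1..N}. W N d * \<psi> (N div d))) 
       \<longlonglongrightarrow> \<bar>0\<bar> + B * (pi\<^sup>2 / 6 - 1) + 0"
      by (intro tendsto_intros Elim W1 \<psi>lim)
    moreover have "\<bar>0\<bar> + B * (pi\<^sup>2 / 6 - 1) + 0 < 3/4 * B" using zeta2_upper_bound B by simp
    ultimately have "eventually (\<lambda>N. \<bar>E N\<bar> + B * ((\<Sum>d\<in>{1..N}. W N d) - 1) + (\<Sum>d\<in>{1..N}. W N d * \<psi> (N div d)) < 3/4 * B) sequentially"
      by (rule order_tendstoD(2))
    then show ?thesis using eventually_gt_at_top[of 0]
    proof eventually_elim
      case (elim N)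
      have W11: "W N 1 = 1" using elim(2) by (simp add: W_def)
      have split: "(\<Sum>d\<in>{1..N}. f d) = f 1 + (\<Sum>d\<in>{2..N}. f d)" for f :: "nat \<Rightarrow> real"
      proof -
        have "{1..N} = insert 1 {2..N}" using elim(2) by auto
        then show ?thesis by simp
      qed
      have "E N = e N + (\<Sum>d\<in>{2..N}. W N d * e (N div d))"
        unfolding E_def by (subst split) (simp add: W11[unfolded One_nat_def])
      then have "\<bar>e N\<bar> \<le> \<bar>E N\<bar> + \<bar>\<Sum>d\<in>{2..N}. W N d * e (N div d)\<bar>" by linarith
      also have "\<bar>\<Sum>d\<in>{2..N}. W N d * e (N div d)\<bar> \<le> (\<Sum>d\<in>{2..N}. W N d * (B + \<psi> (N div d)))"
      proof (rule order_trans[OF sum_abs sum_mono])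
        fix d
        have "\<bar>e (N div d)\<bar> \<le> B + \<psi> (N div d)" by (simp add: \<psi>_def)
        then show "\<bar>W N d * e (N div d)\<bar> \<le> W N d * (B + \<psi> (N div d))"
          using W0 by (simp add: abs_mult mult_left_mono)
      qed
      also have "(\<Sum>d\<in>{2..N}. W N d * (B + \<psi> (N div d))) = B * (\<Sum>d\<in>{2..N}. W N d) + (\<Sum>d\<in>{2..N}. W N d * \<psi> (N div d))"
        by (simp add: distrib_left sum.distrib sum_distrib_left mult.commute)
      also have "(\<Sum>d\<in>{2..N}. W N d) = (\<Sum>d\<in>{1..N}. W N d) - 1" using split[of "W N"] W11 by simp
      also have "(\<Sum>d\<in>{2..N}. W N d * \<psi> (N div d)) \<le> (\<Sum>d\<in>{1..N}. W N d * \<psi> (N div d))"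
        by (rule sum_mono2) (use W0 in \<open>auto simp: \<psi>_def\<close>)
      finally show ?case using elim(1) by linarith
    qed
  qed
  have iter: "eventually (\<lambda>N. \<bar>e N\<bar> \<le> (3/4)^k * (1 + c)) sequentially" for k
  proof (induction k)
    case 0 then show ?case using eb by simp
  next
    case (Suc k)
    have "(3/4)^k * (1 + c) > 0" using c0 by simp
    from contract[OF this Suc] show ?case by (simp only: power_Suc mult.assoc)
  qed
  have "e \<longlonglongrightarrow> 0"
  proof (rule tendstoI)
    fix \<epsilon> :: real assume "\<epsilon> > 0"
    then obtain k where "(3/4::real)^k < \<epsilon> / (1 + c)" using real_arch_pow_inv[of "\<epsilon> / (1 + c)" "3/4"] c0 by auto
    then have small: "(3/4)^k * (1 + c) < \<epsilon>" using c0 by (simp add: pos_less_divide_eq)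
    show "eventually (\<lambda>N. dist (e N) 0 < \<epsilon>) sequentially"
      using iter[of k] by eventually_elim (use small in simp)
  qed
  then have "(\<lambda>N. e N + c) \<longlonglongrightarrow> 0 + c" by (intro tendsto_intros)
  then show ?thesis by (simp add: e_def c_def)
qed

text \<open>By \<open>card_Sol\<close> the sum splits over a = q^i b into q^i q^(i n) times sums of
  b^n \<open>totient b\<close>. Termwise limits then leave the constant of
  \<open>tot_sum_asymp\<close> times the geometric series of q^(-i).\<close>

lemma card_Sol_average:
  assumes q: "prime q" and N: "filterlim N at_top sequentially"
  shows "(\<lambda>\<nu>. (\<Sum>a\<in>{1..N \<nu>}. real a ^ n * real (card (Sol (q^\<nu>) a))) / real (N \<nu>) ^ (n + 2))
    \<longlonglongrightarrow> (6 / pi\<^sup>2) / real (n + 2) / (1 - 1 / real q)"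
proof -
  have q1: "q > 1" using q prime_gt_1_nat by blast
  define r where "r = (\<lambda>Z. tot_sum n Z / real Z ^ (n + 2))"
  have r1: "\<bar>r Z\<bar> \<le> 1" for Z
    using tot_sum_bounds(1)[of n Z] tot_sum_ratio_le_1[of n Z] by (simp add: r_def)
  have lim: "(\<lambda>\<nu>. \<Sum>i<Suc \<nu>. real (q^i) * real (q^i)^n * (real (N \<nu> div q^i) / real (N \<nu>))^(n+2) * r (N \<nu> div q^i))
     \<longlonglongrightarrow> (6 / pi\<^sup>2) / real (n + 2) * (\<Sum>i. real (q^i) / real (q^i)^2)"
  proof (rule tannery_div[OF _ _ prime_power_weights(1)[OF q1] N filterlim_Suc r1])
    show "r \<longlonglongrightarrow> (6 / pi\<^sup>2) / real (n + 2)" unfolding r_def by (rule tot_sum_asymp)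
  qed (use q1 in auto)
  have "(\<Sum>a\<in>{1..N \<nu>}. real a ^ n * real (card (Sol (q^\<nu>) a))) / real (N \<nu>) ^ (n + 2) =
      (\<Sum>i<Suc \<nu>. real (q^i) * real (q^i)^n * (real (N \<nu> div q^i) / real (N \<nu>))^(n+2) * r (N \<nu> div q^i))" for \<nu>
  proof -
    have "(\<Sum>a\<in>{1..N \<nu>}. real a ^ n * real (card (Sol (q^\<nu>) a))) = 
       (\<Sum>a\<in>{1..N \<nu>}. \<Sum>i\<in>{i. i \<le> \<nu> \<and> q^i dvd a}. real (q^i) * real (q^i)^n * (real (a div q^i) ^ n * real (totient (a div q^i))))"
    proof (rule sum.cong[OF refl])
      fix a assume "a \<in> {1..N \<nu>}"
      then have "real a ^ n * real (card (Sol (q^\<nu>) a)) = 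
          (\<Sum>i\<in>{i. i \<le> \<nu> \<and> q^i dvd a}. real a ^ n * (real (q^i) * real (totient (a div q^i))))"
        using card_Sol[OF q, of a \<nu>] by (simp add: sum_distrib_left)
      also have "\<dots> = (\<Sum>i\<in>{i. i \<le> \<nu> \<and> q^i dvd a}. real (q^i) * real (q^i)^n * (real (a div q^i) ^ n * real (totient (a div q^i))))"
      proof (rule sum.cong[OF refl])
        fix i assume "i \<in> {i. i \<le> \<nu> \<and> q^i dvd a}"
        then have "real a = real (q^i) * real (a div q^i)" by (metis (lifting) dvd_mult_div_cancel mem_Collect_eq of_nat_mult)
        then show "real a ^ n * (real (q^i) * real (totient (a div q^i))) = real (q^i) * real (q^i)^n * (real (a div q^i) ^ n * real (totient (a div q^i)))"
          by (simp only: power_mult_distrib mult_ac)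
      qed
      finally show "real a ^ n * real (card (Sol (q^\<nu>) a)) = 
          (\<Sum>i\<in>{i. i \<le> \<nu> \<and> q^i dvd a}. real (q^i) * real (q^i)^n * (real (a div q^i) ^ n * real (totient (a div q^i))))" .
    qed
    also have "\<dots> = (\<Sum>i\<le>\<nu>. \<Sum>b\<in>{1..N \<nu> div q^i}. real (q^i) * real (q^i)^n * (real b ^ n * real (totient b)))"
      using q1 by (intro sum_swap_prime_powers) auto
    also have "\<dots> = (\<Sum>i<Suc \<nu>. real (q^i) * real (q^i)^n * (real (N \<nu> div q^i)^(n+2) * r (N \<nu> div q^i)))"
    proof -
      have "real Z ^ (n + 2) * r Z = (\<Sum>b\<in>{1..Z}. real b ^ n * real (totient b))" for Z
        by (cases "Z = 0") (auto simp: r_def tot_sum_def)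
      then show ?thesis unfolding lessThan_Suc_atMost by (simp only: sum_distrib_left)
    qed
    finally have "(\<Sum>a\<in>{1..N \<nu>}. real a ^ n * real (card (Sol (q^\<nu>) a))) / real (N \<nu>) ^ (n + 2) =
      (\<Sum>i<Suc \<nu>. real (q^i) * real (q^i)^n * (real (N \<nu> div q^i)^(n+2) * r (N \<nu> div q^i))) / real (N \<nu>) ^ (n + 2)"
      by (rule arg_cong)
    also have "\<dots> = (\<Sum>i<Suc \<nu>. real (q^i) * real (q^i)^n * (real (N \<nu> div q^i) / real (N \<nu>))^(n+2) * r (N \<nu> div q^i))"
      unfolding sum_divide_distrib power_divide by (intro sum.cong refl) (simp only: times_divide_eq_left times_divide_eq_right mult.assoc)
    finally show ?thesis .
  qed
  then have "(\<lambda>\<nu>. (\<Sum>a\<in>{1..N \<nu>}. real a ^ n * real (card (Sol (q^\<nu>) a))) / real (N \<nu>) ^ (n + 2))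
      \<longlonglongrightarrow> (6 / pi\<^sup>2) / real (n + 2) * (\<Sum>i. real (q^i) / real (q^i)^2)" using lim by (simp only:)
  then show ?thesis unfolding prime_power_weights(2)[OF q1] by simp
qed

text \<open>Each power q^i dividing a accounts for at most a solutions, so a summand is at most the
  number of such i, and at most M/2^i of the a <= M are multiples of q^i. The bound is uniform in nu
  and M, as the cusp estimate requires.\<close>

lemma sum_card_Sol_div_le:
  assumes q: "prime q"
  shows "(\<Sum>a\<in>{1..M}. real (card (Sol (q^\<nu>) a)) / real a) \<le> 2 * real M"
proof -
  have q1: "q > 1" using q prime_gt_1_nat by blast
  have "(\<Sum>a\<in>{1..M}. real (card (Sol (q^\<nu>) a)) / real a) \<le> (\<Sum>a\<in>{1..M}. \<Sum>i\<in>{i. i \<le> \<nu> \<and> q^i dvd a}. 1)"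
  proof (rule sum_mono)
    fix a assume a: "a \<in> {1..M}"
    then have a0: "a > 0" by simp
    have "card (Sol (q^\<nu>) a) \<le> (\<Sum>i\<in>{i. i \<le> \<nu> \<and> q^i dvd a}. a)"
      unfolding card_Sol[OF q a0]
    proof (rule sum_mono)
      fix i assume i: "i \<in> {i. i \<le> \<nu> \<and> q^i dvd a}"
      have "q^i * totient (a div q^i) \<le> q^i * (a div q^i)" by (intro mult_left_mono totient_le) auto
      also have "\<dots> = a" using i by simp
      finally show "q^i * totient (a div q^i) \<le> a" .
    qed
    then have "real (card (Sol (q^\<nu>) a)) \<le> real (card {i. i \<le> \<nu> \<and> q^i dvd a} * a)" by (simp only: sum_constant of_nat_le_iff of_nat_id)
    then show "real (card (Sol (q^\<nu>) a)) / real a \<le> (\<Sum>i\<in>{i. i \<le> \<nu> \<and> q^i dvd a}. 1)"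
      using a by (simp add: pos_divide_le_eq)
  qed
  also have "\<dots> = (\<Sum>i\<le>\<nu>. \<Sum>b\<in>{1..M div q^i}. 1)"
    using q1 by (intro sum_swap_prime_powers) auto
  also have "\<dots> = (\<Sum>i\<le>\<nu>. real (M div q^i))" by simp
  also have "\<dots> \<le> (\<Sum>i\<le>\<nu>. real M * (1/2)^i)"
  proof (rule sum_mono)
    fix i
    have "real (M div q^i) \<le> real M / real (q^i)"
      using div_ratio_le[of M "q^i"] by (cases "M = 0") (auto simp: field_simps)
    also have "\<dots> \<le> real M / 2^i" 
    proof (rule divide_left_mono)
      have "(2::nat)^i \<le> q^i" using q1 by (intro power_mono) auto
      then show "2^i \<le> real (q^i)" by (metis of_nat_le_iff of_nat_numeral of_nat_power)
    qed (use q1 in auto)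
    finally show "real (M div q^i) \<le> real M * (1/2)^i" by (simp add: power_divide)
  qed
  also have "\<dots> = real M * (\<Sum>i\<le>\<nu>. (1/2)^i)" by (simp add: sum_distrib_left)
  also have "(\<Sum>i\<le>\<nu>. (1/2::real)^i) \<le> 2"
    by (subst sum_gp0) (auto simp: field_simps)
  then have "real M * (\<Sum>i\<le>\<nu>. (1/2)^i) \<le> real M * 2" by (intro mult_left_mono) auto
  finally show ?thesis by simp
qed

section \<open>Equidistribution on the torus\<close>

lemma lborel_integral_compact_product:
  fixes f :: "'a::euclidean_space \<Rightarrow> complex" and g :: "'b::euclidean_space \<Rightarrow> complex"
  assumes A: "compact A" "continuous_on A f" and B: "compact B" "continuous_on B g"
  shows "(\<integral>p. indicator (A \<times> B) p *\<^sub>R (f (fst p) * g (snd p)) \<partial>lborel) = 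
    (\<integral>x. indicator A x *\<^sub>R f x \<partial>lborel) * (\<integral>y. indicator B y *\<^sub>R g y \<partial>lborel)"
proof -
  have "continuous_on (A \<times> B) (\<lambda>p. f (fst p) * g (snd p))"
    by (intro continuous_intros continuous_on_compose2[OF A(2)] continuous_on_compose2[OF B(2)]) auto
  then have int: "integrable (lborel \<Otimes>\<^sub>M lborel) (\<lambda>p. indicator (A \<times> B) p *\<^sub>R (f (fst p) * g (snd p)))"
    unfolding lborel_prod by (intro borel_integrable_compact compact_Times A B)
  have "(\<integral>p. indicator (A \<times> B) p *\<^sub>R (f (fst p) * g (snd p)) \<partial>lborel) = 
      (\<integral>x. (\<integral>y. indicator (A \<times> B) (x,y) *\<^sub>R (f x * g y) \<partial>lborel) \<partial>lborel)"
    using lborel_pair.integral_fst'[OF int] by (simp add: lborel_prod)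
  also have "\<dots> = (\<integral>x. (\<integral>y. (indicator A x *\<^sub>R f x) * (indicator B y *\<^sub>R g y) \<partial>lborel) \<partial>lborel)"
    by (simp add: indicator_times mult.commute)
  also have "\<dots> = (\<integral>x. indicator A x *\<^sub>R f x \<partial>lborel) * (\<integral>y. indicator B y *\<^sub>R g y \<partial>lborel)"
    by (simp only: integral_mult_right_zero integral_mult_left_zero)
  finally show ?thesis .
qed

text \<open>The first coordinate stands for a/X. Reduced triples satisfy 3 a^2 <= 4 m, hence a <=
  (2/sqrt 3) X, and 2 is a convenient bound.\<close>

definition unit_box :: "(real \<times> real \<times> real) set" where
  "unit_box = {0..2} \<times> {0..1} \<times> {0..1}"

text \<open>The factor \<open>fst p\<close> is there because the number of solutions modulo a is on
  average proportional to a, so points with a/X near s have density proportional to s.\<close>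

definition box_integral :: "(real \<times> real \<times> real \<Rightarrow> complex) \<Rightarrow> complex" where
  "box_integral F = (\<integral>p. indicator unit_box p *\<^sub>R (fst p *\<^sub>R F p) \<partial>lborel)"

lemma compact_unit_box: "compact unit_box"
  unfolding unit_box_def by (intro compact_Times compact_Icc)

lemma box_integrable:
  fixes F :: "real \<times> real \<times> real \<Rightarrow> 'b::{banach, second_countable_topology}"
  assumes "continuous_on unit_box F"
  shows "integrable lborel (\<lambda>p. indicator unit_box p *\<^sub>R (fst p *\<^sub>R F p))"
  by (rule borel_integrable_compact[OF compact_unit_box]) (intro continuous_intros assms)

lemma box_integral_add:
  assumes "continuous_on unit_box F" "continuous_on unit_box G"
  shows "box_integral (\<lambda>p. F p + G p) = box_integral F + box_integral G"
  unfolding box_integral_def scaleR_add_right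
  by (rule Bochner_Integration.integral_add) (intro box_integrable assms)+

lemma integral_power_Icc:
  "(\<integral>s. indicator {0..2} s *\<^sub>R (complex_of_real s ^ Suc n) \<partial>lborel) = 2 ^ (n + 2) / of_nat (n + 2)"
proof -
  have "(\<integral>s. indicator {0..2} s *\<^sub>R (complex_of_real s ^ Suc n) \<partial>lborel) = 
     (complex_of_real 2 ^ (n + 2) / of_nat (n + 2)) - (complex_of_real 0 ^ (n + 2) / of_nat (n + 2))"
  proof (rule integral_FTC_Icc)
    fix x :: real
    have "((\<lambda>x. x ^ (n + 2)) has_real_derivative real (n + 2) * x ^ Suc n) (at x within {0..2})"
      using DERIV_pow[of "n + 2" x "{0..2}"] by simp
    then have "((\<lambda>x. x ^ (n + 2) / real (n + 2)) has_real_derivative x ^ Suc n) (at x within {0..2})"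
      by (rule DERIV_cdivide[THEN DERIV_cong]) simp
    then have "((\<lambda>x. complex_of_real (x ^ (n + 2) / real (n + 2))) has_vector_derivative complex_of_real (x ^ Suc n)) (at x within {0..2})"
      by (intro has_vector_derivative_of_real) (simp add: has_real_derivative_iff_has_vector_derivative)
    then show "((\<lambda>x. complex_of_real x ^ (n + 2) / of_nat (n + 2)) has_vector_derivative complex_of_real x ^ Suc n) (at x within {0..2})"
      by simp
  qed (auto intro!: continuous_intros)
  then show ?thesis by simp
qed

lemma integral_cis_Icc:
  "(\<integral>u. indicator {0..1} u *\<^sub>R cis (2 * pi * real_of_int h * u) \<partial>lborel) = (if h = 0 then 1 else 0)"
proof (cases "h = 0")
  case True
  have "(\<integral>u. indicator {0..1::real} u *\<^sub>R (1::complex) \<partial>lborel) = complex_of_real 1 - complex_of_real 0"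
    by (rule integral_FTC_Icc) (auto intro!: derivative_eq_intros has_vector_derivative_of_real)
  then show ?thesis using True by simp
next
  case False
  define c where "c = 2 * pi * real_of_int h"
  have c: "c \<noteq> 0" using False by (simp add: c_def)
  have "(\<integral>u. indicator {0..1} u *\<^sub>R cis (c * u) \<partial>lborel) = cis (c * 1) / (\<i> * c) - cis (c * 0) / (\<i> * c)"
  proof (rule integral_FTC_Icc)
    fix u :: real
    have "((\<lambda>u. exp (\<i> * (of_real c * u)) / (\<i> * c)) has_field_derivative exp (\<i> * (of_real c * of_real u))) (at (of_real u))"
      using c by (auto intro!: derivative_eq_intros simp: field_simps)
    then have "((\<lambda>u. exp (\<i> * (of_real c * of_real u)) / (\<i> * c)) has_vector_derivative exp (\<i> * (of_real c * of_real u))) (at u within {0..1})"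
      by (rule has_vector_derivative_real_field)
    then show "((\<lambda>u. cis (c * u) / (\<i> * c)) has_vector_derivative cis (c * u)) (at u within {0..1})"
      by (simp add: cis_conv_exp)
  qed (auto intro!: continuous_intros)
  moreover have "cis (c * 1) = 1" unfolding c_def by (simp only: mult_1_right cis_multiple_2pi Ints_of_int)
  ultimately show ?thesis using False by (simp add: c_def)
qed

definition tmono :: "complex \<Rightarrow> nat \<Rightarrow> int \<Rightarrow> int \<Rightarrow> real \<times> real \<times> real \<Rightarrow> complex" where
  "tmono c n h k = (\<lambda>(s,u,v). c * complex_of_real s ^ n * (cis (2 * pi * real_of_int h * u) * cis (2 * pi * real_of_int k * v)))"

lemma box_integral_tmono:
  "box_integral (tmono c n h k) = (if h = 0 \<and> k = 0 then c * 2 ^ (n + 2) / of_nat (n + 2) else 0)"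
proof -
  let ?e = "\<lambda>h u. cis (2 * pi * real_of_int h * u)"
  have cont: "continuous_on A (?e h)" for A h by (intro continuous_intros)
  have "box_integral (tmono c n h k) = (\<integral>p. indicator ({0..2} \<times> ({0..1} \<times> {0..1})) p *\<^sub>R 
      ((c * complex_of_real (fst p) ^ Suc n) * (\<lambda>q. ?e h (fst q) * ?e k (snd q)) (snd p)) \<partial>lborel)"
    unfolding box_integral_def tmono_def unit_box_def
    by (intro Bochner_Integration.integral_cong refl) (auto simp: case_prod_unfold scaleR_conv_of_real)
  also have "\<dots> = (\<integral>s. indicator {0..2} s *\<^sub>R (c * complex_of_real s ^ Suc n) \<partial>lborel) * 
      (\<integral>q. indicator ({0..1} \<times> {0..1}) q *\<^sub>R (?e h (fst q) * ?e k (snd q)) \<partial>lborel)"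
    by (rule lborel_integral_compact_product) (auto intro!: compact_Times continuous_intros)
  also have "(\<integral>q. indicator ({0..1} \<times> {0..1}) q *\<^sub>R (?e h (fst q) * ?e k (snd q)) \<partial>lborel) = 
      (\<integral>u. indicator {0..1} u *\<^sub>R ?e h u \<partial>lborel) * (\<integral>v. indicator {0..1} v *\<^sub>R ?e k v \<partial>lborel)"
    by (rule lborel_integral_compact_product) (auto intro!: continuous_intros)
  also have "(\<integral>s. indicator {0..2} s *\<^sub>R (c * complex_of_real s ^ Suc n) \<partial>lborel) = c * (2 ^ (n + 2) / of_nat (n + 2))"
    unfolding integral_power_Icc[symmetric] by (simp flip: mult_scaleR_right)
  finally show ?thesis unfolding integral_cis_Icc by simp
qed

inductive trig_poly :: "(real \<times> real \<times> real \<Rightarrow> complex) \<Rightarrow> bool" where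
  mono: "trig_poly (tmono c n h k)"
| add: "trig_poly F \<Longrightarrow> trig_poly G \<Longrightarrow> trig_poly (\<lambda>p. F p + G p)"

lemma trig_poly_continuous: "trig_poly F \<Longrightarrow> continuous_on A F"
  by (induction rule: trig_poly.induct) (auto intro!: continuous_intros simp: tmono_def case_prod_unfold)

lemma tmono_mult: "tmono c n h k p * tmono d m i j p = tmono (c * d) (n + m) (h + i) (k + j) p"
  by (simp add: tmono_def case_prod_unfold power_add cis_mult distrib_left distrib_right flip: cis_mult)

lemma trig_poly_mult:
  assumes "trig_poly F" "trig_poly G"
  shows "trig_poly (\<lambda>p. F p * G p)"
  using assms(1)
proof induction
  case (mono c n h k)
  show ?case using assms(2)
  proof induction
    case (mono d m i j)
    show ?case unfolding tmono_mult by (rule trig_poly.mono)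
  next
    case (add F G)
    show ?case unfolding distrib_left by (rule trig_poly.add) (use add in auto)
  qed
next
  case (add F G)
  show ?case unfolding distrib_right by (rule trig_poly.add) (use add in auto)
qed

text \<open>Embeds the interval times the torus in a Euclidean space, where polynomials are
  available. A function composed with this map is automatically periodic in u and v.\<close>

definition torus_map :: "real \<times> real \<times> real \<Rightarrow> real \<times> complex \<times> complex" where
  "torus_map = (\<lambda>(s,u,v). (s, cis (2 * pi * u), cis (2 * pi * v)))"

lemma continuous_torus_map: "continuous_on A torus_map"
  unfolding torus_map_def case_prod_unfold by (intro continuous_intros)

text \<open>A real linear functional on the target is a combination of s and of the cosines and
  sines of 2 pi u and 2 pi v, which amounts to nine monomials. Closure under sums and products does
  the rest.\<close>

lemma trig_poly_of_polynomial:
  assumes "real_polynomial_function (g :: real \<times> complex \<times> complex \<Rightarrow> real)"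
  shows "trig_poly (\<lambda>p. complex_of_real (g (torus_map p)))"
  using assms
proof induction
  case (linear f)
  define a1 a2 a3 a4 a5 where "a1 = complex_of_real (f (1,0,0))" and "a2 = complex_of_real (f (0,1,0))" 
    and "a3 = complex_of_real (f (0,\<i>,0))" and "a4 = complex_of_real (f (0,0,1))" and "a5 = complex_of_real (f (0,0,\<i>))"
  interpret f: bounded_linear f by (rule linear)
  have dec: "f (s,z,w) = s * f (1,0,0) + Re z * f (0,1,0) + Im z * f (0,\<i>,0) + Re w * f (0,0,1) + Im w * f (0,0,\<i>)" for s z w
  proof -
    have "(s,z,w) = s *\<^sub>R (1,0,0) + Re z *\<^sub>R (0,1,0) + Im z *\<^sub>R (0,\<i>,0) + Re w *\<^sub>R (0,0,1) + Im w *\<^sub>R (0,0,\<i>)"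
      by (simp add: complex_eq_iff)
    then show ?thesis by (simp only: f.add f.scaleR real_scaleR_def)
  qed
  have ReIm: "complex_of_real (cos t) = (cis t + cis (-t)) / 2" "complex_of_real (sin t) = (cis t - cis (-t)) / (2 * \<i>)" for t
    by (auto simp: complex_eq_iff)
  have "(\<lambda>p. complex_of_real (f (torus_map p))) = (\<lambda>p. tmono a1 1 0 0 p + (tmono (a2 / 2) 0 1 0 p + (tmono (a2 / 2) 0 (-1) 0 p
     + (tmono (a3 / (2 * \<i>)) 0 1 0 p + (tmono (- a3 / (2 * \<i>)) 0 (-1) 0 p + (tmono (a4 / 2) 0 0 1 p + (tmono (a4 / 2) 0 0 (-1) p
     + (tmono (a5 / (2 * \<i>)) 0 0 1 p + tmono (- a5 / (2 * \<i>)) 0 0 (-1) p))))))))"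
  proof
    fix p :: "real \<times> real \<times> real"
    obtain s u v where p: "p = (s,u,v)" by (metis prod.collapse)
    have "complex_of_real (f (torus_map p)) = of_real s * a1 + of_real (cos (2*pi * u)) * a2 + of_real (sin (2*pi * u)) * a3
       + of_real (cos (2*pi * v)) * a4 + of_real (sin (2*pi * v)) * a5"
    proof -
      have "f (torus_map p) = s * f (1,0,0) + cos (2*pi * u) * f (0,1,0) + sin (2*pi * u) * f (0,\<i>,0) 
         + cos (2*pi * v) * f (0,0,1) + sin (2*pi * v) * f (0,0,\<i>)"
        unfolding p torus_map_def prod.case using dec[of s "cis (2*pi * u)" "cis (2*pi * v)"] by simp
      then show ?thesis by (simp add: a1_def a2_def a3_def a4_def a5_def)
    qed
    then show "complex_of_real (f (torus_map p)) = tmono a1 1 0 0 p + (tmono (a2 / 2) 0 1 0 p + (tmono (a2 / 2) 0 (-1) 0 p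
     + (tmono (a3 / (2 * \<i>)) 0 1 0 p + (tmono (- a3 / (2 * \<i>)) 0 (-1) 0 p + (tmono (a4 / 2) 0 0 1 p + (tmono (a4 / 2) 0 0 (-1) p
     + (tmono (a5 / (2 * \<i>)) 0 0 1 p + tmono (- a5 / (2 * \<i>)) 0 0 (-1) p)))))))"
    proof -
      assume *: "complex_of_real (f (torus_map p)) = of_real s * a1 + of_real (cos (2*pi * u)) * a2 + of_real (sin (2*pi * u)) * a3
         + of_real (cos (2*pi * v)) * a4 + of_real (sin (2*pi * v)) * a5"
      have t: "tmono a 1 0 0 p = of_real s * a" "tmono a 0 1 0 p = a * cis (2*pi * u)" "tmono a 0 (-1) 0 p = a * cis (- (2*pi * u))"
        "tmono a 0 0 1 p = a * cis (2*pi * v)" "tmono a 0 0 (-1) p = a * cis (- (2*pi * v))" for a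
        by (auto simp: tmono_def p)
      have c: "(z + w) / 2 * a = a / 2 * z + a / 2 * w" for z w a :: complex
        by (simp add: field_simps)
      have d: "(z - w) / (2 * \<i>) * a = a / (2 * \<i>) * z + - a / (2 * \<i>) * w" for z w a :: complex
        by (simp add: field_simps)
      show ?thesis unfolding * t ReIm c d by (simp only: add.assoc)
    qed
  qed
  then show ?case by (simp only:) (intro trig_poly.add trig_poly.mono)
next
  case (const c)
  have "(\<lambda>p. complex_of_real c) = tmono (of_real c) 0 0 0" by (auto simp: tmono_def)
  then show ?case by (simp only: trig_poly.mono)
next
  case (add f g)
  then show ?case using trig_poly.add by (simp only: of_real_add)
next
  case (mult f g)
  then show ?case using trig_poly_mult by (simp only: of_real_mult)
qed

section \<open>The rescaled solutions and their averages\<close>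

definition amax :: "nat \<Rightarrow> nat \<Rightarrow> nat" where
  "amax q \<nu> = nat \<lfloor>2 * sqrt (real (q ^ \<nu>))\<rfloor>"

definition scaled :: "nat \<Rightarrow> nat \<Rightarrow> nat \<times> int \<times> int \<Rightarrow> real \<times> real \<times> real" where
  "scaled q \<nu> = (\<lambda>(a,x,y). (real a / sqrt (real (q ^ \<nu>)), real_of_int x / real a, real_of_int y / real a))"

definition points :: "nat \<Rightarrow> nat \<Rightarrow> (nat \<times> int \<times> int) set" where
  "points q \<nu> = Sigma {1..amax q \<nu>} (\<lambda>a. Sol (q ^ \<nu>) a)"

lemma finite_points [simp]: "finite (points q \<nu>)"
  by (simp add: points_def)

lemma scaled_points: 
  assumes "p \<in> points q \<nu>" 
  shows "fst (scaled q \<nu> p) \<in> {0..2}" "fst (snd (scaled q \<nu> p)) \<in> {0..<1}" "snd (snd (scaled q \<nu> p)) \<in> {0..<1}"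
proof -
  obtain a x y where p: "p = (a,x,y)" by (metis prod.collapse)
  have a: "1 \<le> a" "a \<le> amax q \<nu>" and xy: "0 \<le> x" "x < int a" "0 \<le> y" "y < int a" 
    using assms by (auto simp: p points_def Sol_def)
  have "real a \<le> 2 * sqrt (real (q ^ \<nu>))" using a by (auto simp: amax_def le_nat_iff le_floor_iff)
  moreover have "sqrt (real (q ^ \<nu>)) > 0" using calculation a by linarith
  ultimately show "fst (scaled q \<nu> p) \<in> {0..2}" by (simp add: p scaled_def pos_divide_le_eq)
  show "fst (snd (scaled q \<nu> p)) \<in> {0..<1}" "snd (snd (scaled q \<nu> p)) \<in> {0..<1}"
    using a xy by (auto simp: p scaled_def)
qed

lemma amax_ratio:
  assumes "q > 1"
  shows "filterlim (amax q) at_top sequentially" "(\<lambda>\<nu>. real (amax q \<nu>) / sqrt (real (q ^ \<nu>))) \<longlonglongrightarrow> 2"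
proof -
  have X: "filterlim (\<lambda>\<nu>. sqrt (real (q ^ \<nu>))) at_top sequentially"
  proof (rule filterlim_compose[OF sqrt_at_top])
    have "real q > 1" using assms by simp
    then show "filterlim (\<lambda>\<nu>. real (q ^ \<nu>)) at_top sequentially" unfolding of_nat_power by real_asymp
  qed
  have "filterlim (\<lambda>x::real. nat \<lfloor>2 * x\<rfloor>) at_top at_top"
    by (intro filterlim_compose[OF filterlim_nat_sequentially] filterlim_compose[OF filterlim_floor_sequentially]) real_asymp
  from filterlim_compose[OF this X] show "filterlim (amax q) at_top sequentially" by (simp add: amax_def[abs_def])
  have "((\<lambda>x::real. real (nat \<lfloor>2 * x\<rfloor>) / x) \<longlongrightarrow> 2) at_top" by real_asymp
  from filterlim_compose[OF this X] show "(\<lambda>\<nu>. real (amax q \<nu>) / sqrt (real (q ^ \<nu>))) \<longlonglongrightarrow> 2" 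
    by (simp add: amax_def[abs_def])
qed

text \<open>The limiting density of the rescaled points with respect to \<open>box_measure\<close>,
  when they are counted in units of q^nu.\<close>

definition kappa :: "nat \<Rightarrow> real" where
  "kappa q = (6 / pi\<^sup>2) / (1 - 1 / real q)"

text \<open>Summed over a single modulus a, a monomial becomes (a/X)^n times \<open>Ksol\<close>.
  The trivial frequency is governed by \<open>card_Sol_average\<close>. At the others (a/X)^n <=
  2^n, and \<open>Ksol_average\<close> gives 0, which is also the integral of a nontrivial
  character.\<close>

lemma points_average_tmono:
  assumes q: "prime q"
  shows "(\<lambda>\<nu>. (\<Sum>p\<in>points q \<nu>. tmono c n h k (scaled q \<nu> p)) / of_nat (q ^ \<nu>)) 
     \<longlonglongrightarrow> of_real (kappa q) * box_integral (tmono c n h k)"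
proof -
  have q1: "q > 1" using q prime_gt_1_nat by blast
  define X where "X = (\<lambda>\<nu>. sqrt (real (q ^ \<nu>)))"
  have X0: "X \<nu> > 0" for \<nu> using q1 by (simp add: X_def)
  have X2: "X \<nu> ^ 2 = real (q ^ \<nu>)" for \<nu> by (simp add: X_def)
  let ?N = "amax q"
  have ratio: "(\<lambda>\<nu>. real (?N \<nu>) / X \<nu>) \<longlonglongrightarrow> 2" using amax_ratio(2)[OF q1] by (simp add: X_def)
  have sum: "(\<Sum>p\<in>points q \<nu>. tmono c n h k (scaled q \<nu> p)) = 
      (\<Sum>a\<in>{1..?N \<nu>}. c * complex_of_real (real a / X \<nu>) ^ n * Ksol (q ^ \<nu>) a h k)" for \<nu>
  proof -
    have "(\<Sum>p\<in>points q \<nu>. tmono c n h k (scaled q \<nu> p)) = (\<Sum>a\<in>{1..?N \<nu>}. \<Sum>xy\<in>Sol (q ^ \<nu>) a. tmono c n h k (scaled q \<nu> (a,xy)))"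
      unfolding points_def by (subst sum.Sigma) auto
    also have "\<dots> = (\<Sum>a\<in>{1..?N \<nu>}. c * complex_of_real (real a / X \<nu>) ^ n * Ksol (q ^ \<nu>) a h k)"
      unfolding Ksol_def sum_distrib_left
      by (intro sum.cong refl) (auto simp: tmono_def scaled_def X_def echar_def cis_mult add_divide_distrib distrib_left mult.assoc)
    finally show ?thesis .
  qed
  show ?thesis
  proof (cases "h = 0 \<and> k = 0")
    case True
    have K: "Ksol (q ^ \<nu>) a h k = of_nat (card (Sol (q ^ \<nu>) a))" for \<nu> a
      using True by (simp add: Ksol_def)
    have e: "(\<Sum>p\<in>points q \<nu>. tmono c n h k (scaled q \<nu> p)) / of_nat (q ^ \<nu>) = 
       c * complex_of_real ((real (?N \<nu>) / X \<nu>) ^ (n + 2) * ((\<Sum>a\<in>{1..?N \<nu>}. real a ^ n * real (card (Sol (q^\<nu>) a))) / real (?N \<nu>) ^ (n + 2)))" for \<nu>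
    proof -
      have "(\<Sum>p\<in>points q \<nu>. tmono c n h k (scaled q \<nu> p)) = c * complex_of_real (\<Sum>a\<in>{1..?N \<nu>}. (real a / X \<nu>) ^ n * real (card (Sol (q^\<nu>) a)))"
        unfolding sum K by (simp add: sum_distrib_left mult.assoc)
      also have "(\<Sum>a\<in>{1..?N \<nu>}. (real a / X \<nu>) ^ n * real (card (Sol (q^\<nu>) a))) = 
          (\<Sum>a\<in>{1..?N \<nu>}. real a ^ n * real (card (Sol (q^\<nu>) a))) / X \<nu> ^ n" (is "_ = ?S / _")
        by (simp add: sum_divide_distrib power_divide)
      finally have "(\<Sum>p\<in>points q \<nu>. tmono c n h k (scaled q \<nu> p)) / of_nat (q ^ \<nu>) = 
          c * complex_of_real (?S / X \<nu> ^ n / real (q ^ \<nu>))" by simp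
      also have "?S / X \<nu> ^ n / real (q ^ \<nu>) = ?S / X \<nu> ^ (n + 2)"
        unfolding power_add X2 by simp
      also have "?S / X \<nu> ^ (n + 2) = (real (?N \<nu>) / X \<nu>) ^ (n + 2) * (?S / real (?N \<nu>) ^ (n + 2))"
        by (cases "?N \<nu> = 0") (auto simp: power_divide)
      finally show ?thesis .
    qed
    have "(\<lambda>\<nu>. c * complex_of_real ((real (?N \<nu>) / X \<nu>) ^ (n + 2) * ((\<Sum>a\<in>{1..?N \<nu>}. real a ^ n * real (card (Sol (q^\<nu>) a))) / real (?N \<nu>) ^ (n + 2))))
      \<longlonglongrightarrow> c * complex_of_real (2 ^ (n + 2) * ((6 / pi\<^sup>2) / real (n + 2) / (1 - 1 / real q)))"
      by (intro tendsto_mult tendsto_const tendsto_of_real tendsto_power card_Sol_average[OF q] amax_ratio(1)[OF q1] ratio)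
    then show ?thesis unfolding e box_integral_tmono kappa_def using True by (simp add: mult_ac)
  next
    case False
    have "(\<lambda>\<nu>. (\<Sum>p\<in>points q \<nu>. tmono c n h k (scaled q \<nu> p)) / of_nat (q ^ \<nu>)) \<longlonglongrightarrow> 0"
    proof (rule Lim_null_comparison)
      show "(\<lambda>\<nu>. norm c * 2 ^ n * ((real (?N \<nu>) / X \<nu>) ^ 2 * ((\<Sum>a\<in>{1..?N \<nu>}. norm (Ksol (q^\<nu>) a h k)) / real (?N \<nu>) ^ 2))) \<longlonglongrightarrow> 0"
      proof -
        have "(\<lambda>\<nu>. norm c * 2 ^ n * ((real (?N \<nu>) / X \<nu>) ^ 2 * ((\<Sum>a\<in>{1..?N \<nu>}. norm (Ksol (q^\<nu>) a h k)) / real (?N \<nu>) ^ 2))) 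
          \<longlonglongrightarrow> norm c * 2 ^ n * (2 ^ 2 * 0)"
          using False by (intro tendsto_intros Ksol_average[OF q] amax_ratio(1)[OF q1] ratio) auto
        then show ?thesis by simp
      qed
      show "eventually (\<lambda>\<nu>. norm ((\<Sum>p\<in>points q \<nu>. tmono c n h k (scaled q \<nu> p)) / of_nat (q ^ \<nu>)) \<le> 
         norm c * 2 ^ n * ((real (?N \<nu>) / X \<nu>) ^ 2 * ((\<Sum>a\<in>{1..?N \<nu>}. norm (Ksol (q^\<nu>) a h k)) / real (?N \<nu>) ^ 2))) sequentially"
      proof (intro always_eventually allI)
        fix \<nu>
        have "norm (\<Sum>a\<in>{1..?N \<nu>}. c * complex_of_real (real a / X \<nu>) ^ n * Ksol (q ^ \<nu>) a h k) \<le> 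
           (\<Sum>a\<in>{1..?N \<nu>}. norm c * 2 ^ n * norm (Ksol (q ^ \<nu>) a h k))"
        proof (rule sum_norm_le)
          fix a assume "a \<in> {1..?N \<nu>}"
          then have "real a \<le> 2 * X \<nu>" by (auto simp: amax_def le_nat_iff le_floor_iff X_def)
          then have "(real a / X \<nu>) ^ n \<le> 2 ^ n" using X0[of \<nu>] by (intro power_mono) (auto simp: pos_divide_le_eq)
          then show "norm (c * complex_of_real (real a / X \<nu>) ^ n * Ksol (q ^ \<nu>) a h k) \<le> norm c * 2 ^ n * norm (Ksol (q ^ \<nu>) a h k)"
            using X0[of \<nu>] by (simp add: norm_mult norm_power norm_divide mult_right_mono mult_left_mono del: of_real_divide)
        qed
        then have "norm (\<Sum>p\<in>points q \<nu>. tmono c n h k (scaled q \<nu> p)) \<le> norm c * 2 ^ n * (\<Sum>a\<in>{1..?N \<nu>}. norm (Ksol (q ^ \<nu>) a h k))"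
          unfolding sum by (simp only: sum_distrib_left)
        then have "norm ((\<Sum>p\<in>points q \<nu>. tmono c n h k (scaled q \<nu> p)) / of_nat (q ^ \<nu>)) \<le> 
            norm c * 2 ^ n * (\<Sum>a\<in>{1..?N \<nu>}. norm (Ksol (q ^ \<nu>) a h k)) / X \<nu> ^ 2"
          unfolding X2 norm_divide norm_of_nat by (intro divide_right_mono) auto
        also have "\<dots> = norm c * 2 ^ n * ((real (?N \<nu>) / X \<nu>) ^ 2 * ((\<Sum>a\<in>{1..?N \<nu>}. norm (Ksol (q^\<nu>) a h k)) / real (?N \<nu>) ^ 2))"
          by (cases "?N \<nu> = 0") (auto simp: power_divide)
        finally show "norm ((\<Sum>p\<in>points q \<nu>. tmono c n h k (scaled q \<nu> p)) / of_nat (q ^ \<nu>)) \<le> 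
         norm c * 2 ^ n * ((real (?N \<nu>) / X \<nu>) ^ 2 * ((\<Sum>a\<in>{1..?N \<nu>}. norm (Ksol (q^\<nu>) a h k)) / real (?N \<nu>) ^ 2))" .
      qed
    qed
    then show ?thesis unfolding box_integral_tmono using False by auto
  qed
qed

lemma points_average_trig_poly:
  assumes q: "prime q" and F: "trig_poly F"
  shows "(\<lambda>\<nu>. (\<Sum>p\<in>points q \<nu>. F (scaled q \<nu> p)) / of_nat (q ^ \<nu>)) \<longlonglongrightarrow> of_real (kappa q) * box_integral F"
  using F
proof induction
  case (mono c n h k)
  show ?case by (rule points_average_tmono[OF q])
next
  case (add F G)
  have "(\<lambda>\<nu>. (\<Sum>p\<in>points q \<nu>. F (scaled q \<nu> p)) / of_nat (q ^ \<nu>) + (\<Sum>p\<in>points q \<nu>. G (scaled q \<nu> p)) / of_nat (q ^ \<nu>)) 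
     \<longlonglongrightarrow> of_real (kappa q) * box_integral F + of_real (kappa q) * box_integral G"
    by (intro tendsto_add add.IH)
  then show ?case 
    using box_integral_add[OF trig_poly_continuous[OF add.hyps(1)] trig_poly_continuous[OF add.hyps(2)]]
    by (simp add: sum.distrib add_divide_distrib distrib_left)
qed

section \<open>From monomials to continuous functions, compact sets and open sets\<close>

definition box_measure :: "(real \<times> real \<times> real) measure" where
  "box_measure = density lborel (\<lambda>p. ennreal (indicator unit_box p * fst p))"

lemma sets_box_measure [simp, measurable_cong]: "sets box_measure = sets borel"
  by (simp add: box_measure_def)

lemma space_box_measure [simp]: "space box_measure = UNIV"
  by (simp add: box_measure_def)

lemma unit_box_borel [measurable]: "unit_box \<in> sets borel"
  by (rule borel_compact[OF compact_unit_box])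

lemma box_weight_measurable [measurable]: "(\<lambda>p. indicator unit_box p * fst p) \<in> borel_measurable borel"
  by (intro borel_measurable_times borel_measurable_indicator unit_box_borel borel_measurable_continuous_onI continuous_intros)

lemma box_weight_nonneg: "0 \<le> indicator unit_box p * fst p"
  by (auto simp: unit_box_def indicator_def)

lemma box_measure_integral:
  fixes G :: "real \<times> real \<times> real \<Rightarrow> real"
  assumes [measurable]: "G \<in> borel_measurable borel"
  shows "complex_of_real (integral\<^sup>L box_measure G) = box_integral (\<lambda>p. complex_of_real (G p))"
proof -
  have "integral\<^sup>L box_measure G = (\<integral>p. (indicator unit_box p * fst p) *\<^sub>R G p \<partial>lborel)"
    unfolding box_measure_def by (rule integral_density) (auto simp: box_weight_nonneg)
  moreover have "box_integral (\<lambda>p. complex_of_real (G p)) = (\<integral>p. complex_of_real ((indicator unit_box p * fst p) *\<^sub>R G p) \<partial>lborel)"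
    unfolding box_integral_def by (intro Bochner_Integration.integral_cong refl) (simp add: scaleR_conv_of_real)
  ultimately show ?thesis by (simp only: integral_complex_of_real)
qed

lemma emeasure_box_measure_UNIV: "emeasure box_measure UNIV = 2"
proof -
  have "box_integral (\<lambda>p. complex_of_real 1) = 2"
    using box_integral_tmono[of 1 0 0 0] by (simp add: tmono_def case_prod_unfold)
  moreover have "box_integral (\<lambda>p. complex_of_real 1) = complex_of_real (\<integral>p. indicator unit_box p * fst p \<partial>lborel)"
    unfolding box_integral_def by (simp add: scaleR_conv_of_real flip: of_real_mult)
  ultimately have *: "(\<integral>p. indicator unit_box p * fst p \<partial>lborel) = 2"
    by (metis of_real_eq_iff of_real_numeral)
  have "integrable lborel (\<lambda>p. indicator unit_box p *\<^sub>R (fst p *\<^sub>R (1::real)))"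
    by (rule box_integrable) (intro continuous_intros)
  then have int: "integrable lborel (\<lambda>p. indicator unit_box p * fst p)" by simp
  have "emeasure box_measure UNIV = (\<integral>\<^sup>+p. ennreal (indicator unit_box p * fst p) \<partial>lborel)"
    unfolding box_measure_def by (subst emeasure_density) auto
  also have "\<dots> = ennreal 2"
    using nn_integral_eq_integral[OF int] box_weight_nonneg * by simp
  finally show ?thesis by simp
qed

interpretation box_measure: finite_measure box_measure
  by (rule finite_measureI) (simp add: emeasure_box_measure_UNIV)

lemma measure_box_measure_UNIV: "measure box_measure UNIV = 2"
  by (simp add: measure_def emeasure_box_measure_UNIV)

lemma AE_box_measure: "AE p in box_measure. p \<in> unit_box"
proof -
  have m: "(\<lambda>p. ennreal (indicator unit_box p * fst p)) \<in> borel_measurable lborel" by measurable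
  show ?thesis unfolding box_measure_def AE_density[OF m] by (auto simp: indicator_def)
qed

lemma kappa_pos: "q > 1 \<Longrightarrow> kappa q > 0"
  by (simp add: kappa_def)

lemma card_points_asymp:
  assumes q: "prime q"
  shows "(\<lambda>\<nu>. real (card (points q \<nu>)) / real (q ^ \<nu>)) \<longlonglongrightarrow> kappa q * 2"
proof -
  have "(\<lambda>\<nu>. complex_of_real (real (card (points q \<nu>)) / real (q ^ \<nu>))) \<longlonglongrightarrow> complex_of_real (kappa q * 2)"
    using points_average_tmono[OF q, of 1 0 0 0] by (simp add: box_integral_tmono) (simp add: tmono_def case_prod_unfold)
  then show ?thesis by (simp only: tendsto_of_real_iff)
qed

lemma torus_map_measurable [measurable]: "torus_map \<in> borel_measurable borel"
  by (rule borel_measurable_continuous_onI[OF continuous_torus_map])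

lemma torus_map_in:
  assumes "p \<in> unit_box"
  shows "torus_map p \<in> {0..2} \<times> sphere 0 1 \<times> sphere 0 1"
  using assms by (auto simp: torus_map_def unit_box_def)

lemma scaled_in_unit_box: "p \<in> points q \<nu> \<Longrightarrow> scaled q \<nu> p \<in> unit_box"
  using scaled_points[of p q \<nu>] by (cases "scaled q \<nu> p") (auto simp: unit_box_def)

lemma points_average_continuous:
  fixes F :: "real \<times> complex \<times> complex \<Rightarrow> real"
  assumes q: "prime q" and F: "continuous_on UNIV F"
  shows "(\<lambda>\<nu>. (\<Sum>p\<in>points q \<nu>. F (torus_map (scaled q \<nu> p))) / real (q ^ \<nu>)) 
     \<longlonglongrightarrow> kappa q * integral\<^sup>L box_measure (\<lambda>p. F (torus_map p))"
proof (rule tendstoI)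
  fix \<eta> :: real assume \<eta>: "\<eta> > 0"
  have q1: "q > 1" using q prime_gt_1_nat by blast
  define k where "k = kappa q"
  have k0: "k > 0" using kappa_pos[OF q1] by (simp add: k_def)
  \<comment> \<open>Approximation within this bound costs at most 2 k \<open>\<delta>\<close> in the
    integral, as the total mass is 2, and eventually at most (2 k + 1) \<open>\<delta>\<close> in
    the averages. Each is at most a third of \<open>\<eta>\<close>.\<close>
  define \<delta> where "\<delta> = \<eta> / (3 * (2 * k + 1))"
  have d0: "\<delta> > 0" using \<eta> k0 by (simp add: \<delta>_def)
  have dk: "(2 * k + 1) * \<delta> = \<eta> / 3" using k0 by (simp add: \<delta>_def field_simps)
  let ?S = "{0..2::real} \<times> sphere (0::complex) 1 \<times> sphere (0::complex) 1"
  have "compact ?S" by (intro compact_Times compact_sphere compact_Icc)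
  then obtain g where g: "real_polynomial_function g" and gF: "\<And>z. z \<in> ?S \<Longrightarrow> \<bar>F z - g z\<bar> < \<delta>"
    using Stone_Weierstrass_real_polynomial_function[OF _ continuous_on_subset[OF F] d0] by blast
  define f where "f = (\<lambda>p. F (torus_map p))"
  define h where "h = (\<lambda>p. g (torus_map p))"
  have near: "\<bar>f p - h p\<bar> \<le> \<delta>" if "p \<in> unit_box" for p
    using gF[OF torus_map_in[OF that]] by (simp add: f_def h_def)
  have fcont: "continuous_on UNIV f" unfolding f_def
    by (rule continuous_on_compose2[OF F continuous_torus_map]) auto
  have gcont: "continuous_on UNIV g" using continuous_real_polymonial_function[OF g] by (simp add: continuous_at_imp_continuous_on)
  have hcont: "continuous_on UNIV h" unfolding h_def
    by (rule continuous_on_compose2[OF gcont continuous_torus_map]) auto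
  have [measurable]: "f \<in> borel_measurable borel" "h \<in> borel_measurable borel"
    using fcont hcont by (auto intro: borel_measurable_continuous_onI)
  have integ: "integrable box_measure G" if c: "continuous_on UNIV G" for G :: "real \<times> real \<times> real \<Rightarrow> real"
  proof -
    have m [measurable]: "G \<in> borel_measurable borel" using c by (rule borel_measurable_continuous_onI)
    have "compact (G ` unit_box)" by (rule compact_continuous_image[OF continuous_on_subset[OF c] compact_unit_box]) auto
    then obtain B where B: "\<And>p. p \<in> unit_box \<Longrightarrow> norm (G p) \<le> B" by (metis bounded_iff compact_imp_bounded image_eqI)
    show ?thesis by (rule box_measure.integrable_const_bound[of _ B])
      (use AE_box_measure B in \<open>auto elim!: eventually_mono\<close>)
  qed
  have "\<bar>integral\<^sup>L box_measure f - integral\<^sup>L box_measure h\<bar> = \<bar>integral\<^sup>L box_measure (\<lambda>p. f p - h p)\<bar>"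
    using integ[OF fcont] integ[OF hcont] by simp
  also have "\<dots> \<le> integral\<^sup>L box_measure (\<lambda>p. \<bar>f p - h p\<bar>)" by (rule integral_abs_bound)
  also have "\<dots> \<le> integral\<^sup>L box_measure (\<lambda>p. \<delta>)"
  proof (rule integral_mono_AE)
    show "integrable box_measure (\<lambda>p. \<bar>f p - h p\<bar>)" by (intro integ continuous_intros fcont hcont)
    show "AE p in box_measure. \<bar>f p - h p\<bar> \<le> \<delta>" using AE_box_measure by eventually_elim (rule near)
  qed auto
  also have "\<dots> = 2 * \<delta>" by (simp add: measure_box_measure_UNIV)
  finally have I: "\<bar>k * integral\<^sup>L box_measure f - k * integral\<^sup>L box_measure h\<bar> \<le> k * (2 * \<delta>)"
    using k0 by (simp flip: right_diff_distrib add: abs_mult mult_left_mono)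
  have hlim: "(\<lambda>\<nu>. (\<Sum>p\<in>points q \<nu>. h (scaled q \<nu> p)) / real (q ^ \<nu>)) \<longlonglongrightarrow> k * integral\<^sup>L box_measure h"
  proof -
    have "(\<lambda>\<nu>. (\<Sum>p\<in>points q \<nu>. complex_of_real (h (scaled q \<nu> p))) / of_nat (q ^ \<nu>)) 
       \<longlonglongrightarrow> of_real (kappa q) * box_integral (\<lambda>p. complex_of_real (h p))"
      using points_average_trig_poly[OF q trig_poly_of_polynomial[OF g]] by (simp only: h_def)
    then have "(\<lambda>\<nu>. complex_of_real ((\<Sum>p\<in>points q \<nu>. h (scaled q \<nu> p)) / real (q ^ \<nu>))) 
       \<longlonglongrightarrow> complex_of_real (k * integral\<^sup>L box_measure h)"
      by (simp add: k_def box_measure_integral)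
    then show ?thesis by (simp only: tendsto_of_real_iff)
  qed
  have ev1: "eventually (\<lambda>\<nu>. dist ((\<Sum>p\<in>points q \<nu>. h (scaled q \<nu> p)) / real (q ^ \<nu>)) (k * integral\<^sup>L box_measure h) < \<eta> / 3) sequentially"
    using tendstoD[OF hlim, of "\<eta> / 3"] \<eta> by simp
  have ev2: "eventually (\<lambda>\<nu>. real (card (points q \<nu>)) / real (q ^ \<nu>) < 2 * k + 1) sequentially"
    by (rule order_tendstoD(2)[OF card_points_asymp[OF q]]) (simp add: k_def)
  show "eventually (\<lambda>\<nu>. dist ((\<Sum>p\<in>points q \<nu>. F (torus_map (scaled q \<nu> p))) / real (q ^ \<nu>)) 
      (kappa q * integral\<^sup>L box_measure (\<lambda>p. F (torus_map p))) < \<eta>) sequentially"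
    using ev1 ev2
  proof eventually_elim
    case (elim \<nu>)
    have m0: "real (q ^ \<nu>) > 0" using q1 by simp
    have "\<bar>(\<Sum>p\<in>points q \<nu>. f (scaled q \<nu> p)) - (\<Sum>p\<in>points q \<nu>. h (scaled q \<nu> p))\<bar> \<le> (\<Sum>p\<in>points q \<nu>. \<delta>)"
      unfolding sum_subtractf[symmetric]
      by (rule order_trans[OF sum_abs sum_mono]) (rule near[OF scaled_in_unit_box])
    then have "\<bar>(\<Sum>p\<in>points q \<nu>. f (scaled q \<nu> p)) - (\<Sum>p\<in>points q \<nu>. h (scaled q \<nu> p))\<bar> / real (q ^ \<nu>) 
        \<le> real (card (points q \<nu>)) / real (q ^ \<nu>) * \<delta>"
      using m0 by (simp add: divide_right_mono)
    also have "\<dots> \<le> (2 * k + 1) * \<delta>" using elim(2) d0 by (intro mult_right_mono) auto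
    finally have "\<bar>(\<Sum>p\<in>points q \<nu>. f (scaled q \<nu> p)) / real (q ^ \<nu>) - (\<Sum>p\<in>points q \<nu>. h (scaled q \<nu> p)) / real (q ^ \<nu>)\<bar> \<le> \<eta> / 3"
      using m0 dk by (simp add: diff_divide_distrib[symmetric])
    moreover have "k * (2 * \<delta>) \<le> (2 * k + 1) * \<delta>" using d0 by (simp add: algebra_simps)
    ultimately show ?case using elim(1) I dk
      unfolding dist_real_def f_def[symmetric] k_def[symmetric] by (simp only: f_def h_def; linarith)
  qed
qed

lemma cis_eq_unit_interval:
  assumes "cis (2 * pi * u) = cis (2 * pi * v)" "u \<in> {0..1}" "v \<in> {0..1}"
  shows "u = v \<or> u = 0 \<or> u = 1"
proof -
  have "cis (2 * pi * u - 2 * pi * v) = 1" using assms(1) by (simp add: cis_divide[symmetric])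
  then have "cos (2 * pi * u - 2 * pi * v) = 1" by (metis cis.sel(1) one_complex.sel(1))
  then obtain n :: int where "2 * pi * u - 2 * pi * v = n * 2 * pi" by (auto simp: cos_one_2pi_int)
  then have "2 * pi * (u - v - of_int n) = 0" by (simp add: algebra_simps)
  then have n: "u - v = of_int n" by simp
  then have "-1 \<le> real_of_int n" "real_of_int n \<le> 1" using assms(2,3) by auto
  then have "n = -1 \<or> n = 0 \<or> n = 1" by linarith
  then show ?thesis using n assms(2,3) by auto
qed

lemma AE_lborel_coordinate:
  assumes "b \<in> (Basis :: 'a::euclidean_space set)"
  shows "AE p in lborel. p \<bullet> b \<noteq> c"
proof -
  have "{p. p \<bullet> b = c} \<in> null_sets lebesgue"
    using negligible_standard_hyperplane[OF assms] by (simp add: negligible_iff_null_sets)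
  moreover have "{p. p \<bullet> b = c} \<in> sets lborel" by simp
  ultimately have "{p. p \<bullet> b = c} \<in> null_sets lborel" by (simp add: null_sets_completion_iff)
  from AE_not_in[OF this] show ?thesis by simp
qed

text \<open>The indicator of \<open>K\<close> is neither continuous nor periodic. It is bounded
  above by the tent functions \<open>F n\<close> around the image \<open>K'\<close>, which decrease
  pointwise to the indicator of \<open>K'\<close>. The preimage of \<open>K'\<close> in the box
  exceeds \<open>K\<close> only on the faces with u or v in {0, 1}, which the torus glues together
  and which have measure 0.\<close>

lemma points_compact_upper:
  assumes q: "prime q" and K: "compact K" "K \<subseteq> unit_box" and e: "e > 0"
  shows "eventually (\<lambda>\<nu>. real (card {p\<in>points q \<nu>. scaled q \<nu> p \<in> K}) / real (q ^ \<nu>) \<le> kappa q * measure box_measure K + e) sequentially"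
proof (cases "K = {}")
  case True
  then show ?thesis using e by simp
next
  case False
  have q1: "q > 1" using q prime_gt_1_nat by blast
  have k0: "kappa q > 0" by (rule kappa_pos[OF q1])
  have [measurable]: "K \<in> sets borel" using K(1) by (rule borel_compact)
  define K' where "K' = torus_map ` K"
  have K'c: "compact K'" unfolding K'_def by (rule compact_continuous_image[OF continuous_torus_map K(1)])
  have K'n: "K' \<noteq> {}" using False by (simp add: K'_def)
  have [measurable]: "K' \<in> sets borel" using K'c by (rule borel_compact)
  define F where "F = (\<lambda>n z. max 0 (1 - real n * infdist z K'))"
  have Fc: "continuous_on UNIV (F n)" for n unfolding F_def by (intro continuous_intros)
  have F01: "0 \<le> F n z" "F n z \<le> 1" for n z by (auto simp: F_def infdist_nonneg)
  have F1: "F n z = 1" if "z \<in> K'" for n z using that by (simp add: F_def)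
  define A where "A = torus_map -` K'"
  have [measurable]: "A \<in> sets borel" unfolding A_def 
    using measurable_sets[OF torus_map_measurable, of K'] by simp
  have lim: "(\<lambda>n. integral\<^sup>L box_measure (\<lambda>p. F n (torus_map p))) \<longlonglongrightarrow> integral\<^sup>L box_measure (indicator A)"
  proof (rule integral_dominated_convergence[where w = "\<lambda>_. 1"])
    show "(\<lambda>p. F n (torus_map p)) \<in> borel_measurable box_measure" for n
      using borel_measurable_continuous_onI[OF Fc] by measurable
    show "AE p in box_measure. (\<lambda>n. F n (torus_map p)) \<longlonglongrightarrow> indicator A p"
    proof (intro AE_I2)
      fix p
      show "(\<lambda>n. F n (torus_map p)) \<longlonglongrightarrow> indicator A p"
      proof (cases "torus_map p \<in> K'")
        case True
        then show ?thesis by (simp add: F1 A_def)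
      next
        case False
        then have pos: "infdist (torus_map p) K' > 0" using compact_imp_closed[OF K'c] K'n
          by (simp add: infdist_pos_not_in_closed)
        have "eventually (\<lambda>n. 1 / infdist (torus_map p) K' \<le> real n) sequentially"
          using filterlim_real_sequentially unfolding filterlim_at_top by blast
        then have "eventually (\<lambda>n. 0 = F n (torus_map p)) sequentially"
        proof eventually_elim
          case (elim n)
          then have "1 \<le> real n * infdist (torus_map p) K'" using pos by (simp add: pos_divide_le_eq)
          then show ?case by (simp add: F_def)
        qed
        then have "(\<lambda>n. F n (torus_map p)) \<longlonglongrightarrow> 0" by (rule Lim_transform_eventually[OF tendsto_const])
        then show ?thesis using False by (simp add: A_def)
      qed
    qed
    show "AE p in box_measure. norm (F n (torus_map p)) \<le> 1" for n using F01 by simp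
  qed auto
  have "integral\<^sup>L box_measure (indicator A) = measure box_measure A" by simp
  also have "\<dots> \<le> measure box_measure K"
  proof -
    have "emeasure box_measure A \<le> emeasure box_measure K"
    proof (rule emeasure_mono_AE)
      have b: "(0,1,0) \<in> (Basis :: (real \<times> real \<times> real) set)" "(0,0,1) \<in> (Basis :: (real \<times> real \<times> real) set)"
        by (auto simp: Basis_prod_def)
      have ae: "AE p :: real \<times> real \<times> real in lborel. fst (snd p) \<noteq> 0 \<and> fst (snd p) \<noteq> 1 \<and> snd (snd p) \<noteq> 0 \<and> snd (snd p) \<noteq> 1"
        using AE_lborel_coordinate[OF b(1), of 0] AE_lborel_coordinate[OF b(1), of 1]
          AE_lborel_coordinate[OF b(2), of 0] AE_lborel_coordinate[OF b(2), of 1]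
        by eventually_elim (auto simp: inner_prod_def)
      have "AE p in box_measure. fst (snd p) \<noteq> 0 \<and> fst (snd p) \<noteq> 1 \<and> snd (snd p) \<noteq> 0 \<and> snd (snd p) \<noteq> 1"
      proof -
        have m: "(\<lambda>p. ennreal (indicator unit_box p * fst p)) \<in> borel_measurable lborel" by measurable
        show ?thesis unfolding box_measure_def AE_density[OF m] using ae by eventually_elim auto
      qed
      then show "AE p in box_measure. p \<in> A \<longrightarrow> p \<in> K" using AE_box_measure
      proof eventually_elim
        case (elim p)
        show ?case
        proof
          assume "p \<in> A"
          then obtain p' where p': "p' \<in> K" "torus_map p = torus_map p'" by (auto simp: A_def K'_def)
          obtain s u v where p: "p = (s,u,v)" by (metis prod.collapse)
          obtain s' u' v' where pp: "p' = (s',u',v')" by (metis prod.collapse)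
          have "p' \<in> unit_box" using p'(1) K(2) by auto
          then have r: "u \<in> {0..1}" "v \<in> {0..1}" "u' \<in> {0..1}" "v' \<in> {0..1}" using elim(2) by (auto simp: p pp unit_box_def)
          have "s = s'" "cis (2 * pi * u) = cis (2 * pi * u')" "cis (2 * pi * v) = cis (2 * pi * v')"
            using p'(2) by (auto simp: p pp torus_map_def)
          then have "p = p'" using cis_eq_unit_interval[of u u'] cis_eq_unit_interval[of v v'] r elim(1) by (auto simp: p pp)
          then show "p \<in> K" using p'(1) by simp
        qed
      qed
    qed simp
    then show ?thesis by (simp add: box_measure.emeasure_eq_measure)
  qed
  finally have IA: "integral\<^sup>L box_measure (indicator A) \<le> measure box_measure K" .
  have "(\<lambda>n. kappa q * integral\<^sup>L box_measure (\<lambda>p. F n (torus_map p))) \<longlonglongrightarrow> kappa q * integral\<^sup>L box_measure (indicator A)"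
    by (intro tendsto_intros lim)
  moreover have "kappa q * integral\<^sup>L box_measure (indicator A) < kappa q * measure box_measure K + e"
    using mult_left_mono[OF IA, of "kappa q"] k0 e by linarith
  ultimately have "eventually (\<lambda>n. kappa q * integral\<^sup>L box_measure (\<lambda>p. F n (torus_map p)) < kappa q * measure box_measure K + e) sequentially"
    by (rule order_tendstoD(2))
  then obtain n where n: "kappa q * integral\<^sup>L box_measure (\<lambda>p. F n (torus_map p)) < kappa q * measure box_measure K + e"
    using eventually_happens'[OF sequentially_bot] by blast
  have "eventually (\<lambda>\<nu>. (\<Sum>p\<in>points q \<nu>. F n (torus_map (scaled q \<nu> p))) / real (q ^ \<nu>) < kappa q * measure box_measure K + e) sequentially"
    by (rule order_tendstoD(2)[OF points_average_continuous[OF q Fc] n])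
  then show ?thesis
  proof eventually_elim
    case (elim \<nu>)
    have "real (card {p\<in>points q \<nu>. scaled q \<nu> p \<in> K}) = (\<Sum>p\<in>{p\<in>points q \<nu>. scaled q \<nu> p \<in> K}. 1)" by simp
    also have "\<dots> = (\<Sum>p\<in>points q \<nu>. if scaled q \<nu> p \<in> K then 1 else 0)"
      by (rule sum.inter_filter) simp
    also have "\<dots> \<le> (\<Sum>p\<in>points q \<nu>. F n (torus_map (scaled q \<nu> p)))"
      by (rule sum_mono) (use F01 F1 in \<open>auto simp: K'_def\<close>)
    finally have "real (card {p\<in>points q \<nu>. scaled q \<nu> p \<in> K}) / real (q ^ \<nu>) \<le> (\<Sum>p\<in>points q \<nu>. F n (torus_map (scaled q \<nu> p))) / real (q ^ \<nu>)"
      by (rule divide_right_mono) simp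
    then show ?case using elim by linarith
  qed
qed

text \<open>The part of the box outside \<open>U\<close> is compact. Subtracting its upper bound
  from the total count, which converges to twice \<open>kappa q\<close>, gives the claim.\<close>

lemma points_open_lower:
  assumes q: "prime q" and U: "open U" and e: "e > 0"
  shows "eventually (\<lambda>\<nu>. real (card {p\<in>points q \<nu>. scaled q \<nu> p \<in> U}) / real (q ^ \<nu>) \<ge> kappa q * measure box_measure U - e) sequentially"
proof -
  have [measurable]: "U \<in> sets borel" using U by simp
  have "compact (unit_box - U)" using compact_diff[OF compact_unit_box U] .
  then have ev1: "eventually (\<lambda>\<nu>. real (card {p\<in>points q \<nu>. scaled q \<nu> p \<in> unit_box - U}) / real (q ^ \<nu>) \<le> 
     kappa q * measure box_measure (unit_box - U) + e / 2) sequentially"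
    by (rule points_compact_upper[OF q]) (use e in auto)
  have ev2: "eventually (\<lambda>\<nu>. real (card (points q \<nu>)) / real (q ^ \<nu>) > kappa q * 2 - e / 2) sequentially"
    by (rule order_tendstoD(1)[OF card_points_asymp[OF q]]) (use e in simp)
  have "measure box_measure (unit_box - U) = measure box_measure (UNIV - U)"
    by (rule measure_eq_AE) (use AE_box_measure in \<open>auto elim!: eventually_mono\<close>)
  also have "\<dots> = 2 - measure box_measure U"
    using box_measure.finite_measure_compl[of U] by (simp add: measure_box_measure_UNIV)
  finally have m: "measure box_measure (unit_box - U) = 2 - measure box_measure U" .
  show ?thesis using ev1 ev2
  proof eventually_elim
    case (elim \<nu>)
    have "card (points q \<nu>) = card {p\<in>points q \<nu>. scaled q \<nu> p \<in> U} + card {p\<in>points q \<nu>. scaled q \<nu> p \<in> unit_box - U}"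
    proof -
      have "points q \<nu> = {p\<in>points q \<nu>. scaled q \<nu> p \<in> U} \<union> {p\<in>points q \<nu>. scaled q \<nu> p \<in> unit_box - U}"
        using scaled_in_unit_box by auto
      then show ?thesis by (metis (no_types, lifting) card_Un_disjoint finite_points finite_Un DiffD2 disjoint_iff mem_Collect_eq)
    qed
    then have "real (card (points q \<nu>)) / real (q ^ \<nu>) = real (card {p\<in>points q \<nu>. scaled q \<nu> p \<in> U}) / real (q ^ \<nu>) + 
       real (card {p\<in>points q \<nu>. scaled q \<nu> p \<in> unit_box - U}) / real (q ^ \<nu>)"
      by (simp add: add_divide_distrib)
    then show ?case using elim m by (simp add: right_diff_distrib)
  qed
qed

section \<open>The volume of the reduced region\<close>

text \<open>The conditions of \<open>wcount\<close> after rescaling by s = a/X, u = x/a, v = y/a: |y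
  - x| <= a, a^2 <= m - x y, and the range of the trace x + y between twice \<open>\<alpha>\<close>
  X and twice \<open>\<beta>\<close> X.\<close>

definition region_c :: "real \<Rightarrow> real \<Rightarrow> (real \<times> real \<times> real) set" where
  "region_c \<alpha> \<beta> = {(s,u,v). 0 \<le> s \<and> s \<le> 2 \<and> \<bar>v - u\<bar> \<le> 1 \<and> s^2 * (1 + u * v) \<le> 1 \<and> 2 * \<alpha> \<le> s * (u + v) \<and> s * (u + v) \<le> 2 * \<beta>}"

text \<open>The range of s is left to \<open>points\<close> and to \<open>strip_measure\<close>,
  which live on 0 <= s <= 2.\<close>

definition region_o :: "real \<Rightarrow> real \<Rightarrow> (real \<times> real \<times> real) set" where
  "region_o \<alpha> \<beta> = {(s,u,v). \<bar>v - u\<bar> < 1 \<and> s^2 * (1 + u * v) < 1 \<and> 2 * \<alpha> < s * (u + v) \<and> s * (u + v) < 2 * \<beta>}"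

lemma closed_region_c: "closed (region_c \<alpha> \<beta>)"
  unfolding region_c_def case_prod_unfold
  by (intro closed_Collect_conj closed_Collect_le continuous_intros)

lemma open_region_o: "open (region_o \<alpha> \<beta>)"
  unfolding region_o_def case_prod_unfold
  by (intro open_Collect_conj open_Collect_less continuous_intros)

definition strip_weight :: "real \<Rightarrow> ennreal" where
  "strip_weight s = ennreal (indicator {0..2} s * s)"

lemma strip_weight_measurable [measurable]: "strip_weight \<in> borel_measurable borel"
  unfolding strip_weight_def[abs_def] by measurable

text \<open>\<open>box_measure\<close> unrolled: the density in s is the same, while u and v run
  over the whole plane instead of one period.\<close>

definition strip_measure :: "(real \<times> real \<times> real) measure" where
  "strip_measure = density lborel (\<lambda>p. strip_weight (fst p))"

lemma sets_strip_measure [simp, measurable_cong]: "sets strip_measure = sets borel"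
  by (simp add: strip_measure_def)

lemma fst_weight_measurable [measurable]: "(\<lambda>p. strip_weight (fst p)) \<in> borel_measurable (borel :: (real \<times> real \<times> real) measure)"
  by (rule measurable_compose[OF _ strip_weight_measurable]) (rule borel_measurable_continuous_onI, intro continuous_intros)

lemma emeasure_strip_measure:
  assumes [measurable]: "A \<in> sets borel"
  shows "emeasure strip_measure A = (\<integral>\<^sup>+p. strip_weight (fst p) * indicator A p \<partial>lborel)"
  unfolding strip_measure_def by (rule emeasure_density) (use assms in auto)

lemma nn_integral_lborel_triple:
  fixes f :: "real \<times> real \<times> real \<Rightarrow> ennreal"
  assumes f [measurable]: "f \<in> borel_measurable borel"
  shows "(\<integral>\<^sup>+p. f p \<partial>lborel) = (\<integral>\<^sup>+s. \<integral>\<^sup>+u. \<integral>\<^sup>+v. f (s,u,v) \<partial>lborel \<partial>lborel \<partial>lborel)"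
proof -
  have m: "f \<in> borel_measurable (lborel \<Otimes>\<^sub>M lborel)" using f by (simp add: lborel_prod)
  have m2: "(\<lambda>q. f (s,q)) \<in> borel_measurable (lborel \<Otimes>\<^sub>M lborel)" for s
    unfolding lborel_prod using f by measurable
  have "(\<integral>\<^sup>+p. f p \<partial>lborel) = (\<integral>\<^sup>+s. \<integral>\<^sup>+q. f (s,q) \<partial>lborel \<partial>lborel)"
    using lborel.nn_integral_fst[OF m] by (simp add: lborel_prod)
  also have "\<dots> = (\<integral>\<^sup>+s. \<integral>\<^sup>+u. \<integral>\<^sup>+v. f (s,u,v) \<partial>lborel \<partial>lborel \<partial>lborel)"
    using lborel.nn_integral_fst[OF m2] by (simp add: lborel_prod)
  finally show ?thesis .
qed

lemma nn_integral_translate: 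
  fixes g :: "real \<Rightarrow> ennreal"
  assumes [measurable]: "g \<in> borel_measurable borel"
  shows "(\<integral>\<^sup>+x. g x \<partial>lborel) = (\<integral>\<^sup>+x. g (t + x) \<partial>lborel)"
  using nn_integral_real_affine[OF assms, of 1 t] by simp

lemma nn_integral_lborel_swap:
  fixes g :: "real \<times> real \<Rightarrow> ennreal"
  assumes "g \<in> borel_measurable borel"
  shows "(\<integral>\<^sup>+x. \<integral>\<^sup>+y. g (x,y) \<partial>lborel \<partial>lborel) = (\<integral>\<^sup>+y. \<integral>\<^sup>+x. g (x,y) \<partial>lborel \<partial>lborel)"
  by (rule lborel_pair.Fubini'[symmetric]) (use assms in \<open>simp add: lborel_prod\<close>)

lemma borel_measurable_triple:
  fixes f :: "real \<times> real \<times> real \<Rightarrow> ennreal"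
  assumes "f \<in> borel_measurable borel" and "g1 \<in> borel_measurable borel" "g2 \<in> borel_measurable borel" "g3 \<in> borel_measurable borel"
  shows "(\<lambda>x::'a::topological_space. f (g1 x, g2 x, g3 x)) \<in> borel_measurable borel"
proof (rule measurable_compose[OF _ assms(1)])
  show "(\<lambda>x. (g1 x, g2 x, g3 x)) \<in> borel \<rightarrow>\<^sub>M borel"
    unfolding borel_prod[symmetric] using assms by measurable
qed

text \<open>The new coordinates are the difference b = v - u and the midpoint p = (u + v)/2. Each is
  introduced by a translation in one variable, so Tonelli and translation invariance replace a
  linear change of variables.\<close>

lemma rotate_coordinates:
  fixes f :: "real \<times> real \<times> real \<Rightarrow> ennreal"
  assumes f: "f \<in> borel_measurable borel"
  shows "(\<integral>\<^sup>+u. \<integral>\<^sup>+v. f (s,u,v) \<partial>lborel \<partial>lborel) = (\<integral>\<^sup>+b. \<integral>\<^sup>+p. f (s, p - b / 2, p + b / 2) \<partial>lborel \<partial>lborel)"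
proof -
  note ms = borel_measurable_triple[OF f]
  have "(\<integral>\<^sup>+u. \<integral>\<^sup>+v. f (s,u,v) \<partial>lborel \<partial>lborel) = (\<integral>\<^sup>+u. \<integral>\<^sup>+b. f (s,u,u + b) \<partial>lborel \<partial>lborel)"
    by (intro nn_integral_cong nn_integral_translate ms) auto
  also have "\<dots> = (\<integral>\<^sup>+b. \<integral>\<^sup>+u. f (s,u,u + b) \<partial>lborel \<partial>lborel)"
  proof -
    have "(\<lambda>p :: real \<times> real. f (s, fst p, fst p + snd p)) \<in> borel_measurable borel"
      by (intro ms borel_measurable_continuous_onI continuous_intros)
    from nn_integral_lborel_swap[OF this] show ?thesis by simp
  qed
  also have "\<dots> = (\<integral>\<^sup>+b. \<integral>\<^sup>+p. f (s, - b / 2 + p, - b / 2 + p + b) \<partial>lborel \<partial>lborel)"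
    by (intro nn_integral_cong nn_integral_translate ms) auto
  also have "\<dots> = (\<integral>\<^sup>+b. \<integral>\<^sup>+p. f (s, p - b / 2, p + b / 2) \<partial>lborel \<partial>lborel)"
    by (simp add: algebra_simps)
  finally show ?thesis .
qed

lemma nn_integral_arcsin_part: "(\<integral>\<^sup>+b. ennreal (1 / sqrt (1 - b^2 / 4)) * indicator {-1..1} b \<partial>lborel) = ennreal (2 * pi / 3)"
proof -
  have "(\<integral>\<^sup>+b. ennreal (1 / sqrt (1 - b^2 / 4)) * indicator {-1..1} b \<partial>lborel) = ennreal (2 * arcsin (1 / 2) - 2 * arcsin (- 1 / 2))"
  proof (rule nn_integral_FTC_Icc[where F = "\<lambda>b. 2 * arcsin (b / 2)"])
    fix b :: real assume "b \<in> {-1..1}"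
    then have b: "-1 \<le> b" "b \<le> 1" by auto
    have "((\<lambda>b. 2 * arcsin (b / 2)) has_real_derivative 2 * (inverse (sqrt (1 - (b / 2)\<^sup>2)) * (1 / 2))) (at b)"
      using b by (auto intro!: derivative_eq_intros)
    then show "((\<lambda>b. 2 * arcsin (b / 2)) has_real_derivative 1 / sqrt (1 - b^2 / 4)) (at b)"
      by (simp add: power_divide inverse_eq_divide)
    have "b^2 \<le> 1" using b by (simp add: abs_square_le_1 abs_le_iff)
    then show "0 \<le> 1 / sqrt (1 - b^2 / 4)" by simp
  qed auto
  then show ?thesis by simp
qed

lemma nn_integral_semicircle_part:
  assumes "-1 \<le> \<alpha>" "\<beta> \<le> 1"
  shows "(\<integral>\<^sup>+x. ennreal (sqrt (1 - x^2)) * indicator {\<alpha>..\<beta>} x \<partial>lborel) = ennreal (integral {\<alpha>..\<beta>} (\<lambda>x. sqrt (1 - x^2)))"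
proof -
  define f where "f = (\<lambda>x. if x \<in> {\<alpha>..\<beta>} then sqrt (1 - x^2) else 0)"
  have "continuous_on {\<alpha>..\<beta>} (\<lambda>x. sqrt (1 - x^2))" by (intro continuous_intros)
  then have "((\<lambda>x. sqrt (1 - x^2)) has_integral integral {\<alpha>..\<beta>} (\<lambda>x. sqrt (1 - x^2))) {\<alpha>..\<beta>}"
    by (intro integrable_integral integrable_continuous_interval)
  then have "(f has_integral integral {\<alpha>..\<beta>} (\<lambda>x. sqrt (1 - x^2))) UNIV"
    unfolding f_def has_integral_restrict_UNIV .
  moreover have "0 \<le> f x" for x
  proof (cases "x \<in> {\<alpha>..\<beta>}")
    case True
    then have "\<bar>x\<bar> \<le> 1" using assms by auto
    then show ?thesis by (simp add: f_def abs_square_le_1)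
  next
    case False
    then show ?thesis unfolding f_def by (simp only: if_False order_refl)
  qed
  moreover have "f \<in> borel_measurable borel" unfolding f_def by measurable
  ultimately have "(\<integral>\<^sup>+x. ennreal (f x) \<partial>lborel) = ennreal (integral {\<alpha>..\<beta>} (\<lambda>x. sqrt (1 - x^2)))"
    by (intro nn_integral_has_integral_lborel)
  moreover have "ennreal (f x) = ennreal (sqrt (1 - x^2)) * indicator {\<alpha>..\<beta>} x" for x by (simp add: f_def)
  ultimately show ?thesis by simp
qed

text \<open>With b = v - u and x = s (u + v)/2 the quadratic condition becomes s^2 (1 - b^2/4) + x^2
  <= 1. So for fixed b and x the admissible s fill an interval from 0 to sqrt(1 - x^2)/sqrt(1 -
  b^2/4), and the two variables separate. Enclosing \<open>A\<close> between the two regions treats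
  strict and weak inequalities at once.\<close>

lemma region_fibre:
  assumes A [measurable]: "A \<in> sets borel" and sub: "region_o \<alpha> \<beta> \<inter> {p. 0 < fst p \<and> fst p \<le> 2} \<subseteq> A" "A \<subseteq> region_c \<alpha> \<beta>"
    and ab: "-1 \<le> \<alpha>" "\<beta> \<le> 1" and b: "b \<noteq> 1" "b \<noteq> -1" and x: "x \<noteq> \<alpha>" "x \<noteq> \<beta>"
  shows "(\<integral>\<^sup>+s. indicator {0<..2} s * indicator A (s, x / s - b / 2, x / s + b / 2) \<partial>lborel) = 
    (ennreal (1 / sqrt (1 - b^2 / 4)) * indicator {-1..1} b) * (ennreal (sqrt (1 - x^2)) * indicator {\<alpha>..\<beta>} x)"
proof (cases "\<bar>b\<bar> < 1 \<and> \<alpha> < x \<and> x < \<beta>")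
  case False
  have "(s, x / s - b / 2, x / s + b / 2) \<notin> A" if "0 < s" for s
  proof
    assume "(s, x / s - b / 2, x / s + b / 2) \<in> A"
    then have "(s, x / s - b / 2, x / s + b / 2) \<in> region_c \<alpha> \<beta>" using sub by auto
    then have "\<bar>b\<bar> \<le> 1" "2 * \<alpha> \<le> s * (2 * (x / s))" "s * (2 * (x / s)) \<le> 2 * \<beta>" by (auto simp: region_c_def)
    then have "\<bar>b\<bar> \<le> 1" "\<alpha> \<le> x" "x \<le> \<beta>" using that by auto
    then show False using False b x by auto
  qed
  then have "indicator {0<..2} s * indicator A (s, x / s - b / 2, x / s + b / 2) = (0::ennreal)" for s by (auto simp: indicator_def)
  then have "(\<integral>\<^sup>+s. indicator {0<..2} s * indicator A (s, x / s - b / 2, x / s + b / 2) \<partial>lborel) = 0"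
    by (simp only: nn_integral_const mult_zero_left)
  moreover have "indicator {-1..1} b = (0::ennreal) \<or> indicator {\<alpha>..\<beta>} x = (0::ennreal)" 
    using False b x by (auto simp: indicator_def)
  ultimately show ?thesis by auto
next
  case True
  define R where "R = sqrt (1 - x^2) / sqrt (1 - b^2 / 4)"
  have b2: "b^2 < 1" using True by (simp add: abs_square_less_1)
  have "\<bar>x\<bar> < 1" using True ab by linarith
  then have x2: "x^2 < 1" by (simp add: abs_square_less_1)
  define c where "c = 1 - b^2 / 4"
  have c: "3/4 < c" using b2 by (simp add: c_def)
  have R0: "R > 0" using x2 c by (simp add: R_def flip: c_def)
  have R2: "R^2 = (1 - x^2) / c" using x2 c by (simp add: R_def power_divide flip: c_def)
  \<comment> \<open>The fibre ends before s = 2, so the cut at 2 does not shorten it.\<close>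
  have "R^2 \<le> 1 / (3/4)" unfolding R2 using c x2 by (intro frac_le) auto
  also have "\<dots> < 2^2" by simp
  finally have "R < 2" by (rule power_less_imp_less_base) simp
  have key: "s^2 * (1 + (x / s - b / 2) * (x / s + b / 2)) = s^2 * c + x^2" if "s > 0" for s
    using that by (simp add: c_def field_simps power2_eq_square)
  have lt: "s^2 * c + x^2 < 1 \<longleftrightarrow> s < R" "s^2 * c + x^2 \<le> 1 \<longleftrightarrow> s \<le> R" if "s > 0" for s
  proof -
    have "s < R \<longleftrightarrow> s^2 < R^2" "s \<le> R \<longleftrightarrow> s^2 \<le> R^2" using that R0 power_mono_iff[of R s 2] power_mono_iff[of s R 2] by (auto simp flip: not_le)
    moreover have "s^2 < R^2 \<longleftrightarrow> s^2 * c + x^2 < 1" "s^2 \<le> R^2 \<longleftrightarrow> s^2 * c + x^2 \<le> 1" 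
      unfolding R2 using c by (auto simp: pos_less_divide_eq pos_le_divide_eq)
    ultimately show "s^2 * c + x^2 < 1 \<longleftrightarrow> s < R" "s^2 * c + x^2 \<le> 1 \<longleftrightarrow> s \<le> R" by auto
  qed
  define B where "B = {s \<in> {0<..2}. (s, x / s - b / 2, x / s + b / 2) \<in> A}"
  have B [measurable]: "B \<in> sets borel"
  proof -
    have "(\<lambda>s. indicator {0<..2} s * (indicator A (s, x / s - b / 2, x / s + b / 2) :: ennreal)) \<in> borel_measurable borel"
      by (intro borel_measurable_times_ennreal borel_measurable_triple[of "indicator A"] borel_measurable_indicator) auto
    then have "{s. indicator {0<..2} s * (indicator A (s, x / s - b / 2, x / s + b / 2) :: ennreal) = 1} \<in> sets borel"
      by measurable
    also have "{s. indicator {0<..2} s * (indicator A (s, x / s - b / 2, x / s + b / 2) :: ennreal) = 1} = B"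
      by (auto simp: B_def indicator_def split: if_splits)
    finally show ?thesis .
  qed
  have "{0<..<R} \<subseteq> B"
  proof
    fix s assume s: "s \<in> {0<..<R}"
    then have "(s, x / s - b / 2, x / s + b / 2) \<in> region_o \<alpha> \<beta>"
      unfolding region_o_def using True key[of s] lt(1)[of s] by simp
    then show "s \<in> B" using s sub \<open>R < 2\<close> by (auto simp: B_def)
  qed
  then have "ennreal R \<le> emeasure lborel B"
    using emeasure_mono[of "{0<..<R}" B lborel] R0 by simp
  moreover have "B \<subseteq> {0<..R}"
  proof
    fix s assume s: "s \<in> B"
    then have "(s, x / s - b / 2, x / s + b / 2) \<in> region_c \<alpha> \<beta>" using sub by (auto simp: B_def)
    then have "s^2 * (1 + (x / s - b / 2) * (x / s + b / 2)) \<le> 1" by (simp add: region_c_def)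
    then show "s \<in> {0<..R}" using s key[of s] lt(2)[of s] by (auto simp: B_def)
  qed
  then have "emeasure lborel B \<le> ennreal R"
    using emeasure_mono[of B "{0<..R}" lborel] R0 by simp
  ultimately have "emeasure lborel B = ennreal R" by (rule antisym[rotated])
  moreover have "(\<integral>\<^sup>+s. indicator {0<..2} s * indicator A (s, x / s - b / 2, x / s + b / 2) \<partial>lborel) = (\<integral>\<^sup>+s. indicator B s \<partial>lborel)"
    by (intro nn_integral_cong) (auto simp: B_def indicator_def)
  moreover have "(\<integral>\<^sup>+s. indicator B s \<partial>lborel) = emeasure lborel B" by simp
  moreover have "ennreal R = ennreal (1 / sqrt (1 - b^2 / 4)) * ennreal (sqrt (1 - x^2))"
    using x2 b2 by (simp add: R_def flip: ennreal_mult)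
  ultimately show ?thesis using True by (simp add: indicator_def abs_less_iff)
qed

text \<open>Passing from the midpoint p to x = s p has Jacobian 1/s, which cancels the density s
  exactly. Integrating over s first then gives the product found in
  \<open>region_fibre\<close>.\<close>

lemma strip_measure_region:
  assumes A [measurable]: "A \<in> sets borel" and sub: "region_o \<alpha> \<beta> \<inter> {p. 0 < fst p \<and> fst p \<le> 2} \<subseteq> A" "A \<subseteq> region_c \<alpha> \<beta>"
    and ab: "-1 \<le> \<alpha>" "\<beta> \<le> 1" "\<alpha> < \<beta>"
  shows "emeasure strip_measure A = ennreal (2 * pi / 3 * integral {\<alpha>..\<beta>} (\<lambda>x. sqrt (1 - x^2)))"
proof -
  define f :: "real \<times> real \<times> real \<Rightarrow> ennreal" where "f = indicator A"
  have f [measurable]: "f \<in> borel_measurable borel" unfolding f_def by measurable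
  note ms = borel_measurable_triple[OF f]
  have bm: "g \<in> borel_measurable borel" if "continuous_on UNIV g" for g :: "'a::topological_space \<Rightarrow> real"
    using that by (rule borel_measurable_continuous_onI)
  \<comment> \<open>The value s = 0 is left out because x/s is formed below; the density vanishes
    there.\<close>
  define w :: "real \<Rightarrow> ennreal" where "w = indicator {0<..2}"
  have w [measurable]: "w \<in> borel_measurable borel" unfolding w_def by measurable
  define F where "F = (\<lambda>s b x. f (s, x / s - b / 2, x / s + b / 2))"
  have F3: "(\<lambda>(s,b,x). w s * F s b x) \<in> borel_measurable (borel \<Otimes>\<^sub>M borel \<Otimes>\<^sub>M borel)"
  proof -
    have "(\<lambda>p::real\<times>real\<times>real. (fst p, snd (snd p) / fst p - fst (snd p) / 2, snd (snd p) / fst p + fst (snd p) / 2)) \<in> 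
        borel \<Otimes>\<^sub>M borel \<Otimes>\<^sub>M borel \<rightarrow>\<^sub>M borel \<Otimes>\<^sub>M borel \<Otimes>\<^sub>M borel" by measurable
    moreover have "f \<in> borel_measurable (borel \<Otimes>\<^sub>M borel \<Otimes>\<^sub>M borel)" using f by (simp add: borel_prod)
    ultimately have "(\<lambda>p::real\<times>real\<times>real. f (fst p, snd (snd p) / fst p - fst (snd p) / 2, snd (snd p) / fst p + fst (snd p) / 2)) \<in> 
       borel_measurable (borel \<Otimes>\<^sub>M borel \<Otimes>\<^sub>M borel)" by (rule measurable_compose)
    then have [measurable]: "(\<lambda>p. F (fst p) (fst (snd p)) (snd (snd p))) \<in> borel_measurable (borel \<Otimes>\<^sub>M borel \<Otimes>\<^sub>M borel)"
      by (simp add: F_def)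
    show ?thesis unfolding case_prod_unfold by measurable
  qed
  then have F3' [measurable]: "(\<lambda>(s,b,x). w s * F s b x) \<in> borel_measurable (lborel \<Otimes>\<^sub>M lborel \<Otimes>\<^sub>M lborel)" 
    by (simp cong: measurable_cong_sets)
  have "emeasure strip_measure A = (\<integral>\<^sup>+p. strip_weight (fst p) * f p \<partial>lborel)"
    unfolding f_def by (rule emeasure_strip_measure[OF A])
  also have "\<dots> = (\<integral>\<^sup>+s. \<integral>\<^sup>+u. \<integral>\<^sup>+v. strip_weight s * f (s,u,v) \<partial>lborel \<partial>lborel \<partial>lborel)"
    by (subst nn_integral_lborel_triple) auto
  also have "\<dots> = (\<integral>\<^sup>+s. \<integral>\<^sup>+b. \<integral>\<^sup>+p. strip_weight s * f (s, p - b / 2, p + b / 2) \<partial>lborel \<partial>lborel \<partial>lborel)"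
  proof (rule nn_integral_cong)
    fix s
    show "(\<integral>\<^sup>+u. \<integral>\<^sup>+v. strip_weight s * f (s,u,v) \<partial>lborel \<partial>lborel) = (\<integral>\<^sup>+b. \<integral>\<^sup>+p. strip_weight s * f (s, p - b / 2, p + b / 2) \<partial>lborel \<partial>lborel)"
      using rotate_coordinates[of "\<lambda>p. strip_weight (fst p) * f p" s] by simp
  qed
  also have "\<dots> = (\<integral>\<^sup>+s. \<integral>\<^sup>+b. \<integral>\<^sup>+x. w s * F s b x \<partial>lborel \<partial>lborel \<partial>lborel)"
  proof (rule nn_integral_cong, rule nn_integral_cong)
    fix s b :: real
    show "(\<integral>\<^sup>+p. strip_weight s * f (s, p - b / 2, p + b / 2) \<partial>lborel) = (\<integral>\<^sup>+x. w s * F s b x \<partial>lborel)"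
    proof (cases "s \<in> {0<..2}")
      case True
      have m: "(\<lambda>p. f (s, p - b / 2, p + b / 2)) \<in> borel_measurable borel" by (intro ms bm continuous_intros)
      have m2: "(\<lambda>x. f (s, x / s - b / 2, x / s + b / 2)) \<in> borel_measurable borel" using True by (intro ms bm continuous_intros) auto
      have "(\<integral>\<^sup>+p. f (s, p - b / 2, p + b / 2) \<partial>lborel) = ennreal (1 / s) * (\<integral>\<^sup>+x. f (s, x / s - b / 2, x / s + b / 2) \<partial>lborel)"
        using nn_integral_real_affine[OF m, of "1 / s" 0] True by simp
      then have "(\<integral>\<^sup>+p. strip_weight s * f (s, p - b / 2, p + b / 2) \<partial>lborel) = (ennreal s * ennreal (1 / s)) * (\<integral>\<^sup>+x. f (s, x / s - b / 2, x / s + b / 2) \<partial>lborel)"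
        using True m by (simp add: nn_integral_cmult strip_weight_def mult.assoc)
      also have "ennreal s * ennreal (1 / s) = 1" using True by (simp flip: ennreal_mult)
      finally show ?thesis using True by (simp add: w_def F_def)
    next
      case False
      then have "strip_weight s = 0" "w s = 0" by (auto simp: strip_weight_def w_def indicator_def)
      then show ?thesis by simp
    qed
  qed
  also have "\<dots> = (\<integral>\<^sup>+b. \<integral>\<^sup>+s. \<integral>\<^sup>+x. w s * F s b x \<partial>lborel \<partial>lborel \<partial>lborel)"
  proof (rule lborel_pair.Fubini'[symmetric])
    have "(\<lambda>((s,b),x). w s * F s b x) \<in> borel_measurable ((lborel \<Otimes>\<^sub>M lborel) \<Otimes>\<^sub>M lborel)"
    proof -
      have "(\<lambda>p::(real\<times>real)\<times>real. (fst (fst p), snd (fst p), snd p)) \<in> (lborel \<Otimes>\<^sub>M lborel) \<Otimes>\<^sub>M lborel \<rightarrow>\<^sub>M lborel \<Otimes>\<^sub>M lborel \<Otimes>\<^sub>M lborel"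
        by measurable
      from measurable_compose[OF this F3'] show ?thesis by (simp add: case_prod_unfold)
    qed
    from lborel.borel_measurable_nn_integral_fst[OF this]
    show "(\<lambda>(s,b). \<integral>\<^sup>+x. w s * F s b x \<partial>lborel) \<in> borel_measurable (lborel \<Otimes>\<^sub>M lborel)"
      by (simp add: case_prod_unfold)
  qed
  also have "\<dots> = (\<integral>\<^sup>+b. \<integral>\<^sup>+x. \<integral>\<^sup>+s. w s * F s b x \<partial>lborel \<partial>lborel \<partial>lborel)"
  proof (rule nn_integral_cong, rule lborel_pair.Fubini'[symmetric])
    fix b :: real
    have "(\<lambda>p::real\<times>real. (fst p, b, snd p)) \<in> lborel \<Otimes>\<^sub>M lborel \<rightarrow>\<^sub>M lborel \<Otimes>\<^sub>M lborel \<Otimes>\<^sub>M lborel"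
      by measurable
    from measurable_compose[OF this F3'] show "(\<lambda>(s,x). w s * F s b x) \<in> borel_measurable (lborel \<Otimes>\<^sub>M lborel)"
      by (simp add: case_prod_unfold)
  qed
  also have "\<dots> = (\<integral>\<^sup>+b. \<integral>\<^sup>+x. (ennreal (1 / sqrt (1 - b^2 / 4)) * indicator {-1..1} b) * (ennreal (sqrt (1 - x^2)) * indicator {\<alpha>..\<beta>} x) \<partial>lborel \<partial>lborel)"
  proof (rule nn_integral_cong_AE)
    have "AE b in lborel. b \<noteq> (1::real)" "AE b in lborel. b \<noteq> (-1::real)"
      by (auto intro: AE_lborel_singleton)
    then show "AE b in lborel. (\<integral>\<^sup>+x. \<integral>\<^sup>+s. w s * F s b x \<partial>lborel \<partial>lborel) = 
      (\<integral>\<^sup>+x. (ennreal (1 / sqrt (1 - b^2 / 4)) * indicator {-1..1} b) * (ennreal (sqrt (1 - x^2)) * indicator {\<alpha>..\<beta>} x) \<partial>lborel)"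
    proof eventually_elim
      case (elim b)
      have "AE x in lborel. x \<noteq> \<alpha>" "AE x in lborel. x \<noteq> \<beta>" by (auto intro: AE_lborel_singleton)
      then have "AE x in lborel. (\<integral>\<^sup>+s. w s * F s b x \<partial>lborel) = 
        (ennreal (1 / sqrt (1 - b^2 / 4)) * indicator {-1..1} b) * (ennreal (sqrt (1 - x^2)) * indicator {\<alpha>..\<beta>} x)"
      proof eventually_elim
        case (elim x)
        then show ?case unfolding w_def F_def f_def using region_fibre[OF A sub ab(1,2), of b x] \<open>b \<noteq> 1\<close> \<open>b \<noteq> -1\<close> by simp
      qed
      then show ?case by (rule nn_integral_cong_AE)
    qed
  qed
  also have "\<dots> = (\<integral>\<^sup>+b. ennreal (1 / sqrt (1 - b^2 / 4)) * indicator {-1..1} b \<partial>lborel) * (\<integral>\<^sup>+x. ennreal (sqrt (1 - x^2)) * indicator {\<alpha>..\<beta>} x \<partial>lborel)"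
    by (subst nn_integral_cmult, measurable, subst nn_integral_multc, measurable)
  also have "\<dots> = ennreal (2 * pi / 3 * integral {\<alpha>..\<beta>} (\<lambda>x. sqrt (1 - x^2)))"
    unfolding nn_integral_arcsin_part nn_integral_semicircle_part[OF ab(1,2)]
    by (rule ennreal_mult'[symmetric]) simp
  finally show ?thesis .
qed

section \<open>Counting reduced forms\<close>

definition shift :: "int \<Rightarrow> int \<Rightarrow> real \<times> real \<times> real \<Rightarrow> real \<times> real \<times> real" where
  "shift j l p = (0, of_int j, of_int l) + p"

lemma shift_simps: "shift j l (s,u,v) = (s, of_int j + u, of_int l + v)"
  by (simp add: shift_def)

lemma continuous_shift: "continuous_on A (shift j l)"
  unfolding shift_def[abs_def] by (intro continuous_intros)

lemma shift_measurable [measurable]: "shift j l \<in> borel \<rightarrow>\<^sub>M borel"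
  by (rule borel_measurable_continuous_onI[OF continuous_shift])

definition cell :: "int \<Rightarrow> int \<Rightarrow> (real \<times> real \<times> real) set" where
  "cell j l = {p. \<lfloor>fst (snd p)\<rfloor> = j \<and> \<lfloor>snd (snd p)\<rfloor> = l}"

lemma cell_borel [measurable]: "cell j l \<in> sets borel"
proof -
  have "cell j l = {p. of_int j \<le> fst (snd p)} \<inter> {p. fst (snd p) < of_int j + 1} \<inter> {p. of_int l \<le> snd (snd p)} \<inter> {p. snd (snd p) < of_int l + 1}"
    by (auto simp: cell_def floor_eq_iff)
  moreover have "{p :: real \<times> real \<times> real. of_int j \<le> fst (snd p)} \<in> sets borel" "{p :: real \<times> real \<times> real. of_int l \<le> snd (snd p)} \<in> sets borel"
    by (intro borel_closed closed_Collect_le continuous_intros)+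
  moreover have "{p :: real \<times> real \<times> real. fst (snd p) < of_int j + 1} \<in> sets borel" "{p :: real \<times> real \<times> real. snd (snd p) < of_int l + 1} \<in> sets borel"
    by (intro borel_open open_Collect_less continuous_intros)+
  ultimately show ?thesis by simp
qed

text \<open>The shift moves the unit square onto the cell (j, l), and Lebesgue measure is
  translation invariant. The closed box and the half-open cell differ only on the faces u = 1 and v
  = 1, which are null.\<close>

lemma emeasure_box_measure_shift:
  assumes [measurable]: "A \<in> sets borel"
  shows "emeasure box_measure (shift j l -` A) = emeasure strip_measure (A \<inter> cell j l)"
proof -
  let ?H = "\<lambda>p. strip_weight (fst p) * indicator (A \<inter> cell j l) p"
  have sA [measurable]: "shift j l -` A \<in> sets borel" 
    using measurable_sets[OF shift_measurable assms, of j l] by simp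
  have m: "?H \<in> borel_measurable borel" by measurable
  have b: "(0,1,0) \<in> (Basis :: (real \<times> real \<times> real) set)" "(0,0,1) \<in> (Basis :: (real \<times> real \<times> real) set)"
    by (auto simp: Basis_prod_def)
  have ae: "AE p :: real \<times> real \<times> real in lborel. fst (snd p) \<noteq> 1 \<and> snd (snd p) \<noteq> 1"
    using AE_lborel_coordinate[OF b(1), of 1] AE_lborel_coordinate[OF b(2), of 1]
    by eventually_elim (auto simp: inner_prod_def)
  have "emeasure box_measure (shift j l -` A) = (\<integral>\<^sup>+p. ennreal (indicator unit_box p * fst p) * indicator (shift j l -` A) p \<partial>lborel)"
    unfolding box_measure_def by (rule emeasure_density) auto
  also have "\<dots> = (\<integral>\<^sup>+p. ?H (shift j l p) \<partial>lborel)"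
  proof (rule nn_integral_cong_AE, use ae in eventually_elim)
    fix p :: "real \<times> real \<times> real" assume p1: "fst (snd p) \<noteq> 1 \<and> snd (snd p) \<noteq> 1"
    obtain s u v where p: "p = (s,u,v)" by (metis prod.collapse)
    have "\<lfloor>of_int j + u\<rfloor> = j \<longleftrightarrow> u \<in> {0..1}" "\<lfloor>of_int l + v\<rfloor> = l \<longleftrightarrow> v \<in> {0..1}"
      using p1 by (auto simp: p floor_eq_iff)
    then show "ennreal (indicator unit_box p * fst p) * indicator (shift j l -` A) p = ?H (shift j l p)"
      by (auto simp: p shift_simps cell_def unit_box_def strip_weight_def indicator_def)
  qed
  also have "\<dots> = (\<integral>\<^sup>+p. ?H p \<partial>distr lborel borel ((+) (0, of_int j, of_int l)))"
    unfolding shift_def by (rule nn_integral_distr[symmetric]) (use m in auto)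
  also have "\<dots> = (\<integral>\<^sup>+p. ?H p \<partial>lborel)" by (simp only: lborel_distr_plus)
  also have "\<dots> = emeasure strip_measure (A \<inter> cell j l)" by (rule emeasure_strip_measure[symmetric]) simp
  finally show ?thesis .
qed

definition cells :: "nat \<Rightarrow> (int \<times> int) set" where
  "cells J = {-int J..int J} \<times> {-int J..int J}"

lemma finite_cells [simp]: "finite (cells J)"
  by (simp add: cells_def)

lemma sum_cells_measure:
  assumes [measurable]: "A \<in> sets borel"
  shows "ennreal (\<Sum>(j,l)\<in>cells J. measure box_measure (shift j l -` A)) = emeasure strip_measure (A \<inter> (\<Union>(j,l)\<in>cells J. cell j l))"
proof -
  have "ennreal (\<Sum>(j,l)\<in>cells J. measure box_measure (shift j l -` A)) = (\<Sum>c\<in>cells J. ennreal (measure box_measure (shift (fst c) (snd c) -` A)))"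
    unfolding case_prod_unfold by (rule sum_ennreal[symmetric]) simp
  also have "\<dots> = (\<Sum>c\<in>cells J. emeasure strip_measure (A \<inter> cell (fst c) (snd c)))"
    by (simp add: box_measure.emeasure_eq_measure[symmetric] emeasure_box_measure_shift)
  also have "\<dots> = emeasure strip_measure (\<Union>c\<in>cells J. A \<inter> cell (fst c) (snd c))"
  proof (rule sum_emeasure)
    show "(\<lambda>c. A \<inter> cell (fst c) (snd c)) ` cells J \<subseteq> sets strip_measure" by auto
  qed (auto simp: disjoint_family_on_def cell_def)
  also have "(\<Union>c\<in>cells J. A \<inter> cell (fst c) (snd c)) = A \<inter> (\<Union>(j,l)\<in>cells J. cell j l)" by auto
  finally show ?thesis .
qed

lemma UN_cells: "(\<Union>J. \<Union>(j,l)\<in>cells J. cell j l) = UNIV"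
proof -
  have "p \<in> (\<Union>J. \<Union>(j,l)\<in>cells J. cell j l)" for p :: "real \<times> real \<times> real"
  proof -
    let ?j = "\<lfloor>fst (snd p)\<rfloor>" and ?l = "\<lfloor>snd (snd p)\<rfloor>"
    have "(?j, ?l) \<in> cells (nat (max \<bar>?j\<bar> \<bar>?l\<bar>))" by (auto simp: cells_def)
    moreover have "p \<in> cell ?j ?l" by (simp add: cell_def)
    ultimately show ?thesis by blast
  qed
  then show ?thesis by auto
qed

text \<open>The finite unions of cells increase to the whole space, so continuity from below
  recovers the measure of \<open>A\<close>.\<close>

lemma sum_cells_measure_tendsto:
  assumes A [measurable]: "A \<in> sets borel" and V: "emeasure strip_measure A = ennreal V" "0 \<le> V"
  shows "(\<lambda>J. \<Sum>(j,l)\<in>cells J. measure box_measure (shift j l -` A)) \<longlonglongrightarrow> V"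
proof -
  let ?C = "\<lambda>J. A \<inter> (\<Union>(j,l)\<in>cells J. cell j l)"
  have "(\<lambda>J. emeasure strip_measure (?C J)) \<longlonglongrightarrow> emeasure strip_measure (\<Union>J. ?C J)"
  proof (rule Lim_emeasure_incseq)
    show "range ?C \<subseteq> sets strip_measure" by (auto intro!: sets.Int sets.finite_UN)
    have "cells J \<subseteq> cells J'" if "J \<le> J'" for J J' using that by (auto simp: cells_def)
    then show "incseq ?C" unfolding incseq_def by blast
  qed
  also have "(\<Union>J. ?C J) = A" using UN_cells by auto
  finally have "(\<lambda>J. ennreal (\<Sum>(j,l)\<in>cells J. measure box_measure (shift j l -` A))) \<longlonglongrightarrow> ennreal V"
    by (simp only: sum_cells_measure[OF A] V)
  then show ?thesis
    by (subst (asm) tendsto_ennreal_iff) (auto intro!: always_eventually sum_nonneg V)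
qed

lemma sum_cells_measure_le:
  assumes A [measurable]: "A \<in> sets borel" and V: "emeasure strip_measure A = ennreal V" "0 \<le> V"
  shows "(\<Sum>(j,l)\<in>cells J. measure box_measure (shift j l -` A)) \<le> V"
proof -
  have "ennreal (\<Sum>(j,l)\<in>cells J. measure box_measure (shift j l -` A)) \<le> ennreal V"
    unfolding sum_cells_measure[OF A] V(1)[symmetric] by (rule emeasure_mono) auto
  then show ?thesis using V(2) by (simp add: ennreal_le_iff)
qed

definition trace_range :: "nat \<Rightarrow> real \<Rightarrow> real \<Rightarrow> int set" where
  "trace_range m \<alpha> \<beta> = {t. t^2 < 4 * int m \<and> \<alpha> \<le> real_of_int t / (2 * sqrt (real m)) \<and> real_of_int t / (2 * sqrt (real m)) \<le> \<beta>}"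

lemma finite_trace_range: "finite (trace_range m \<alpha> \<beta>)"
proof (rule finite_subset)
  show "trace_range m \<alpha> \<beta> \<subseteq> {- (4 * int m)..4 * int m}"
  proof
    fix t assume "t \<in> trace_range m \<alpha> \<beta>"
    then have "t^2 < 4 * int m" by (simp add: trace_range_def)
    moreover have "\<bar>t\<bar> \<le> t^2"
    proof (cases "t = 0")
      case False
      then have "\<bar>t\<bar> * 1 \<le> \<bar>t\<bar> * \<bar>t\<bar>" by (intro mult_left_mono) auto
      then show ?thesis by (simp add: power2_eq_square)
    qed simp
    ultimately show "t \<in> {- (4 * int m)..4 * int m}" by auto
  qed
qed simp

text \<open>With t = x + y and b = y - x one has 4 x y = t^2 - b^2, so a^2 <= m - x y and |b| <= a
  give 3 a^2 <= 4 m. The bounds on 2 x = t - b and 2 y = t + b follow from |t| <= 2 X.\<close>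

lemma wcount_bounds:
  assumes "(a,x,y) \<in> wcount (int m) (trace_range m \<alpha> \<beta>)" and m: "m > 0"
  defines "X \<equiv> sqrt (real m)"
  shows "real_of_int a \<le> 2 * X" "2 * \<bar>real_of_int x\<bar> \<le> 2 * X + real_of_int a" "2 * \<bar>real_of_int y\<bar> \<le> 2 * X + real_of_int a" "\<bar>y - x\<bar> \<le> a" "0 < a"
proof -
  have a: "0 < a" "\<bar>y - x\<bar> \<le> a" "a^2 \<le> int m - x * y" "(x + y)^2 < 4 * int m"
    using assms(1) by (auto simp: wcount_def trace_range_def)
  then show "\<bar>y - x\<bar> \<le> a" "0 < a" by auto
  have X: "X \<ge> 0" "X^2 = real m" by (auto simp: X_def)
  have "(y - x)^2 \<le> a^2" using a(1,2) abs_le_square_iff[of "y - x" a] by simp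
  moreover have "4 * (x * y) = (x + y)^2 - (y - x)^2" by (simp add: power2_eq_square algebra_simps)
  ultimately have "4 * (a^2) \<le> 4 * int m + a^2" using a(3) zero_le_power2[of "x + y"] by linarith
  then have "a^2 \<le> 4 * int m" using zero_le_power2[of a] by linarith
  then have "real_of_int (a^2) \<le> real_of_int (4 * int m)" by (simp only: of_int_le_iff)
  then have "(real_of_int a)^2 \<le> (2 * X)^2" by (simp add: X power_mult_distrib)
  then show "real_of_int a \<le> 2 * X" by (rule power2_le_imp_le) (use X in simp)
  have "real_of_int ((x + y)^2) \<le> real_of_int (4 * int m)" using a(4) by (simp only: of_int_le_iff)
  then have "(real_of_int (x + y))^2 \<le> (2 * X)^2" by (simp add: X power_mult_distrib)
  then have t: "\<bar>real_of_int x + real_of_int y\<bar> \<le> 2 * X" using abs_le_square_iff[of "real_of_int (x + y)" "2 * X"] X(1) by simp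
  have d: "\<bar>real_of_int y - real_of_int x\<bar> \<le> real_of_int a" using a(2) by linarith
  show "2 * \<bar>real_of_int x\<bar> \<le> 2 * X + real_of_int a" "2 * \<bar>real_of_int y\<bar> \<le> 2 * X + real_of_int a"
    using t d by linarith+
qed

lemma of_int_div_bounds:
  assumes "(a::int) > 0"
  shows "real_of_int (x div a) \<le> real_of_int x / real_of_int a" "real_of_int x / real_of_int a < real_of_int (x div a) + 1"
  using floor_correct[of "real_of_int x / real_of_int a"] by (auto simp: floor_divide_of_int_eq)

text \<open>Points high in the cusp, that is with small \<open>a/X\<close>, escape the equidistribution theorem but are few.\<close>
lemma card_cusp:
  fixes q \<nu> :: nat and c :: real
  assumes q: "prime q" and c: "0 \<le> c" "c \<le> 2"
  defines "X \<equiv> sqrt (real (q ^ \<nu>))"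
  defines "S \<equiv> {(a,x,y). 0 < a \<and> real_of_int a \<le> c * X \<and> \<bar>y - x\<bar> \<le> a \<and> 2 * \<bar>real_of_int x\<bar> \<le> 2 * X + real_of_int a \<and> a dvd x * y - int (q ^ \<nu>)}"
  shows "finite S" "real (card S) \<le> 100 * c * real (q ^ \<nu>)"
proof -
  have q1: "q > 1" using q prime_gt_1_nat by blast
  have X0: "X > 0" using q1 by (simp add: X_def)
  have X2: "X * X = real (q ^ \<nu>)" by (simp add: X_def)
  define M where "M = nat \<lfloor>c * X\<rfloor>"
  have M: "real M \<le> c * X" using c X0 by (simp add: M_def)
  \<comment> \<open>A bound for |x div a|, from |x|/a <= X/a + 1/2 and a rounding error of at most
    1.\<close>
  define B where "B = (\<lambda>a::nat. \<lfloor>X / real a + 3 / 2\<rfloor>)"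
  \<comment> \<open>Since |y - x| <= a, the quotients of x and y by a differ by less than 3, which
    leaves the five values -2..2.\<close>
  define D where "D = Sigma {1..M} (\<lambda>a. Sol (q ^ \<nu>) a \<times> ({-B a..B a} \<times> {-2..2::int}))"
  define g :: "int \<times> int \<times> int \<Rightarrow> nat \<times> (int \<times> int) \<times> (int \<times> int)" where
    "g = (\<lambda>(a,x,y). (nat a, (x mod a, y mod a), (x div a, y div a - x div a)))"
  have finD: "finite D" unfolding D_def by (intro finite_SigmaI) auto
  have gS: "g ` S \<subseteq> D"
  proof
    fix t assume "t \<in> g ` S"
    then obtain a x y where t: "t = g (a,x,y)" and a: "0 < a" "real_of_int a \<le> c * X" "\<bar>y - x\<bar> \<le> a"
      and x: "2 * \<bar>real_of_int x\<bar> \<le> 2 * X + real_of_int a" and dv: "a dvd x * y - int (q ^ \<nu>)" by (auto simp: S_def)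
    have na: "int (nat a) = a" "real (nat a) = real_of_int a" using a by auto
    have "nat a \<in> {1..M}" using a by (simp add: M_def le_nat_iff le_floor_iff)
    moreover have "(x mod a, y mod a) \<in> Sol (q ^ \<nu>) (nat a)"
    proof -
      have "[(x mod a) * (y mod a) - int (q ^ \<nu>) = x * y - int (q ^ \<nu>)] (mod a)"
        by (intro cong_diff cong_mult cong_refl) auto
      then have "a dvd (x mod a) * (y mod a) - int (q ^ \<nu>)" using dv cong_dvd_iff by blast
      then show ?thesis using a na by (simp add: Sol_def)
    qed
    moreover have "x div a \<in> {-B (nat a)..B (nat a)}"
    proof -
      have "\<bar>real_of_int x\<bar> \<le> (X / real_of_int a + 1 / 2) * real_of_int a" using x a(1) by (simp add: distrib_right)
      then have "\<bar>real_of_int x\<bar> / real_of_int a \<le> X / real_of_int a + 1 / 2"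
        using a(1) by (simp add: pos_divide_le_eq)
      then have r: "real_of_int x / real_of_int a \<le> X / real_of_int a + 1 / 2" "- (X / real_of_int a + 1 / 2) \<le> real_of_int x / real_of_int a"
      proof -
        have "\<bar>real_of_int x / real_of_int a\<bar> = \<bar>real_of_int x\<bar> / real_of_int a" using a(1) by (simp add: abs_divide)
        then show "real_of_int x / real_of_int a \<le> X / real_of_int a + 1 / 2" "- (X / real_of_int a + 1 / 2) \<le> real_of_int x / real_of_int a"
          using \<open>\<bar>real_of_int x\<bar> / real_of_int a \<le> X / real_of_int a + 1 / 2\<close> by linarith+
      qed
      have "x div a \<le> B (nat a)" "- (x div a) \<le> B (nat a)"
        using r of_int_div_bounds[OF a(1), of x] by (auto simp: B_def le_floor_iff na)
      then show ?thesis by auto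
    qed
    moreover have "y div a - x div a \<in> {-2..2}"
    proof -
      have "\<bar>real_of_int y - real_of_int x\<bar> \<le> real_of_int a" using a(3) by linarith
      then have "\<bar>(real_of_int y - real_of_int x) / real_of_int a\<bar> \<le> 1" using a(1) by (simp add: abs_divide)
      then have "\<bar>real_of_int y / real_of_int a - real_of_int x / real_of_int a\<bar> \<le> 1" by (simp only: diff_divide_distrib)
      then have "real_of_int (y div a) - real_of_int (x div a) < 3" "real_of_int (y div a) - real_of_int (x div a) > -3"
        using of_int_div_bounds[OF a(1), of x] of_int_div_bounds[OF a(1), of y] by linarith+
      then show ?thesis by auto
    qed
    ultimately show "t \<in> D" by (simp add: t g_def D_def)
  qed
  have inj: "inj_on g S"
  proof (rule inj_onI)
    fix s t assume s: "s \<in> S" and t: "t \<in> S" and eq: "g s = g t"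
    obtain a x y where S: "s = (a,x,y)" by (metis prod.collapse)
    obtain a' x' y' where T: "t = (a',x',y')" by (metis prod.collapse)
    have "0 < a" "0 < a'" using s t by (auto simp: S T S_def)
    then have aa: "a = a'" using eq by (auto simp: S T g_def)
    have e: "x mod a = x' mod a" "y mod a = y' mod a" "x div a = x' div a" "y div a = y' div a"
      using eq by (auto simp: S T g_def aa)
    have "x = x'" using e(1,3) by (metis mult_div_mod_eq)
    moreover have "y = y'" using e(2,4) by (metis mult_div_mod_eq)
    ultimately show "s = t" by (simp only: S T aa)
  qed
  show "finite S" using finite_imageD[OF finite_subset[OF gS finD] inj] .
  have "card S \<le> card D" by (rule card_inj_on_le[OF inj gS finD])
  also have "card D = (\<Sum>a\<in>{1..M}. card (Sol (q ^ \<nu>) a) * (nat (2 * B a + 1) * 5))"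
  proof -
    have "card ({-B a..B a}) = nat (2 * B a + 1)" for a by (simp add: algebra_simps)
    then show ?thesis unfolding D_def by (subst card_SigmaI) (auto simp: card_cartesian_product)
  qed
  finally have "real (card S) \<le> real (\<Sum>a\<in>{1..M}. card (Sol (q ^ \<nu>) a) * (nat (2 * B a + 1) * 5))"
    by (simp only: of_nat_le_iff)
  also have "\<dots> = (\<Sum>a\<in>{1..M}. real (card (Sol (q ^ \<nu>) a)) * (real (nat (2 * B a + 1)) * 5))"
    by (simp only: of_nat_sum of_nat_mult of_nat_numeral)
  \<comment> \<open>As 1 <= 2 X/a, one has 2 B + 1 <= 2 X/a + 4 <= 10 X/a, and the five differences
    make 50. The final 100 includes the factor 2 of \<open>sum_card_Sol_div_le\<close>.\<close>
  also have "\<dots> \<le> (\<Sum>a\<in>{1..M}. (50 * X) * (real (card (Sol (q ^ \<nu>) a)) / real a))"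
  proof (rule sum_mono)
    fix a assume a: "a \<in> {1..M}"
    then have a0: "real a > 0" by simp
    have "real a \<le> c * X" using a M by simp
    also have "\<dots> \<le> 2 * X" using c X0 by simp
    finally have "1 \<le> 2 * X / real a" using a0 by (simp add: pos_le_divide_eq)
    moreover have "real_of_int (B a) \<le> X / real a + 3 / 2" by (simp add: B_def)
    moreover have "0 \<le> B a" using X0 a0 by (simp add: B_def)
    ultimately have "real (nat (2 * B a + 1)) * 5 \<le> 50 * X / real a" by simp
    then have "real (card (Sol (q ^ \<nu>) a)) * (real (nat (2 * B a + 1)) * 5) \<le> real (card (Sol (q ^ \<nu>) a)) * (50 * X / real a)"
      by (intro mult_left_mono) auto
    then show "real (card (Sol (q ^ \<nu>) a)) * (real (nat (2 * B a + 1)) * 5) \<le> (50 * X) * (real (card (Sol (q ^ \<nu>) a)) / real a)"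
      by (simp add: mult.commute)
  qed
  also have "\<dots> = 50 * X * (\<Sum>a\<in>{1..M}. real (card (Sol (q ^ \<nu>) a)) / real a)" by (simp only: sum_distrib_left)
  also have "\<dots> \<le> 50 * X * (2 * real M)" using X0 by (intro mult_left_mono sum_card_Sol_div_le[OF q]) auto
  also have "\<dots> \<le> 50 * X * (2 * (c * X))" using X0 M by (intro mult_left_mono) auto
  also have "\<dots> = 100 * c * (X * X)" by simp
  also have "\<dots> = 100 * c * real (q ^ \<nu>)" by (simp only: X2)
  finally show "real (card S) \<le> 100 * c * real (q ^ \<nu>)" .
qed

definition cell_points :: "nat \<Rightarrow> nat \<Rightarrow> (real \<times> real \<times> real) set \<Rightarrow> int \<Rightarrow> int \<Rightarrow> (nat \<times> int \<times> int) set" where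
  "cell_points q \<nu> A j l = {p \<in> points q \<nu>. scaled q \<nu> p \<in> shift j l -` A}"

lemma finite_cell_points [simp]: "finite (cell_points q \<nu> A j l)"
  by (simp add: cell_points_def)

definition unfold_point :: "int \<Rightarrow> int \<Rightarrow> nat \<times> int \<times> int \<Rightarrow> int \<times> int \<times> int" where
  "unfold_point j l = (\<lambda>(a,x,y). (int a, x + int a * j, y + int a * l))"

lemma shift_scaled:
  assumes "a > 0"
  shows "shift j l (scaled q \<nu> (a,x,y)) = (real a / sqrt (real (q ^ \<nu>)), real_of_int (x + int a * j) / real a, real_of_int (y + int a * l) / real a)"
  using assms by (simp add: scaled_def shift_simps add_divide_distrib)

lemma rescaled_form:
  fixes A X u v :: real
  assumes "A \<noteq> 0"
  shows "(A / X)^2 * (1 + u / A * (v / A)) = (A^2 + u * v) / X^2"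
proof -
  have "A^2 * (1 + u / A * (v / A)) = A^2 + u * v" using assms by (simp add: power2_eq_square distrib_left)
  then show ?thesis by (simp only: power_divide times_divide_eq_left)
qed

text \<open>A triple whose quotients by a lie in \<open>cells J\<close> is unfolded from a point in
  the corresponding cell. Otherwise J a <= |x| or J a <= |y|, while both 2|x| and 2|y| are at most 2
  X + a. This forces J a <= 2 X, so the triple is counted by \<open>card_cusp\<close> with c =
  2/J.\<close>

lemma wcount_card_le:
  assumes q: "prime q" and J: "J \<ge> 1"
  shows "real (card (wcount (int (q ^ \<nu>)) (trace_range (q ^ \<nu>) \<alpha> \<beta>))) \<le> 
    (\<Sum>(j,l)\<in>cells J. real (card (cell_points q \<nu> (region_c \<alpha> \<beta>) j l))) + 200 / real J * real (q ^ \<nu>)"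
proof -
  have q1: "q > 1" using q prime_gt_1_nat by blast
  define m where "m = q ^ \<nu>"
  have m0: "m > 0" using q1 by (simp add: m_def)
  define X where "X = sqrt (real m)"
  have X0: "X > 0" and X2: "X^2 = real m" using m0 by (auto simp: X_def)
  let ?W = "wcount (int m) (trace_range m \<alpha> \<beta>)"
  define S where "S = {(a,x,y). 0 < a \<and> real_of_int a \<le> (2 / real J) * X \<and> \<bar>y - x\<bar> \<le> a \<and> 2 * \<bar>real_of_int x\<bar> \<le> 2 * X + real_of_int a \<and> a dvd x * y - int (q ^ \<nu>)}"
  have c: "0 \<le> 2 / real J" "2 / real J \<le> 2" using J by (auto simp: field_simps)
  have S: "finite S" "real (card S) \<le> 100 * (2 / real J) * real (q ^ \<nu>)"
    using card_cusp[OF q c, of \<nu>] unfolding S_def X_def m_def by auto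
  let ?U = "\<Union>c\<in>cells J. unfold_point (fst c) (snd c) ` cell_points q \<nu> (region_c \<alpha> \<beta>) (fst c) (snd c)"
  have "?W \<subseteq> ?U \<union> S"
  proof
    fix t assume "t \<in> ?W"
    moreover obtain a x y where t: "t = (a,x,y)" by (metis prod.collapse)
    ultimately have W: "(a,x,y) \<in> ?W" by simp
    note bd = wcount_bounds[OF W m0, folded X_def]
    have a0: "0 < a" by (rule bd(5))
    have w: "a^2 \<le> int m - x * y" "a dvd x * y - int m" "\<alpha> \<le> real_of_int (x + y) / (2 * X)" "real_of_int (x + y) / (2 * X) \<le> \<beta>"
      using W by (auto simp: wcount_def trace_range_def X_def)
    show "t \<in> ?U \<union> S"
    proof (cases "(x div a, y div a) \<in> cells J")
      case True
      define p where "p = (nat a, x mod a, y mod a)"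
      have na: "int (nat a) = a" "real (nat a) = real_of_int a" using a0 by auto
      have "nat a \<in> {1..amax q \<nu>}" using a0 bd(1) by (simp add: amax_def le_nat_iff le_floor_iff X_def m_def)
      moreover have "(x mod a, y mod a) \<in> Sol (q ^ \<nu>) (nat a)"
      proof -
        have "[(x mod a) * (y mod a) - int m = x * y - int m] (mod a)"
          by (intro cong_diff cong_mult cong_refl) auto
        then have "a dvd (x mod a) * (y mod a) - int m" using w(2) cong_dvd_iff by blast
        then show ?thesis using a0 na by (simp add: Sol_def m_def)
      qed
      ultimately have pp: "p \<in> points q \<nu>" by (simp add: p_def points_def)
      have "shift (x div a) (y div a) (scaled q \<nu> p) = (real_of_int a / X, real_of_int x / real_of_int a, real_of_int y / real_of_int a)"
        unfolding p_def using shift_scaled[of "nat a" "x div a" "y div a" q \<nu> "x mod a" "y mod a"] a0 na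
        by (simp add: X_def m_def)
      moreover have "(real_of_int a / X, real_of_int x / real_of_int a, real_of_int y / real_of_int a) \<in> region_c \<alpha> \<beta>"
      proof -
        have "real_of_int a / X \<le> 2" using bd(1) X0 by (simp add: pos_divide_le_eq)
        moreover have "\<bar>real_of_int y / real_of_int a - real_of_int x / real_of_int a\<bar> \<le> 1"
        proof -
          have "\<bar>real_of_int y - real_of_int x\<bar> \<le> real_of_int a" using bd(4) by linarith
          then show ?thesis using a0 by (simp add: abs_divide flip: diff_divide_distrib)
        qed
        moreover have "(real_of_int a / X)^2 * (1 + real_of_int x / real_of_int a * (real_of_int y / real_of_int a)) \<le> 1"
        proof -
          have "real_of_int (a^2 + x * y) \<le> real_of_int (int m)" using w(1) by (simp only: of_int_le_iff)
          then have "(real_of_int a)^2 + real_of_int x * real_of_int y \<le> real m" by simp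
          moreover have "(real_of_int a / X)^2 * (1 + real_of_int x / real_of_int a * (real_of_int y / real_of_int a)) = ((real_of_int a)^2 + real_of_int x * real_of_int y) / real m"
            using rescaled_form[of "real_of_int a" X] a0 by (simp add: X2)
          ultimately show ?thesis using m0 by simp
        qed
        moreover have "2 * \<alpha> \<le> real_of_int a / X * (real_of_int x / real_of_int a + real_of_int y / real_of_int a)"
            "real_of_int a / X * (real_of_int x / real_of_int a + real_of_int y / real_of_int a) \<le> 2 * \<beta>"
        proof -
          have "real_of_int a / X * (real_of_int x / real_of_int a + real_of_int y / real_of_int a) = 2 * (real_of_int (x + y) / (2 * X))"
            using a0 X0 by (simp add: field_simps)
          then show "2 * \<alpha> \<le> real_of_int a / X * (real_of_int x / real_of_int a + real_of_int y / real_of_int a)"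
            "real_of_int a / X * (real_of_int x / real_of_int a + real_of_int y / real_of_int a) \<le> 2 * \<beta>"
            using w(3,4) by linarith+
        qed
        moreover have "0 \<le> real_of_int a / X" using a0 X0 by simp
        ultimately show ?thesis unfolding region_c_def by (simp only: mem_Collect_eq prod.case simp_thms)
      qed
      ultimately have "p \<in> cell_points q \<nu> (region_c \<alpha> \<beta>) (x div a) (y div a)"
        using pp by (simp add: cell_points_def)
      moreover have "t = unfold_point (x div a) (y div a) p"
        using na by (simp add: unfold_point_def p_def t mod_mult_div_eq)
      ultimately have "t \<in> unfold_point (fst (x div a, y div a)) (snd (x div a, y div a)) ` cell_points q \<nu> (region_c \<alpha> \<beta>) (fst (x div a, y div a)) (snd (x div a, y div a))"
        by simp
      then show ?thesis using True by blast
    next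
      case False
      have far: "real_of_int a \<le> 2 / real J * X" if z: "z div a \<notin> {-int J..int J}" "2 * \<bar>real_of_int z\<bar> \<le> 2 * X + real_of_int a" for z
      proof -
        have "real J \<le> \<bar>real_of_int z / real_of_int a\<bar>"
        proof (cases "z div a > int J")
          case True
          then have "real J \<le> real_of_int (z div a)" by linarith
          then show ?thesis using of_int_div_bounds(1)[OF a0, of z] by linarith
        next
          case False
          then have "z div a + 1 \<le> - int J" using z(1) by auto
          then have "real_of_int (z div a) + 1 \<le> - real J" by linarith
          then show ?thesis using of_int_div_bounds(2)[OF a0, of z] by linarith
        qed
        then have "real J * real_of_int a \<le> \<bar>real_of_int z\<bar>" using a0 by (simp add: abs_divide pos_le_divide_eq)
        moreover have "1 * real_of_int a \<le> real J * real_of_int a" using J a0 by (intro mult_right_mono) auto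
        ultimately have "real J * real_of_int a \<le> 2 * X" using z(2) by linarith
        then show ?thesis using J by (simp add: field_simps)
      qed
      have "real_of_int a \<le> 2 / real J * X"
        using False far[OF _ bd(2)] far[OF _ bd(3)] by (auto simp: cells_def)
      then show ?thesis using bd(2,4,5) w(2) by (simp add: S_def t m_def)
    qed
  qed
  then have "card ?W \<le> card (?U \<union> S)" by (intro card_mono finite_UnI finite_UN_I S(1)) auto
  moreover have "card (?U \<union> S) \<le> card ?U + card S" by (rule card_Un_le)
  moreover have "card ?U \<le> (\<Sum>c\<in>cells J. card (unfold_point (fst c) (snd c) ` cell_points q \<nu> (region_c \<alpha> \<beta>) (fst c) (snd c)))"
    by (rule card_UN_le) simp
  moreover have "\<dots> \<le> (\<Sum>c\<in>cells J. card (cell_points q \<nu> (region_c \<alpha> \<beta>) (fst c) (snd c)))"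
    by (intro sum_mono card_image_le) simp
  ultimately have "card ?W \<le> (\<Sum>c\<in>cells J. card (cell_points q \<nu> (region_c \<alpha> \<beta>) (fst c) (snd c))) + card S"
    by linarith
  then have "real (card ?W) \<le> real (\<Sum>c\<in>cells J. card (cell_points q \<nu> (region_c \<alpha> \<beta>) (fst c) (snd c))) + real (card S)"
    by (simp only: of_nat_le_iff flip: of_nat_add)
  then show ?thesis using S(2) unfolding of_nat_sum case_prod_unfold m_def by linarith
qed

text \<open>Division with remainder by a recovers both the cell and the residues, so unfolding is
  injective over all cells together. Ignoring the cells beyond J only lowers the left side.\<close>

lemma scount_card_ge:
  assumes q: "prime q"
  shows "(\<Sum>(j,l)\<in>cells J. real (card (cell_points q \<nu> (region_o \<alpha> \<beta>) j l))) \<le> 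
    real (card (scount (int (q ^ \<nu>)) (trace_range (q ^ \<nu>) \<alpha> \<beta>)))"
proof -
  have q1: "q > 1" using q prime_gt_1_nat by blast
  define m where "m = q ^ \<nu>"
  have m0: "m > 0" using q1 by (simp add: m_def)
  define X where "X = sqrt (real m)"
  have X0: "X > 0" and X2: "X^2 = real m" using m0 by (auto simp: X_def)
  let ?C = "\<lambda>c. cell_points q \<nu> (region_o \<alpha> \<beta>) (fst c) (snd c)"
  let ?W = "scount (int m) (trace_range m \<alpha> \<beta>)"
  define f where "f = (\<lambda>(c,p). unfold_point (fst c) (snd c) p)"
  have "card (Sigma (cells J) ?C) \<le> card ?W"
  proof (rule card_inj_on_le[of f])
    show "finite ?W"
      by (rule finite_subset[OF _ card_wcount(1)[OF finite_trace_range]]) (auto simp: scount_def wcount_def)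
    show "inj_on f (Sigma (cells J) ?C)"
    proof (rule inj_onI)
      fix s t assume s: "s \<in> Sigma (cells J) ?C" and t: "t \<in> Sigma (cells J) ?C" and eq: "f s = f t"
      obtain j l a x y where S: "s = ((j,l),(a,x,y))" by (metis prod.collapse)
      obtain j' l' a' x' y' where T: "t = ((j',l'),(a',x',y'))" by (metis prod.collapse)
      have aa: "a = a'" and e: "x + int a * j = x' + int a * j'" "y + int a * l = y' + int a * l'"
        using eq by (auto simp: S T f_def unfold_point_def)
      have r: "0 \<le> x" "x < int a" "0 \<le> y" "y < int a" "0 \<le> x'" "x' < int a" "0 \<le> y'" "y' < int a"
        using s t aa by (auto simp: S T cell_points_def points_def Sol_def)
      have "x = (x + int a * j) mod int a" "y = (y + int a * l) mod int a" using r by simp_all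
      moreover have "x' = (x' + int a * j') mod int a" "y' = (y' + int a * l') mod int a" using r by simp_all
      ultimately have "x = x'" "y = y'" using e by simp_all
      moreover have "int a \<noteq> 0" using r by linarith
      ultimately show "s = t" using e aa by (simp add: S T)
    qed
    show "f ` Sigma (cells J) ?C \<subseteq> ?W"
    proof
      fix t assume "t \<in> f ` Sigma (cells J) ?C"
      then obtain j l a x y where t: "t = unfold_point j l (a,x,y)" and p: "(a,x,y) \<in> points q \<nu>"
        and sh: "shift j l (scaled q \<nu> (a,x,y)) \<in> region_o \<alpha> \<beta>" by (force simp: f_def cell_points_def)
      have a: "a > 0" and sol: "int a dvd x * y - int m" using p by (auto simp: points_def Sol_def m_def)
      define x1 where "x1 = x + int a * j"
      define y1 where "y1 = y + int a * l"
      have "shift j l (scaled q \<nu> (a,x,y)) = (real a / X, real_of_int x1 / real a, real_of_int y1 / real a)"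
        using shift_scaled[OF a] by (simp add: x1_def y1_def X_def m_def)
      then have R: "\<bar>real_of_int y1 / real a - real_of_int x1 / real a\<bar> < 1"
        "(real a / X)^2 * (1 + real_of_int x1 / real a * (real_of_int y1 / real a)) < 1"
        "2 * \<alpha> < real a / X * (real_of_int x1 / real a + real_of_int y1 / real a)"
        "real a / X * (real_of_int x1 / real a + real_of_int y1 / real a) < 2 * \<beta>"
        using sh by (auto simp: region_o_def)
      have "\<bar>(real_of_int y1 - real_of_int x1) / real a\<bar> < 1" using R(1) by (simp only: diff_divide_distrib)
      then have "\<bar>real_of_int y1 - real_of_int x1\<bar> < real a" using a by (simp add: abs_divide)
      then have 1: "\<bar>y1 - x1\<bar> < int a" by linarith
      have "(real a / X)^2 * (1 + real_of_int x1 / real a * (real_of_int y1 / real a)) = ((real a)^2 + real_of_int x1 * real_of_int y1) / real m"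
        using rescaled_form[of "real a" X] a by (simp add: X2)
      then have "(real a)^2 + real_of_int x1 * real_of_int y1 < real m" using R(2) m0 by simp
      then have "real_of_int ((int a)^2 + x1 * y1) < real_of_int (int m)" by simp
      then have 2: "(int a)^2 < int m - x1 * y1" by (simp only: of_int_less_iff)
      have "real a / X * (real_of_int x1 / real a + real_of_int y1 / real a) = 2 * (real_of_int (x1 + y1) / (2 * X))"
        using a X0 by (simp add: field_simps)
      then have 3: "\<alpha> \<le> real_of_int (x1 + y1) / (2 * X)" "real_of_int (x1 + y1) / (2 * X) \<le> \<beta>"
        using R(3,4) by linarith+
      have "[x1 * y1 - int m = x * y - int m] (mod int a)"
        unfolding x1_def y1_def by (intro cong_diff cong_mult cong_refl) (auto simp: cong_def)
      then have 4: "int a dvd x1 * y1 - int m" using sol cong_dvd_iff by blast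
      \<comment> \<open>\<open>region_o\<close> does not mention the condition t^2 < 4 m; it follows
        from t^2 = b^2 + 4 x y < a^2 + 4 (m - a^2).\<close>
      have "(y1 - x1)^2 < (int a)^2" using 1 abs_le_square_iff[of "int a" "y1 - x1"] by (simp flip: not_le)
      moreover have "(x1 + y1)^2 = (y1 - x1)^2 + 4 * (x1 * y1)" by (simp add: power2_eq_square algebra_simps)
      ultimately have 5: "(x1 + y1)^2 < 4 * int m" using 2 zero_le_power2[of "int a"] by linarith
      show "t \<in> ?W" using a 1 2 3 4 5 by (simp add: t unfold_point_def scount_def trace_range_def X_def flip: x1_def y1_def)
    qed
  qed
  moreover have "card (Sigma (cells J) ?C) = (\<Sum>c\<in>cells J. card (?C c))" by (rule card_SigmaI) auto
  ultimately have "real (\<Sum>c\<in>cells J. card (?C c)) \<le> real (card ?W)" by (simp only: of_nat_le_iff)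
  then show ?thesis unfolding of_nat_sum case_prod_unfold m_def .
qed

text \<open>In each direction J is fixed before nu grows: for the lower bound so that the cells up
  to J carry almost all the volume, for the upper bound so that the cusp error 200/J is small. Then
  only finitely many applications of equidistribution are left.\<close>

lemma hurwitz_average:
  assumes q: "prime q" and ab: "-1 \<le> \<alpha>" "\<alpha> < \<beta>" "\<beta> \<le> 1"
  shows "(\<lambda>\<nu>. (\<Sum>t\<in>trace_range (q ^ \<nu>) \<alpha> \<beta>. hurwitz (4 * int (q ^ \<nu>) - t^2)) / real (q ^ \<nu>))
     \<longlonglongrightarrow> kappa q * (2 * pi / 3 * integral {\<alpha>..\<beta>} (\<lambda>x. sqrt (1 - x^2)))"
proof -
  have q1: "q > 1" using q prime_gt_1_nat by blast
  have k0: "kappa q > 0" by (rule kappa_pos[OF q1])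
  define V where "V = 2 * pi / 3 * integral {\<alpha>..\<beta>} (\<lambda>x. sqrt (1 - x^2))"
  define H where "H = (\<lambda>\<nu>. \<Sum>t\<in>trace_range (q ^ \<nu>) \<alpha> \<beta>. hurwitz (4 * int (q ^ \<nu>) - t^2))"
  have V0: "V \<ge> 0"
  proof -
    have "integral {\<alpha>..\<beta>} (\<lambda>x. sqrt (1 - x^2)) \<ge> 0"
    proof (rule integral_nonneg)
      show "(\<lambda>x. sqrt (1 - x^2)) integrable_on {\<alpha>..\<beta>}"
        by (intro integrable_continuous_interval continuous_intros)
      fix x assume "x \<in> {\<alpha>..\<beta>}"
      then have "\<bar>x\<bar> \<le> 1" using ab by auto
      then show "0 \<le> sqrt (1 - x^2)" by (simp add: abs_square_le_1)
    qed
    then show ?thesis by (simp add: V_def)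
  qed
  have m0: "real (q ^ \<nu>) > 0" for \<nu> using q1 by simp
  have cb [measurable]: "region_c \<alpha> \<beta> \<in> sets borel" by (rule borel_closed[OF closed_region_c])
  have ob [measurable]: "region_o \<alpha> \<beta> \<in> sets borel" by (rule borel_open[OF open_region_o])
  have Vc: "emeasure strip_measure (region_c \<alpha> \<beta>) = ennreal V"
    unfolding V_def by (rule strip_measure_region[OF cb]) (use ab in \<open>auto simp: region_c_def region_o_def\<close>)
  \<comment> \<open>\<open>strip_measure_region\<close> asks for a subset of
    \<open>region_c\<close>, so the open region is cut to the relevant range of s.\<close>
  define O' where "O' = region_o \<alpha> \<beta> \<inter> {p. 0 < fst p \<and> fst p \<le> 2}"
  have O'b [measurable]: "O' \<in> sets borel"
  proof -
    have "{p :: real \<times> real \<times> real. 0 < fst p} \<in> sets borel" by (intro borel_open open_Collect_less continuous_intros)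
    moreover have "{p :: real \<times> real \<times> real. fst p \<le> 2} \<in> sets borel" by (intro borel_closed closed_Collect_le continuous_intros)
    ultimately have "region_o \<alpha> \<beta> \<inter> ({p. 0 < fst p} \<inter> {p. fst p \<le> 2}) \<in> sets borel" using ob by (intro sets.Int)
    then show ?thesis by (simp add: O'_def Collect_conj_eq)
  qed
  have Vo: "emeasure strip_measure O' = ennreal V"
    unfolding V_def by (rule strip_measure_region[OF O'b]) (use ab in \<open>auto simp: O'_def region_c_def region_o_def\<close>)
  have "(\<lambda>\<nu>. H \<nu> / real (q ^ \<nu>)) \<longlonglongrightarrow> kappa q * V"
  proof (rule tendstoI)
    fix e :: real assume e: "e > 0"
    have lower: "eventually (\<lambda>\<nu>. H \<nu> / real (q ^ \<nu>) > kappa q * V - e) sequentially"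
    proof -
      have "(\<lambda>J. kappa q * (\<Sum>(j,l)\<in>cells J. measure box_measure (shift j l -` O'))) \<longlonglongrightarrow> kappa q * V"
        by (intro tendsto_intros sum_cells_measure_tendsto O'b Vo V0)
      then have "eventually (\<lambda>J. kappa q * (\<Sum>(j,l)\<in>cells J. measure box_measure (shift j l -` O')) > kappa q * V - e / 2) sequentially"
        by (rule order_tendstoD(1)) (use e in simp)
      then obtain J where J: "kappa q * (\<Sum>(j,l)\<in>cells J. measure box_measure (shift j l -` O')) > kappa q * V - e / 2"
        using eventually_happens'[OF sequentially_bot] by blast
      \<comment> \<open>The error allotted to one cell; the added 1 keeps the total strictly below
        e/2.\<close>
      define \<delta> where "\<delta> = e / (2 * (real (card (cells J)) + 1))"
      have d0: "\<delta> > 0" using e by (simp add: \<delta>_def)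
      have dc: "real (card (cells J)) * \<delta> < e / 2" using e by (simp add: \<delta>_def field_simps)
      have "eventually (\<lambda>\<nu>. \<forall>c\<in>cells J. real (card (cell_points q \<nu> (region_o \<alpha> \<beta>) (fst c) (snd c))) / real (q ^ \<nu>) \<ge> 
          kappa q * measure box_measure (shift (fst c) (snd c) -` region_o \<alpha> \<beta>) - \<delta>) sequentially"
        unfolding cell_points_def
        by (intro eventually_ball_finite ballI points_open_lower[OF q _ d0] open_vimage open_region_o continuous_shift) simp
      then show ?thesis
      proof eventually_elim
        case (elim \<nu>)
        have "kappa q * V - e / 2 < (\<Sum>c\<in>cells J. kappa q * measure box_measure (shift (fst c) (snd c) -` O'))"
          using J by (simp add: sum_distrib_left case_prod_unfold)
        also have "\<dots> \<le> (\<Sum>c\<in>cells J. real (card (cell_points q \<nu> (region_o \<alpha> \<beta>) (fst c) (snd c))) / real (q ^ \<nu>) + \<delta>)"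
        proof (rule sum_mono)
          fix c assume c: "c \<in> cells J"
          have sb: "shift (fst c) (snd c) -` region_o \<alpha> \<beta> \<in> sets borel"
            using measurable_sets[OF shift_measurable ob] by simp
          have "measure box_measure (shift (fst c) (snd c) -` O') \<le> measure box_measure (shift (fst c) (snd c) -` region_o \<alpha> \<beta>)"
            by (rule box_measure.finite_measure_mono) (use sb in \<open>auto simp: O'_def\<close>)
          then have "kappa q * measure box_measure (shift (fst c) (snd c) -` O') \<le> kappa q * measure box_measure (shift (fst c) (snd c) -` region_o \<alpha> \<beta>)"
            using k0 by (intro mult_left_mono) auto
          then show "kappa q * measure box_measure (shift (fst c) (snd c) -` O') \<le> 
             real (card (cell_points q \<nu> (region_o \<alpha> \<beta>) (fst c) (snd c))) / real (q ^ \<nu>) + \<delta>"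
            using bspec[OF elim c] by linarith
        qed
        also have "\<dots> = (\<Sum>c\<in>cells J. real (card (cell_points q \<nu> (region_o \<alpha> \<beta>) (fst c) (snd c)))) / real (q ^ \<nu>) + real (card (cells J)) * \<delta>"
          by (simp add: sum.distrib sum_divide_distrib)
        also have "(\<Sum>c\<in>cells J. real (card (cell_points q \<nu> (region_o \<alpha> \<beta>) (fst c) (snd c)))) / real (q ^ \<nu>) \<le> H \<nu> / real (q ^ \<nu>)"
        proof (rule divide_right_mono)
          have "(\<Sum>c\<in>cells J. real (card (cell_points q \<nu> (region_o \<alpha> \<beta>) (fst c) (snd c)))) \<le> 
             real (card (scount (int (q ^ \<nu>)) (trace_range (q ^ \<nu>) \<alpha> \<beta>)))"
            using scount_card_ge[OF q, where \<nu> = \<nu> and \<alpha> = \<alpha> and \<beta> = \<beta> and J = J] unfolding case_prod_unfold .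
          also have "\<dots> \<le> H \<nu>" unfolding H_def by (rule hurwitz_sum_bounds(2)[OF finite_trace_range])
          finally show "(\<Sum>c\<in>cells J. real (card (cell_points q \<nu> (region_o \<alpha> \<beta>) (fst c) (snd c)))) \<le> H \<nu>" .
        qed simp
        finally show ?case using dc by linarith
      qed
    qed
    have upper: "eventually (\<lambda>\<nu>. H \<nu> / real (q ^ \<nu>) < kappa q * V + e) sequentially"
    proof -
      obtain J :: nat where J: "J \<ge> 1" "200 / real J < e / 2"
      proof -
        obtain n :: nat where n: "400 / e < real n" using reals_Archimedean2 by blast
        then have "n > 0" using e by (cases n) (auto simp: field_simps)
        moreover have "200 / real n < e / 2" using n e \<open>n > 0\<close> by (simp add: field_simps)
        ultimately show ?thesis using that[of n] by simp
      qed
      define \<delta> where "\<delta> = e / (2 * (real (card (cells J)) + 1))"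
      have d0: "\<delta> > 0" using e by (simp add: \<delta>_def)
      have dc: "real (card (cells J)) * \<delta> < e / 2" using e by (simp add: \<delta>_def field_simps)
      have "eventually (\<lambda>\<nu>. real (card (cell_points q \<nu> (region_c \<alpha> \<beta>) j l)) / real (q ^ \<nu>) \<le> 
          kappa q * measure box_measure (shift j l -` region_c \<alpha> \<beta>) + \<delta>) sequentially" for j l
      proof -
        have cl: "closed (shift j l -` region_c \<alpha> \<beta>)" by (intro closed_vimage closed_region_c continuous_shift)
        then have sb: "shift j l -` region_c \<alpha> \<beta> \<in> sets borel" by (rule borel_closed)
        \<comment> \<open>The preimage is closed but unbounded. Intersecting it with the box makes
          it compact and loses no point, because all rescaled points lie in the box.\<close>
        have "compact (unit_box \<inter> shift j l -` region_c \<alpha> \<beta>)" by (intro compact_Int_closed compact_unit_box cl)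
        then have "eventually (\<lambda>\<nu>. real (card {p\<in>points q \<nu>. scaled q \<nu> p \<in> unit_box \<inter> shift j l -` region_c \<alpha> \<beta>}) / real (q ^ \<nu>) \<le> 
          kappa q * measure box_measure (unit_box \<inter> shift j l -` region_c \<alpha> \<beta>) + \<delta>) sequentially"
          by (rule points_compact_upper[OF q _ _ d0]) auto
        then show ?thesis
        proof eventually_elim
          case (elim \<nu>)
          have pts: "{p\<in>points q \<nu>. scaled q \<nu> p \<in> unit_box \<inter> shift j l -` region_c \<alpha> \<beta>} = cell_points q \<nu> (region_c \<alpha> \<beta>) j l"
            using scaled_in_unit_box by (auto simp: cell_points_def)
          have "measure box_measure (unit_box \<inter> shift j l -` region_c \<alpha> \<beta>) \<le> measure box_measure (shift j l -` region_c \<alpha> \<beta>)"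
            by (rule box_measure.finite_measure_mono) (use sb in auto)
          then have "kappa q * measure box_measure (unit_box \<inter> shift j l -` region_c \<alpha> \<beta>) \<le> kappa q * measure box_measure (shift j l -` region_c \<alpha> \<beta>)"
            using k0 by (intro mult_left_mono) auto
          then show ?case using elim unfolding pts by linarith
        qed
      qed
      then have "eventually (\<lambda>\<nu>. \<forall>c\<in>cells J. real (card (cell_points q \<nu> (region_c \<alpha> \<beta>) (fst c) (snd c))) / real (q ^ \<nu>) \<le> 
          kappa q * measure box_measure (shift (fst c) (snd c) -` region_c \<alpha> \<beta>) + \<delta>) sequentially"
        by (intro eventually_ball_finite ballI) auto
      then show ?thesis
      proof eventually_elim
        case (elim \<nu>)
        have "H \<nu> \<le> real (card (wcount (int (q ^ \<nu>)) (trace_range (q ^ \<nu>) \<alpha> \<beta>)))"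
          unfolding H_def by (rule hurwitz_sum_bounds(1)[OF finite_trace_range])
        also have "\<dots> \<le> (\<Sum>c\<in>cells J. real (card (cell_points q \<nu> (region_c \<alpha> \<beta>) (fst c) (snd c)))) + 200 / real J * real (q ^ \<nu>)"
          using wcount_card_le[OF q J(1), where \<nu> = \<nu> and \<alpha> = \<alpha> and \<beta> = \<beta>] unfolding case_prod_unfold .
        finally have "H \<nu> / real (q ^ \<nu>) \<le> ((\<Sum>c\<in>cells J. real (card (cell_points q \<nu> (region_c \<alpha> \<beta>) (fst c) (snd c)))) + 200 / real J * real (q ^ \<nu>)) / real (q ^ \<nu>)"
          by (rule divide_right_mono) simp
        also have "\<dots> = (\<Sum>c\<in>cells J. real (card (cell_points q \<nu> (region_c \<alpha> \<beta>) (fst c) (snd c))) / real (q ^ \<nu>)) + 200 / real J"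
          using m0[of \<nu>] by (simp only: add_divide_distrib sum_divide_distrib nonzero_mult_div_cancel_right less_imp_neq[symmetric] not_False_eq_True)
        also have "(\<Sum>c\<in>cells J. real (card (cell_points q \<nu> (region_c \<alpha> \<beta>) (fst c) (snd c))) / real (q ^ \<nu>)) \<le> 
            (\<Sum>c\<in>cells J. kappa q * measure box_measure (shift (fst c) (snd c) -` region_c \<alpha> \<beta>) + \<delta>)"
          by (rule sum_mono) (use elim in auto)
        also have "\<dots> = kappa q * (\<Sum>(j,l)\<in>cells J. measure box_measure (shift j l -` region_c \<alpha> \<beta>)) + real (card (cells J)) * \<delta>"
          by (simp add: sum.distrib sum_distrib_left case_prod_unfold)
        also have "kappa q * (\<Sum>(j,l)\<in>cells J. measure box_measure (shift j l -` region_c \<alpha> \<beta>)) \<le> kappa q * V"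
          using k0 by (intro mult_left_mono sum_cells_measure_le[OF cb Vc V0]) auto
        finally show ?case using dc J(2) by linarith
      qed
    qed
    show "eventually (\<lambda>\<nu>. dist (H \<nu> / real (q ^ \<nu>)) (kappa q * V) < e) sequentially"
      using lower upper by eventually_elim (auto simp: dist_real_def abs_less_iff)
  qed
  then show ?thesis by (simp only: H_def V_def)
qed

lemma integral_semicircle: "integral {-1..1} (\<lambda>x::real. sqrt (1 - x^2)) = pi / 2"
proof -
  have "((\<lambda>x. sqrt (1 - x^2)) has_integral ((arcsin 1 + 1 * sqrt (1 - 1^2)) / 2 - (arcsin (-1) + (-1) * sqrt (1 - (-1)^2)) / 2)) {-1..1}"
  \<comment> \<open>The summands arcsin x and x sqrt(1 - x^2) are not differentiable at the
    endpoints, hence the version with derivatives in the open interval only.\<close>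
  proof (rule fundamental_theorem_of_calculus_interior)
    show "continuous_on {-1..1} (\<lambda>x::real. (arcsin x + x * sqrt (1 - x^2)) / 2)"
      by (intro continuous_intros) auto
    fix x :: real assume x: "x \<in> {-1<..<1}"
    then have x2: "1 - x^2 > 0" by (simp add: abs_square_less_1 abs_less_iff)
    define r where "r = sqrt (1 - x^2)"
    have r: "r > 0" "r^2 = 1 - x^2" using x2 by (auto simp: r_def)
    have "((\<lambda>x. (arcsin x + x * sqrt (1 - x^2)) / 2) has_real_derivative 
       (inverse r + (1 * r + (inverse r / 2 * (0 - 2 * x)) * x)) / 2) (at x)"
      unfolding r_def using x x2 by (auto intro!: derivative_eq_intros)
    moreover have "(inverse r + (1 * r + (inverse r / 2 * (0 - 2 * x)) * x)) / 2 = r"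
    proof -
      have "(inverse r + (1 * r + (inverse r / 2 * (0 - 2 * x)) * x)) / 2 = (inverse r * (1 - x^2) + r) / 2"
        by (simp add: algebra_simps power2_eq_square)
      also have "inverse r * (1 - x^2) = r" unfolding r(2)[symmetric] using r(1) by (simp add: power2_eq_square)
      finally show ?thesis by simp
    qed
    ultimately have "((\<lambda>x. (arcsin x + x * sqrt (1 - x^2)) / 2) has_real_derivative r) (at x)" by (simp only:)
    then show "((\<lambda>x. (arcsin x + x * sqrt (1 - x^2)) / 2) has_vector_derivative sqrt (1 - x^2)) (at x)"
      unfolding r_def by (simp only: has_real_derivative_iff_has_vector_derivative)
  qed simp
  then have "((\<lambda>x::real. sqrt (1 - x^2)) has_integral pi / 2) {-1..1}" by simp
  then show ?thesis by (rule integral_unique)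
qed

theorem theorem1p2:
  fixes q :: nat and \<alpha> \<beta> :: real
  assumes "prime q" and "-1 \<le> \<alpha>" and "\<alpha> < \<beta>" and "\<beta> \<le> 1"
  shows "((\<lambda>\<nu>. mu (q^\<nu>) {\<alpha>..\<beta>} / mu (q^\<nu>) {-1..1})
           \<longlonglongrightarrow> 2 / pi * integral {\<alpha>..\<beta>} (\<lambda>x. sqrt (1 - x^2))) \<and>
         ((\<lambda>\<nu>. (1 - 1 / real q) / (2 * real q ^ \<nu>) *
            (\<Sum>t\<in>{t::int. t^2 < 4 * int q ^ \<nu> \<and>
                  \<alpha> \<le> real_of_int t / (2 * sqrt (real q ^ \<nu>)) \<and>
                  real_of_int t / (2 * sqrt (real q ^ \<nu>)) \<le> \<beta>}.
               hurwitz (4 * int q ^ \<nu> - t^2)))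
           \<longlonglongrightarrow> 2 / pi * integral {\<alpha>..\<beta>} (\<lambda>x. sqrt (1 - x^2)))"
proof -
  have q1: "q > 1" using assms(1) prime_gt_1_nat by blast
  have k0: "kappa q > 0" by (rule kappa_pos[OF q1])
  define I where "I = integral {\<alpha>..\<beta>} (\<lambda>x. sqrt (1 - x^2))"
  define c where "c = (\<lambda>\<nu> a b. (\<Sum>t\<in>trace_range (q ^ \<nu>) a b. hurwitz (4 * int (q ^ \<nu>) - t^2)) / real (q ^ \<nu>))"
  have lim: "(\<lambda>\<nu>. c \<nu> \<alpha> \<beta>) \<longlonglongrightarrow> kappa q * (2 * pi / 3 * I)"
    unfolding c_def I_def by (rule hurwitz_average[OF assms])
  have lim1: "(\<lambda>\<nu>. c \<nu> (-1) 1) \<longlonglongrightarrow> kappa q * (2 * pi / 3 * (pi / 2))"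
    unfolding c_def integral_semicircle[symmetric] by (rule hurwitz_average[OF assms(1)]) auto
  have mu_eq: "mu (q ^ \<nu>) {a..b} = (\<Sum>t\<in>trace_range (q ^ \<nu>) a b. hurwitz (4 * int (q ^ \<nu>) - t^2))" for \<nu> a b
    by (simp add: mu_def trace_range_def)
  have "mu (q ^ \<nu>) {\<alpha>..\<beta>} / mu (q ^ \<nu>) {-1..1} = c \<nu> \<alpha> \<beta> / c \<nu> (-1) 1" for \<nu>
    unfolding mu_eq c_def using q1 by simp
  moreover have "(\<lambda>\<nu>. c \<nu> \<alpha> \<beta> / c \<nu> (-1) 1) \<longlonglongrightarrow> kappa q * (2 * pi / 3 * I) / (kappa q * (2 * pi / 3 * (pi / 2)))"
    using k0 by (intro tendsto_divide lim lim1) auto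
  moreover have "kappa q * (2 * pi / 3 * I) / (kappa q * (2 * pi / 3 * (pi / 2))) = 2 / pi * I"
    using k0 by (simp add: field_simps)
  ultimately have first: "(\<lambda>\<nu>. mu (q ^ \<nu>) {\<alpha>..\<beta>} / mu (q ^ \<nu>) {-1..1}) \<longlonglongrightarrow> 2 / pi * I" by simp
  have scaled_lim: "(\<lambda>\<nu>. (1 - 1 / real q) / 2 * c \<nu> \<alpha> \<beta>) \<longlonglongrightarrow> (1 - 1 / real q) / 2 * (kappa q * (2 * pi / 3 * I))"
    by (intro tendsto_intros lim)
  have const_eq: "(1 - 1 / real q) / 2 * (kappa q * (2 * pi / 3 * I)) = 2 / pi * I"
  \<comment> \<open>Here (1 - 1/q) \<open>kappa q\<close> = 6/pi^2, and (6/pi^2)(pi/3) = 2/pi, so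
    the dependence on q cancels.\<close>
  proof -
    have "d * (r / d) = r" if "d \<noteq> 0" for d r :: real using that by simp
    moreover have "1 - 1 / real q \<noteq> 0" using q1 by simp
    ultimately have k: "(1 - 1 / real q) * kappa q = 6 / pi\<^sup>2" unfolding kappa_def by blast
    have "(1 - 1 / real q) / 2 * (kappa q * (2 * pi / 3 * I)) = ((1 - 1 / real q) * kappa q) * (pi / 3 * I)" by simp
    also have "\<dots> = 2 / pi * I" unfolding k by (simp add: power2_eq_square)
    finally show ?thesis .
  qed
  have summand: "(1 - 1 / real q) / 2 * c \<nu> \<alpha> \<beta> = (1 - 1 / real q) / (2 * real q ^ \<nu>) *
            (\<Sum>t\<in>{t::int. t^2 < 4 * int q ^ \<nu> \<and>
                  \<alpha> \<le> real_of_int t / (2 * sqrt (real q ^ \<nu>)) \<and>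
                  real_of_int t / (2 * sqrt (real q ^ \<nu>)) \<le> \<beta>}.
               hurwitz (4 * int q ^ \<nu> - t^2))" for \<nu>
    by (simp add: c_def trace_range_def)
  from first scaled_lim[unfolded const_eq summand] show ?thesis unfolding I_def by (rule conjI)
qed

end
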